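(* Let $N\ge 3$, $p>2$, and let $h,V\in C(\mathbb{R}^N)$ with $V^+\not\equiv 0$ and $h^+\not\equiv 0$. Suppose that $D^{1,2}(\mathbb{R}^N)$ is compactly embedded in $L^p(\mathbb{R}^N,h^-)$, that $D^{1,2}(\mathbb{R}^N)\cap L^p(\mathbb{R}^N,h^+)$ is compactly embedded in $L^2(\mathbb{R}^N,V^+)$, and that $\lambda_1(\mathbb{R}^N,V,h)$ is finite. Let $\Omega^{-0}=\{x\in\mathbb{R}^N:h(x)\le 0\}$ and for $\mu\in\mathbb{R}$ let $h_\mu:=\mu h^+-h^-$. Then $$\lambda_1(\mathbb{R}^N,V,h_\mu)\to\lambda_1(\Omega^{-0},V)\quad\text{as }\mu\to\infty.$$ Moreover, if $\lambda_1(\Omega^{-0},V)<\infty$, then $\lambda_1(\Omega^{-0},V)$ is attained.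
   Context: Integrals without indicated domain are over $\mathbb{R}^N$ with Lebesgue measure. For a function $f$, $f^+=\max(0,f)$ and $f^-=f^+-f$. $2^*=2N/(N-2)$. $D^{1,2}(\mathbb{R}^N)$ is the closure of $C_c^\infty(\mathbb{R}^N)$ in $L^{2^*}(\mathbb{R}^N)$ with respect to the norm $\|\nabla u\|_2=(\int|\nabla u|^2)^{1/2}$. For measurable $k\ge 0$, $L^q(\Omega,k)$ is the space of measurable $u$ with $\|u\|_{L^q(\Omega,k)}^q=\int_\Omega k|u|^q<\infty$ (functions equal $k\,dx$-a.e. identified). Intersections of such spaces carry the sum of the norms. For measurable $\Omega\subset\mathbb{R}^N$, $D^{1,2}(\Omega)=\{u\in D^{1,2}(\mathbb{R}^N): u=0 \text{ a.e. on }\mathbb{R}^N\setminus\Omega\}$. $\lambda_1(\Omega,V)=\inf\{\|\nabla u\|_2^2: u\in D^{1,2}(\Omega)\cap L^2(\mathbb{R}^N,|V|),\ \int V|u|^2=1\}$. For continuous $k$, $\lambda_1(\Omega,V,k)=\inf\{\|\nabla u\|_2^2: u\in D^{1,2}(\Omega)\cap L^2(\mathbb{R}^N,|V|)\cap L^p(\mathbb{R}^N,|k|),\ \int V|u|^2=1,\ \int k|u|^p\le 0\}$. Both quantities are set equal to $+\infty$ if the infimum is over the empty set; "attained" means that the infimum is a minimum. *)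

theory Defs
  imports "HOL-Analysis.Analysis"
begin

text \<open>
  The space \<open>\<real>\<^sup>N\<close> is \<^typ>\<open>real ^ 'n\<close> with \<open>N = CARD('n)\<close>. Functions on it are real-valued, ``measurable''
  means Lebesgue measurable, and elements of function spaces are represented by functions, not
  by equivalence classes.
\<close>

section \<open>Test functions and weak gradients\<close>

definition partial_deriv :: "'n \<Rightarrow> (real ^ 'n \<Rightarrow> real) \<Rightarrow> real ^ 'n \<Rightarrow> real" where
  "partial_deriv i f x = frechet_derivative f (at x) (axis i 1)"

primrec C_diff :: "nat \<Rightarrow> (real ^ 'n \<Rightarrow> real) \<Rightarrow> bool" where
  "C_diff 0 f \<longleftrightarrow> continuous_on UNIV f"
| "C_diff (Suc m) f \<longleftrightarrow> f differentiable_on UNIV \<and> (\<forall>i. C_diff m (partial_deriv i f))"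

definition test_functions :: "(real ^ 'n \<Rightarrow> real) set" where
  "test_functions = {\<phi>. (\<forall>m. C_diff m \<phi>) \<and> compact (closure {x. \<phi> x \<noteq> 0})}"

definition locally_integrable :: "(real ^ 'n \<Rightarrow> 'b::euclidean_space) \<Rightarrow> bool" where
  "locally_integrable f \<longleftrightarrow> (\<forall>K. compact K \<longrightarrow> set_integrable lebesgue K f)"

definition has_weak_gradient :: "(real ^ 'n \<Rightarrow> real) \<Rightarrow> (real ^ 'n \<Rightarrow> real ^ 'n) \<Rightarrow> bool" where
  "has_weak_gradient u g \<longleftrightarrow> locally_integrable u \<and> locally_integrable g \<and>
     (\<forall>\<phi>\<in>test_functions. \<forall>i.
        (LINT x|lebesgue. u x * partial_deriv i \<phi> x) = - (LINT x|lebesgue. g x $ i * \<phi> x))"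

text \<open>Weak gradients are unique only up to null sets, so this picks one representative.\<close>

definition weak_grad :: "(real ^ 'n \<Rightarrow> real) \<Rightarrow> real ^ 'n \<Rightarrow> real ^ 'n" where
  "weak_grad u = (SOME g. has_weak_gradient u g)"

text \<open>The norm \<open>\<parallel>\<nabla>u\<parallel>\<^sub>2\<close>; only meaningful for \<open>u\<close> with a square integrable weak gradient.\<close>

definition grad_norm :: "(real ^ 'n \<Rightarrow> real) \<Rightarrow> real" where
  "grad_norm u = sqrt (LINT x|lebesgue. (norm (weak_grad u x))\<^sup>2)"

section \<open>Function spaces\<close>

definition Lq :: "real \<Rightarrow> (real ^ 'n \<Rightarrow> real) \<Rightarrow> (real ^ 'n \<Rightarrow> real) set" where
  "Lq q k = {u. u \<in> borel_measurable lebesgue \<and> integrable lebesgue (\<lambda>x. k x * \<bar>u x\<bar> powr q)}"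

definition Lq_norm :: "real \<Rightarrow> (real ^ 'n \<Rightarrow> real) \<Rightarrow> (real ^ 'n \<Rightarrow> real) \<Rightarrow> real" where
  "Lq_norm q k u = (LINT x|lebesgue. k x * \<bar>u x\<bar> powr q) powr (1 / q)"

definition sobolev_exponent :: "'n itself \<Rightarrow> real" where
  "sobolev_exponent _ = 2 * real CARD('n) / (real CARD('n) - 2)"

text \<open>
  The closure of the test functions, with respect to \<^const>\<open>grad_norm\<close>, among the functions in
  \<open>L\<^bsup>2*\<^esup>\<close> for which that norm is defined and finite.
\<close>

definition D12 :: "(real ^ 'n) set \<Rightarrow> (real ^ 'n \<Rightarrow> real) set" where
  "D12 \<Omega> = {u \<in> Lq (sobolev_exponent TYPE('n)) (\<lambda>_. 1).
     (\<exists>g. has_weak_gradient u g \<and> integrable lebesgue (\<lambda>x. (norm (g x))\<^sup>2)) \<and>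
     (\<exists>\<phi>. (\<forall>n. \<phi> n \<in> test_functions) \<and> (\<lambda>n. grad_norm (\<lambda>x. u x - \<phi> n x)) \<longlonglongrightarrow> 0) \<and>
     (AE x in lebesgue. x \<notin> \<Omega> \<longrightarrow> u x = 0)}"

text \<open>
  Compactness of the inclusion map from \<open>X\<close> with (semi)norm \<open>nX\<close> to \<open>Y\<close> with (semi)norm \<open>nY\<close>. Since functions
  represent their equivalence classes, limits are determined only up to \<open>nY\<close>-null functions.
\<close>

definition compactly_embedded ::
  "('a \<Rightarrow> real) set \<Rightarrow> (('a \<Rightarrow> real) \<Rightarrow> real) \<Rightarrow> ('a \<Rightarrow> real) set \<Rightarrow> (('a \<Rightarrow> real) \<Rightarrow> real) \<Rightarrow> bool" where
  "compactly_embedded X nX Y nY \<longleftrightarrow>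
     X \<subseteq> Y \<and> (\<exists>C. \<forall>u\<in>X. nY u \<le> C * nX u) \<and>
     (\<forall>f::nat \<Rightarrow> 'a \<Rightarrow> real. (\<forall>n. f n \<in> X) \<and> (\<exists>B. \<forall>n. nX (f n) \<le> B) \<longrightarrow>
        (\<exists>r u. strict_mono r \<and> u \<in> Y \<and> (\<lambda>n. nY (\<lambda>x. f (r n) x - u x)) \<longlonglongrightarrow> 0))"

section \<open>The variational quantities\<close>

definition pos_part :: "('a \<Rightarrow> real) \<Rightarrow> 'a \<Rightarrow> real" where
  "pos_part f x = max 0 (f x)"

definition neg_part :: "('a \<Rightarrow> real) \<Rightarrow> 'a \<Rightarrow> real" where
  "neg_part f x = pos_part f x - f x"

definition admissible :: "(real ^ 'n) set \<Rightarrow> (real ^ 'n \<Rightarrow> real) \<Rightarrow> (real ^ 'n \<Rightarrow> real) set" where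
  "admissible \<Omega> V =
     {u \<in> D12 \<Omega> \<inter> Lq 2 (\<lambda>x. \<bar>V x\<bar>). (LINT x|lebesgue. V x * \<bar>u x\<bar>\<^sup>2) = 1}"

definition lambda1 :: "(real ^ 'n) set \<Rightarrow> (real ^ 'n \<Rightarrow> real) \<Rightarrow> ereal" where
  "lambda1 \<Omega> V = (INF u\<in>admissible \<Omega> V. ereal ((grad_norm u)\<^sup>2))"

definition lambda1_attained :: "(real ^ 'n) set \<Rightarrow> (real ^ 'n \<Rightarrow> real) \<Rightarrow> bool" where
  "lambda1_attained \<Omega> V \<longleftrightarrow> (\<exists>u\<in>admissible \<Omega> V. lambda1 \<Omega> V = ereal ((grad_norm u)\<^sup>2))"

definition admissible_k :: "real \<Rightarrow> (real ^ 'n) set \<Rightarrow> (real ^ 'n \<Rightarrow> real) \<Rightarrow>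
    (real ^ 'n \<Rightarrow> real) \<Rightarrow> (real ^ 'n \<Rightarrow> real) set" where
  "admissible_k p \<Omega> V k =
     {u \<in> D12 \<Omega> \<inter> Lq 2 (\<lambda>x. \<bar>V x\<bar>) \<inter> Lq p (\<lambda>x. \<bar>k x\<bar>).
        (LINT x|lebesgue. V x * \<bar>u x\<bar>\<^sup>2) = 1 \<and> (LINT x|lebesgue. k x * \<bar>u x\<bar> powr p) \<le> 0}"

definition lambda1_k :: "real \<Rightarrow> (real ^ 'n) set \<Rightarrow> (real ^ 'n \<Rightarrow> real) \<Rightarrow>
    (real ^ 'n \<Rightarrow> real) \<Rightarrow> ereal" where
  "lambda1_k p \<Omega> V k = (INF u\<in>admissible_k p \<Omega> V k. ereal ((grad_norm u)\<^sup>2))"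

end

theory Submission
  imports Defs "HOL-Computational_Algebra.Polynomial"
begin

text \<open>
  Write \<open>\<lambda>(\<mu>)\<close> for the penalised infimum and \<open>\<Lambda>\<close> for the infimum over functions that vanish where \<open>h > 0\<close>.
  Functions admissible for \<open>\<Lambda>\<close> are admissible for every \<open>\<lambda>(\<mu>)\<close>, and for \<open>\<mu> \<ge> 0\<close> raising \<open>\<mu>\<close> shrinks the
  admissible class; hence \<open>\<lambda>\<close> increases and stays below \<open>\<Lambda>\<close>. Both claims follow from one
  compactness statement, \<open>penalised_bound_imp_admissible\<close>: if \<open>\<lambda>(n) \<le> L\<close> for all positive integers \<open>n\<close>, then some function
  admissible for \<open>\<Lambda>\<close> has energy at most \<open>L\<close>. Applied below \<open>\<Lambda>\<close> it excludes a smaller limit, and applied with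
  \<open>L = \<Lambda>\<close> it yields a minimiser.

  For that statement take almost minimisers \<open>u\<^sub>n\<close> of \<open>\<lambda>(n)\<close>. Their energies are bounded, so their \<open>h\<^sup>-\<close> integrals
  are bounded by the first embedding, and the constraint \<open>n \<integral>h\<^sup>+\<bar>u\<^sub>n\<bar>\<^sup>p \<le> \<integral>h\<^sup>-\<bar>u\<^sub>n\<bar>\<^sup>p\<close>
  forces the \<open>h\<^sup>+\<close> integrals to \<open>0\<close>. The second embedding gives a subsequence converging in \<open>L\<^sup>2(V\<^sup>+)\<close>.
  Instead of weak limits, the proof minimises the energy over the nested convex sets of functions that satisfy the
  limiting constraints up to an error \<open>\<epsilon>\<close> (\<open>nested_energy_minimisation\<close>): the parallelogram identity turns
  almost minimisers into a Cauchy sequence for the energy. Its limit vanishes where \<open>h > 0\<close> and satisfies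
  \<open>\<integral>V u\<^sup>2 \<ge> 1\<close> by Fatou's lemma, so that dividing by the square root of this integral restores the
  normalisation without raising the energy.

  The limit exists in the right space because \<open>D\<^sup>1\<^sup>,\<^sup>2\<close> is complete (\<open>D12_complete\<close>). This rests
  on Sobolev's inequality for test functions, proved by Gagliardo's method (\<open>gagliardo_lborel\<close>,
  \<open>sobolev_inequality_C1_compact\<close>), and on two uniqueness facts: weak gradients are unique almost everywhere
  (from the fundamental lemma of the calculus of variations), and a function that is integrable to some power
  \<open>q \<ge> 1\<close> and has weak gradient \<open>0\<close> vanishes (\<open>weak_gradient_0_imp_AE_0\<close>). The second fact identifies an
  element of \<open>D\<^sup>1\<^sup>,\<^sup>2\<close> with the limit of the test functions that approximate it.
\<close>

section \<open>Smooth bump functions\<close>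

lemma partial_deriv_eq:
  fixes f :: "real ^ 'n \<Rightarrow> real"
  assumes "(f has_derivative D) (at x)"
  shows "partial_deriv i f x = D (axis i 1)"
  using frechet_derivative_at[OF assms] by (simp add: partial_deriv_def)

lemma partial_deriv_add:
  fixes f g :: "real ^ 'n \<Rightarrow> real"
  assumes "f differentiable (at x)" "g differentiable (at x)"
  shows "partial_deriv i (\<lambda>x. f x + g x) x = partial_deriv i f x + partial_deriv i g x"
  using has_derivative_add[OF assms[unfolded frechet_derivative_works]]
  by (subst partial_deriv_eq) (auto simp: partial_deriv_def)

lemma partial_deriv_mult:
  fixes f g :: "real ^ 'n \<Rightarrow> real"
  assumes "f differentiable (at x)" "g differentiable (at x)"
  shows "partial_deriv i (\<lambda>x. f x * g x) x = f x * partial_deriv i g x + partial_deriv i f x * g x"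
  using has_derivative_mult[OF assms[unfolded frechet_derivative_works]]
  by (subst partial_deriv_eq) (auto simp: partial_deriv_def)

lemma C_diff_SucD: "C_diff (Suc m) f \<Longrightarrow> C_diff m f"
  by (induction m arbitrary: f) (auto intro: differentiable_imp_continuous_on)

lemma C_diff_const: "C_diff m (\<lambda>x::real^'n. c)"
proof (induction m arbitrary: c)
  case (Suc m)
  have "partial_deriv i (\<lambda>x::real^'n. c) = (\<lambda>x. 0)" for i
    by (rule ext, subst partial_deriv_eq) (auto intro: has_derivative_const)
  with Suc show ?case by auto
qed auto

lemma C_diff_add: "C_diff m f \<Longrightarrow> C_diff m g \<Longrightarrow> C_diff m (\<lambda>x::real^'n. f x + g x)"
proof (induction m arbitrary: f g)
  case (Suc m)
  have d: "f differentiable (at x)" "g differentiable (at x)" for x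
    using Suc.prems by (auto simp: differentiable_on_def)
  have "partial_deriv i (\<lambda>x. f x + g x) = (\<lambda>x. partial_deriv i f x + partial_deriv i g x)" for i
    using partial_deriv_add[OF d] by auto
  with Suc show ?case by auto
qed (auto intro: continuous_on_add)

lemma C_diff_mult: "C_diff m f \<Longrightarrow> C_diff m g \<Longrightarrow> C_diff m (\<lambda>x::real^'n. f x * g x)"
proof (induction m arbitrary: f g)
  case (Suc m)
  have d: "f differentiable (at x)" "g differentiable (at x)" for x
    using Suc.prems by (auto simp: differentiable_on_def)
  have "partial_deriv i (\<lambda>x. f x * g x) = (\<lambda>x. f x * partial_deriv i g x + partial_deriv i f x * g x)" for i
    using partial_deriv_mult[OF d] by auto
  moreover have "C_diff m f" "C_diff m g" using Suc.prems C_diff_SucD by blast+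
  ultimately show ?case using Suc by (auto intro!: C_diff_add)
qed (auto intro: continuous_on_mult)

lemma C_diff_prod:
  assumes "finite S" "\<And>s. s \<in> S \<Longrightarrow> C_diff m (f s)"
  shows "C_diff m (\<lambda>x::real^'n. \<Prod>s\<in>S. f s x)"
  using assms by (induction rule: finite_induct) (auto intro: C_diff_const C_diff_mult)

text \<open>
  The functions \<open>t \<mapsto> P(1/t) exp(-1/t)\<close> on the positive half line, extended by \<open>0\<close>. Allowing a
  polynomial factor makes the family closed under differentiation, so smoothness of all its members
  needs only one differentiation.
\<close>
definition flat :: "real poly \<Rightarrow> real \<Rightarrow> real" where
  "flat P t = (if t \<le> 0 then 0 else poly P (1 / t) * exp (- (1 / t)))"

lemma poly_times_exp_tendsto_0: "((\<lambda>y. poly P y * exp (- y)) \<longlongrightarrow> (0::real)) at_top"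
proof -
  have "((\<lambda>y. \<Sum>i\<le>degree P. coeff P i * (y ^ i / exp y)) \<longlongrightarrow> (\<Sum>i\<le>degree P. coeff P i * 0)) at_top"
    by (intro tendsto_intros tendsto_power_div_exp_0)
  then show ?thesis
    by (simp add: poly_altdef sum_distrib_right exp_minus divide_inverse mult.assoc)
qed

lemma flat_tendsto_0: "(flat P \<longlongrightarrow> 0) (at 0)"
proof -
  have inv: "filterlim (\<lambda>t. 1 / t) at_top (at_right (0::real))"
    using filterlim_inverse_at_top_right by (simp add: inverse_eq_divide)
  have "(flat P \<longlongrightarrow> 0) (at_right 0)"
    by (rule Lim_transform_eventually[OF filterlim_compose[OF poly_times_exp_tendsto_0[of P] inv]])
       (auto simp: flat_def eventually_at_filter)
  moreover have "(flat P \<longlongrightarrow> 0) (at_left 0)"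
    by (rule tendsto_eventually) (auto simp: flat_def eventually_at_filter)
  ultimately show ?thesis by (simp add: filterlim_at_split)
qed

lemma flat_has_derivative: "(flat P has_real_derivative flat ([:0, 0, 1:] * (P - pderiv P)) t) (at t)"
proof (cases t "0::real" rule: linorder_cases)
  case less
  have "((\<lambda>t. 0) has_real_derivative 0) (at t)" by simp
  moreover have "\<forall>\<^sub>F s in nhds t. s < 0" using less using eventually_nhds_in_open[of "{..<0}" t] by simp
  ultimately show ?thesis using less
    by (subst DERIV_cong_ev[where g = "\<lambda>t. 0"]) (auto simp: flat_def elim!: eventually_mono)
next
  case greater
  have "((\<lambda>t. poly P (1 / t) * exp (- (1 / t))) has_real_derivative
          (poly (pderiv P) (1 / t) * (- (1 / t\<^sup>2))) * exp (- (1 / t)) + exp (- (1 / t)) * (1 / t\<^sup>2) * poly P (1 / t)) (at t)"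
    using greater
    by (auto intro!: derivative_eq_intros DERIV_chain'[OF _ poly_DERIV] simp: power2_eq_square)
  also have "(poly (pderiv P) (1 / t) * (- (1 / t\<^sup>2))) * exp (- (1 / t)) + exp (- (1 / t)) * (1 / t\<^sup>2) * poly P (1 / t)
     = flat ([:0, 0, 1:] * (P - pderiv P)) t"
    using greater by (simp add: flat_def algebra_simps power2_eq_square)
  finally have D: "((\<lambda>t. poly P (1 / t) * exp (- (1 / t))) has_real_derivative flat ([:0, 0, 1:] * (P - pderiv P)) t) (at t)" .
  have "\<forall>\<^sub>F s in nhds t. 0 < s" using greater using eventually_nhds_in_open[of "{0<..}" t] by simp
  then show ?thesis
    using D greater by (subst DERIV_cong_ev[OF refl, where g = "\<lambda>t. poly P (1 / t) * exp (- (1 / t))"]) (auto simp: flat_def elim!: eventually_mono)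
next
  case equal
  have "((\<lambda>h. (flat P (0 + h) - flat P 0) / h) \<longlongrightarrow> 0) (at 0)"
    by (rule Lim_transform_eventually[OF flat_tendsto_0[of "[:0, 1:] * P"]])
       (auto simp: flat_def eventually_at_filter)
  then show ?thesis using equal by (simp add: DERIV_def flat_def)
qed

lemma C_diff_flat: "C_diff m (\<lambda>x::real^'n. flat P (c * x $ i + d))"
proof (induction m arbitrary: P)
  case 0
  have "continuous_on UNIV (flat P)"
    using flat_has_derivative by (intro DERIV_continuous_on) (blast intro: has_field_derivative_at_within)
  then show ?case
    by (auto intro!: continuous_intros intro: continuous_on_compose2)
next
  case (Suc m)
  let ?Q = "[:0, 0, 1:] * (P - pderiv P)"
  have d: "((\<lambda>x::real^'n. flat P (c * x $ i + d)) has_derivative (\<lambda>y. flat ?Q (c * x $ i + d) * (c * y $ i))) (at x)" for x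
  proof -
    have 1: "((\<lambda>x::real^'n. c * x $ i + d) has_derivative (\<lambda>y. c * y $ i)) (at x)"
      by (auto intro!: derivative_eq_intros bounded_linear.has_derivative[OF bounded_linear_vec_nth])
    show ?thesis
      using has_derivative_compose[OF 1 flat_has_derivative[unfolded has_field_derivative_def]]
      by (simp add: mult.commute)
  qed
  have "partial_deriv j (\<lambda>x::real^'n. flat P (c * x $ i + d)) =
      (\<lambda>x. flat ?Q (c * x $ i + d) * (c * axis j 1 $ i))" for j
    by (rule ext, rule partial_deriv_eq[OF d])
  moreover have "(\<lambda>x::real^'n. flat P (c * x $ i + d)) differentiable_on UNIV"
    using d by (auto simp: differentiable_on_def differentiable_def)
  ultimately show ?case using Suc by (auto intro!: C_diff_mult C_diff_const simp del: mult_pCons_left)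
qed

text \<open>The \<open>k\<close>-th of a sequence of test functions that tends pointwise to the indicator of the open box from \<open>a\<close> to \<open>b\<close>.\<close>
definition bump :: "real ^ 'n \<Rightarrow> real ^ 'n \<Rightarrow> nat \<Rightarrow> real ^ 'n \<Rightarrow> real" where
  "bump a b k x = (\<Prod>i\<in>UNIV. flat 1 (real k * x $ i + (- real k * a $ i)) * flat 1 (- real k * x $ i + real k * b $ i))"

lemma flat_1_bounds: "0 \<le> flat 1 t" "flat 1 t \<le> 1"
  by (auto simp: flat_def)

lemma bump_bounds: "0 \<le> bump a b k x" "bump a b k x \<le> 1"
  unfolding bump_def
  by (auto intro!: prod_nonneg prod_le_1 mult_nonneg_nonneg mult_le_one simp: flat_1_bounds)

lemma bump_outside: "x \<notin> cbox a b \<Longrightarrow> bump a b k x = 0"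
proof -
  assume "x \<notin> cbox a b"
  then obtain i where "x $ i < a $ i \<or> b $ i < x $ i" by (auto simp: mem_box_cart not_le)
  then have "real k * x $ i + - real k * a $ i \<le> 0 \<or> - real k * x $ i + real k * b $ i \<le> 0"
    by (auto intro: mult_left_mono)
  then show ?thesis unfolding bump_def by (intro prod_zero) (auto simp: flat_def)
qed

lemma flat_1_scaled_tendsto: "0 < t \<Longrightarrow> (\<lambda>k. flat 1 (real k * t)) \<longlonglongrightarrow> 1"
proof -
  assume t: "0 < t"
  have "(\<lambda>k. exp (- ((1 / t) * (1 / real k)))) \<longlonglongrightarrow> exp (- ((1 / t) * 0))"
    by (intro tendsto_intros lim_1_over_n)
  then have "(\<lambda>k. exp (- (1 / (real k * t)))) \<longlonglongrightarrow> 1" by (simp add: field_simps)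
  then show ?thesis
    by (rule Lim_transform_eventually)
       (use t in \<open>auto simp: flat_def eventually_sequentially mult_le_0_iff intro!: exI[of _ 1]\<close>)
qed

lemma bump_tendsto_indicator: "(\<lambda>k. bump a b k x) \<longlonglongrightarrow> indicator (box a b) x"
proof (cases "x \<in> box a b")
  case True
  then have "(\<lambda>k. \<Prod>i\<in>UNIV. flat 1 (real k * (x $ i - a $ i)) * flat 1 (real k * (b $ i - x $ i))) \<longlonglongrightarrow> (\<Prod>i\<in>(UNIV::'a set). 1 * 1)"
    by (intro tendsto_intros flat_1_scaled_tendsto) (auto simp: mem_box_cart)
  then show ?thesis using True by (simp add: bump_def algebra_simps)
next
  case False
  then obtain i where "x $ i \<le> a $ i \<or> b $ i \<le> x $ i" by (auto simp: mem_box_cart not_less)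
  then have "real k * x $ i + - real k * a $ i \<le> 0 \<or> - real k * x $ i + real k * b $ i \<le> 0" for k
    by (auto intro: mult_left_mono)
  then have "bump a b k x = 0" for k unfolding bump_def by (intro prod_zero) (auto simp: flat_def)
  then show ?thesis using False by simp
qed

lemma bump_test_function: "bump a b k \<in> test_functions"
proof -
  have "C_diff m (bump a b k)" for m
    unfolding bump_def[abs_def] by (intro C_diff_prod C_diff_mult C_diff_flat) auto
  moreover have "{x. bump a b k x \<noteq> 0} \<subseteq> cbox a b" using bump_outside by blast
  then have "compact (closure {x. bump a b k x \<noteq> 0})"
    by (meson bounded_cbox bounded_closure bounded_subset closed_closure compact_eq_bounded_closed)
  ultimately show ?thesis by (auto simp: test_functions_def)
qed


section \<open>Continuously differentiable functions of compact support\<close>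

text \<open>
  The regularity that integration by parts and Sobolev's inequality use. The class is closed under products and
  translations and contains the test functions.
\<close>
definition C1_compact :: "(real ^ 'n \<Rightarrow> real) set" where
  "C1_compact = {\<phi>. C_diff 1 \<phi> \<and> compact (closure {x. \<phi> x \<noteq> 0})}"

lemma test_functions_C1_compact: "\<phi> \<in> test_functions \<Longrightarrow> \<phi> \<in> C1_compact"
  unfolding test_functions_def C1_compact_def by blast

lemma C1_compact_continuous: "\<phi> \<in> C1_compact \<Longrightarrow> continuous_on UNIV \<phi>"
  and C1_compact_differentiable: "\<phi> \<in> C1_compact \<Longrightarrow> \<phi> differentiable (at x)"
  and C1_compact_partial_continuous: "\<phi> \<in> C1_compact \<Longrightarrow> continuous_on UNIV (partial_deriv i \<phi>)"
  by (auto simp: C1_compact_def differentiable_on_def intro: differentiable_imp_continuous_on)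

lemma compact_support_subset:
  assumes "compact (closure {x. \<phi> x \<noteq> (0::real)})" "\<And>x. \<psi> x \<noteq> (0::real) \<Longrightarrow> x \<in> closure {x. \<phi> x \<noteq> 0}"
  shows "compact (closure {x::real^'n. \<psi> x \<noteq> 0})"
proof -
  have "closure {x. \<psi> x \<noteq> 0} \<subseteq> closure {x. \<phi> x \<noteq> 0}" using assms(2) by (intro closure_minimal) auto
  then show ?thesis using assms(1) bounded_subset by (auto simp: compact_eq_bounded_closed)
qed

lemma partial_deriv_outside_support:
  assumes "x \<notin> closure {x. \<phi> x \<noteq> 0}"
  shows "partial_deriv i \<phi> x = 0"
proof -
  have "((\<lambda>x. 0) has_derivative (\<lambda>x. 0)) (at x)" by simp
  then have "(\<phi> has_derivative (\<lambda>x. 0)) (at x)"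
    by (rule has_derivative_transform_within_open[where s = "- closure {x. \<phi> x \<noteq> 0}"])
      (use assms closure_subset[of "{x. \<phi> x \<noteq> 0}"] in auto)
  then show ?thesis by (subst partial_deriv_eq) auto
qed

lemma test_functions_partial_deriv:
  assumes "\<phi> \<in> test_functions"
  shows "partial_deriv i \<phi> \<in> test_functions"
proof -
  have c: "compact (closure {x. \<phi> x \<noteq> 0})" and "C_diff (Suc m) \<phi>" for m
    using assms unfolding test_functions_def by blast+
  then have "C_diff m (partial_deriv i \<phi>)" for m by simp
  moreover have "compact (closure {x. partial_deriv i \<phi> x \<noteq> 0})"
    by (rule compact_support_subset[OF c]) (use partial_deriv_outside_support in blast)
  ultimately show ?thesis unfolding test_functions_def by blast
qed

lemma compactly_supported_bounded:
  assumes "continuous_on UNIV \<phi>" "compact (closure {x::real^'n. \<phi> x \<noteq> (0::real)})"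
  obtains B R where "B \<ge> 0" "R > 0" "\<And>x. \<bar>\<phi> x\<bar> \<le> B" "\<And>x. R \<le> norm x \<Longrightarrow> \<phi> x = 0"
proof -
  let ?K = "closure {x. \<phi> x \<noteq> 0}"
  have "bounded (\<phi> ` ?K)"
    using assms by (intro compact_imp_bounded compact_continuous_image) (auto intro: continuous_on_subset)
  then obtain B where B: "\<And>x. x \<in> ?K \<Longrightarrow> \<bar>\<phi> x\<bar> \<le> B" by (auto simp: bounded_iff)
  obtain R where R: "R > 0" "\<And>x. x \<in> ?K \<Longrightarrow> norm x < R"
    using compact_imp_bounded[OF assms(2)] by (auto simp: bounded_pos_less)
  have in_K: "\<phi> x \<noteq> 0 \<Longrightarrow> x \<in> ?K" for x using closure_subset[of "{x. \<phi> x \<noteq> 0}"] by auto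
  show thesis
  proof (rule that[of "max B 0" R])
    show "\<bar>\<phi> x\<bar> \<le> max B 0" for x using B[of x] in_K[of x] by (cases "\<phi> x = 0") auto
    show "R \<le> norm x \<Longrightarrow> \<phi> x = 0" for x using in_K[of x] R(2)[of x] by fastforce
  qed (use R in auto)
qed

lemma C1_compact_bounds:
  assumes "\<phi> \<in> C1_compact"
  obtains B R where "B \<ge> 0" "R > 0" "\<And>x. \<bar>\<phi> x\<bar> \<le> B" "\<And>x. \<bar>partial_deriv i \<phi> x\<bar> \<le> B"
    "\<And>x. R \<le> norm x \<Longrightarrow> \<phi> x = 0" "\<And>x. R \<le> norm x \<Longrightarrow> partial_deriv i \<phi> x = 0"
proof -
  have c: "compact (closure {x. \<phi> x \<noteq> 0})" using assms by (simp add: C1_compact_def)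
  have "compact (closure {x. partial_deriv i \<phi> x \<noteq> 0})"
    by (rule compact_support_subset[OF c]) (use partial_deriv_outside_support in blast)
  from compactly_supported_bounded[OF C1_compact_partial_continuous[OF assms] this]
  obtain B R where 1: "B \<ge> 0" "R > 0" "\<And>x. \<bar>partial_deriv i \<phi> x\<bar> \<le> B" "\<And>x. R \<le> norm x \<Longrightarrow> partial_deriv i \<phi> x = 0"
    by blast
  from compactly_supported_bounded[OF C1_compact_continuous[OF assms] c]
  obtain B' R' where 2: "B' \<ge> 0" "R' > 0" "\<And>x. \<bar>\<phi> x\<bar> \<le> B'" "\<And>x. R' \<le> norm x \<Longrightarrow> \<phi> x = 0"
    by blast
  show thesis
  proof (rule that[of "max B B'" "max R R'"])
    show "\<bar>\<phi> x\<bar> \<le> max B B'" "\<bar>partial_deriv i \<phi> x\<bar> \<le> max B B'" for x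
      using 1(3)[of x] 2(3)[of x] by linarith+
  qed (use 1 2 in auto)
qed

lemma C1_compact_mult:
  assumes "\<phi> \<in> C1_compact" "\<psi> \<in> C1_compact"
  shows "(\<lambda>x. \<phi> x * \<psi> x) \<in> C1_compact"
proof -
  have c: "compact (closure {x. \<phi> x \<noteq> 0})" and "C_diff 1 \<phi>" "C_diff 1 \<psi>"
    using assms unfolding C1_compact_def by blast+
  have "compact (closure {x. \<phi> x * \<psi> x \<noteq> 0})"
    by (rule compact_support_subset[OF c]) (simp add: subsetD[OF closure_subset])
  moreover have "C_diff 1 (\<lambda>x. \<phi> x * \<psi> x)" by (rule C_diff_mult) fact+
  ultimately show ?thesis unfolding C1_compact_def by blast
qed

lemma C1_compact_line_derivative:
  assumes "\<phi> \<in> C1_compact"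
  shows "((\<lambda>t. \<phi> (x + t *\<^sub>R axis i 1)) has_real_derivative partial_deriv i \<phi> (x + t *\<^sub>R axis i 1)) (at t)"
proof -
  have 1: "((\<lambda>t. x + t *\<^sub>R axis i (1::real)) has_derivative (\<lambda>s. s *\<^sub>R axis i 1)) (at t)"
    by (auto intro!: derivative_eq_intros)
  have 2: "(\<phi> has_derivative frechet_derivative \<phi> (at y)) (at y)" for y
    using C1_compact_differentiable[OF assms] frechet_derivative_works by blast
  have "frechet_derivative \<phi> (at y) (s *\<^sub>R axis i 1) = partial_deriv i \<phi> y * s" for s y
    using has_derivative_linear[OF 2[of y]] by (simp add: linear_cmul partial_deriv_def)
  then show ?thesis
    using has_derivative_compose[OF 1 2] by (simp add: has_field_derivative_def)
qed

lemma C1_compact_translate: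
  assumes "\<phi> \<in> C1_compact"
  shows "(\<lambda>x. \<phi> (x + v)) \<in> C1_compact" "partial_deriv i (\<lambda>x. \<phi> (x + v)) x = partial_deriv i \<phi> (x + v)"
proof -
  have 2: "(\<phi> has_derivative frechet_derivative \<phi> (at y)) (at y)" for y
    using C1_compact_differentiable[OF assms] frechet_derivative_works by blast
  have d: "((\<lambda>x. \<phi> (x + v)) has_derivative frechet_derivative \<phi> (at (y + v))) (at y)" for y
    by (rule has_derivative_compose[OF _ 2]) (auto intro!: derivative_eq_intros)
  show pd: "partial_deriv i (\<lambda>x. \<phi> (x + v)) x = partial_deriv i \<phi> (x + v)" for x i
    using d by (subst partial_deriv_eq) (auto simp: partial_deriv_def)
  have "(\<lambda>x. \<phi> (x + v)) differentiable_on UNIV"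
    using d unfolding differentiable_on_def differentiable_def by blast
  moreover have "continuous_on UNIV (partial_deriv i (\<lambda>x. \<phi> (x + v)))" for i
    unfolding pd[abs_def]
    by (rule continuous_on_compose2[OF C1_compact_partial_continuous[OF assms]]) (auto intro: continuous_intros)
  ultimately have "C_diff 1 (\<lambda>x. \<phi> (x + v))" by simp
  moreover obtain B R where "0 \<le> B" "0 < R" "\<And>x. \<bar>\<phi> x\<bar> \<le> B" and R: "\<And>x. R \<le> norm x \<Longrightarrow> \<phi> x = 0"
  proof (rule compactly_supported_bounded[OF C1_compact_continuous[OF assms]])
    show "compact (closure {x. \<phi> x \<noteq> 0})" using assms by (simp add: C1_compact_def)
  qed blast
  have "{x. \<phi> (x + v) \<noteq> 0} \<subseteq> cball (-v) R"
  proof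
    fix x assume "x \<in> {x. \<phi> (x + v) \<noteq> 0}"
    then have "norm (x + v) < R" using R not_le by blast
    moreover have "dist (- v) x = norm (x + v)" by (metis add.commute dist_commute dist_norm diff_minus_eq_add)
    ultimately show "x \<in> cball (- v) R" by simp
  qed
  then have "compact (closure {x. \<phi> (x + v) \<noteq> 0})"
    by (meson bounded_cball bounded_closure bounded_subset closed_closure compact_eq_bounded_closed)
  ultimately show "(\<lambda>x. \<phi> (x + v)) \<in> C1_compact" by (simp add: C1_compact_def)
qed

lemma borel_measurable_continuous_lebesgue:
  fixes f :: "real^'n \<Rightarrow> real"
  shows "continuous_on UNIV f \<Longrightarrow> f \<in> borel_measurable lebesgue"
  by (intro measurable_completion) (simp add: borel_measurable_continuous_onI)

lemma locally_integrable_measurable: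
  fixes f :: "real^'n \<Rightarrow> 'b::euclidean_space"
  assumes "locally_integrable f"
  shows "f \<in> borel_measurable lebesgue"
proof (rule borel_measurable_LIMSEQ_metric)
  fix x :: "real^'n"
  obtain n0 :: nat where "norm x \<le> real n0" using real_arch_simple by blast
  then have "indicator (cball 0 (real n)) x *\<^sub>R f x = f x" if "n \<ge> n0" for n
    using that by (auto simp: indicator_def)
  then show "(\<lambda>n. indicator (cball 0 (real n)) x *\<^sub>R f x) \<longlonglongrightarrow> f x"
    by (intro tendsto_eventually) (auto simp: eventually_sequentially)
qed (use assms in \<open>auto simp: locally_integrable_def set_integrable_def intro!: borel_measurable_integrable\<close>)

lemma locally_integrable_times_bounded:
  fixes f \<psi> :: "real^'n \<Rightarrow> real"
  assumes "locally_integrable f" "continuous_on UNIV \<psi>" "compact (closure {x. \<psi> x \<noteq> 0})"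
  shows "integrable lebesgue (\<lambda>x. f x * \<psi> x)"
proof -
  let ?K = "closure {x. \<psi> x \<noteq> 0}"
  obtain B R where "0 \<le> B" "0 < R" and B: "\<And>x. \<bar>\<psi> x\<bar> \<le> B" and "\<And>x. R \<le> norm x \<Longrightarrow> \<psi> x = 0"
    by (rule compactly_supported_bounded[OF assms(2,3)]) blast
  have "integrable lebesgue (\<lambda>x. (indicator ?K x *\<^sub>R f x) * \<psi> x)"
  proof (rule Bochner_Integration.integrable_bound)
    show int: "integrable lebesgue (\<lambda>x. B * (indicator ?K x *\<^sub>R f x))"
      using assms(1,3) by (auto simp: locally_integrable_def set_integrable_def)
    show "(\<lambda>x. (indicator ?K x *\<^sub>R f x) * \<psi> x) \<in> borel_measurable lebesgue"
      using assms(1,3) borel_measurable_continuous_lebesgue[OF assms(2)]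
      by (intro borel_measurable_times) (auto simp: locally_integrable_def set_integrable_def intro!: borel_measurable_integrable)
    show "AE x in lebesgue. norm ((indicator ?K x *\<^sub>R f x) * \<psi> x) \<le> norm (B * (indicator ?K x *\<^sub>R f x))"
    proof (intro AE_I2)
      fix x
      have "\<bar>\<psi> x\<bar> \<le> \<bar>B\<bar>" using B[of x] by linarith
      then show "norm ((indicator ?K x *\<^sub>R f x) * \<psi> x) \<le> norm (B * (indicator ?K x *\<^sub>R f x))"
        by (auto simp: abs_mult indicator_def mult.commute[of "\<bar>B\<bar>"] intro: mult_left_mono)
    qed
  qed
  moreover have "(\<lambda>x. (indicator ?K x *\<^sub>R f x) * \<psi> x) = (\<lambda>x. f x * \<psi> x)"
    using closure_subset[of "{x. \<psi> x \<noteq> 0}"] by (auto simp: fun_eq_iff indicator_def)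
  ultimately show ?thesis by simp
qed

lemma integrable_times_C1_compact:
  fixes f :: "real^'n \<Rightarrow> real"
  assumes "locally_integrable f" "\<phi> \<in> C1_compact"
  shows "integrable lebesgue (\<lambda>x. f x * \<phi> x)" "integrable lebesgue (\<lambda>x. f x * partial_deriv i \<phi> x)"
proof -
  have c: "compact (closure {x. \<phi> x \<noteq> 0})" using assms by (simp add: C1_compact_def)
  show "integrable lebesgue (\<lambda>x. f x * \<phi> x)"
    by (rule locally_integrable_times_bounded[OF assms(1) C1_compact_continuous[OF assms(2)] c])
  have "compact (closure {x. partial_deriv i \<phi> x \<noteq> 0})"
    by (rule compact_support_subset[OF c]) (use partial_deriv_outside_support in blast)
  then show "integrable lebesgue (\<lambda>x. f x * partial_deriv i \<phi> x)"
    by (rule locally_integrable_times_bounded[OF assms(1) C1_compact_partial_continuous[OF assms(2)]])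
qed

lemma locally_integrable_continuous:
  fixes f :: "real^'n \<Rightarrow> 'b::euclidean_space"
  assumes "continuous_on UNIV f"
  shows "locally_integrable f"
  unfolding locally_integrable_def
proof (intro allI impI)
  fix K :: "(real^'n) set" assume K: "compact K"
  have "set_integrable lborel K f"
    unfolding set_integrable_def
    by (rule borel_integrable_compact[OF K]) (use assms continuous_on_subset in blast)
  then show "set_integrable lebesgue K f"
    unfolding set_integrable_def by (subst integrable_completion) auto
qed

text \<open>
  Pairing \<open>f\<close> with the translates of \<open>\<phi>\<close> along an axis: the difference quotients of \<open>\<phi>\<close> are
  bounded with a common compact support, so the derivative passes under the integral. With \<open>f = 1\<close> this yields integration by parts without Fubini, and for a function with vanishing weak gradient it
  it shows that the pairing does not change under translation.
\<close>
lemma translated_pairing_derivative: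
  fixes f :: "real^'n \<Rightarrow> real"
  assumes f: "locally_integrable f" and \<phi>: "\<phi> \<in> C1_compact"
  shows "((\<lambda>t. LINT x|lebesgue. f x * \<phi> (x + t *\<^sub>R axis i 1)) has_real_derivative
          (LINT x|lebesgue. f x * partial_deriv i \<phi> (x + t *\<^sub>R axis i 1))) (at t)"
proof -
  have at_0: "((\<lambda>t. LINT x|lebesgue. f x * \<phi> (x + t *\<^sub>R axis i 1)) has_real_derivative
          (LINT x|lebesgue. f x * partial_deriv i \<phi> x)) (at 0)"
    if \<phi>: "\<phi> \<in> C1_compact" for \<phi>
    unfolding DERIV_def tendsto_at_iff_sequentially comp_def
  proof (intro allI impI)
    fix X :: "nat \<Rightarrow> real" assume X0: "\<forall>n. X n \<in> UNIV - {0}" and X: "X \<longlonglongrightarrow> 0"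
    obtain B R where B: "B \<ge> 0" "R > 0" "\<And>x. \<bar>\<phi> x\<bar> \<le> B" "\<And>x. \<bar>partial_deriv i \<phi> x\<bar> \<le> B"
      and R: "\<And>x. R \<le> norm x \<Longrightarrow> \<phi> x = 0" "\<And>x. R \<le> norm x \<Longrightarrow> partial_deriv i \<phi> x = 0"
      by (rule C1_compact_bounds[OF \<phi>, of i]) blast
    obtain M where M: "\<And>n. \<bar>X n\<bar> \<le> M"
      using convergent_imp_Bseq[OF convergentI[OF X]] by (auto simp: Bseq_def)
    have int: "integrable lebesgue (\<lambda>x. f x * \<phi> (x + t *\<^sub>R axis i 1))" for t
      by (rule integrable_times_C1_compact[OF f C1_compact_translate(1)[OF \<phi>]])
    let ?q = "\<lambda>n x. (f x * \<phi> (x + X n *\<^sub>R axis i 1) - f x * \<phi> x) / X n"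
    have "(\<lambda>n. LINT x|lebesgue. ?q n x) \<longlonglongrightarrow> (LINT x|lebesgue. f x * partial_deriv i \<phi> x)"
    proof (rule integral_dominated_convergence[where w = "\<lambda>x. B * norm (indicator (cball 0 (R + M)) x *\<^sub>R f x)"])
      show "(\<lambda>x. f x * partial_deriv i \<phi> x) \<in> borel_measurable lebesgue"
        using integrable_times_C1_compact(2)[OF f \<phi>] by (rule borel_measurable_integrable)
      show "?q n \<in> borel_measurable lebesgue" for n
        using int[of "X n"] int[of 0] by (intro borel_measurable_divide borel_measurable_diff) auto
      show "integrable lebesgue (\<lambda>x. B * norm (indicator (cball 0 (R + M)) x *\<^sub>R f x))"
        using f by (auto simp: locally_integrable_def set_integrable_def simp del: norm_scaleR real_norm_def)
      show "AE x in lebesgue. (\<lambda>n. ?q n x) \<longlonglongrightarrow> f x * partial_deriv i \<phi> x"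
      proof (intro AE_I2)
        fix x
        have "(\<lambda>h. (\<phi> (x + h *\<^sub>R axis i 1) - \<phi> x) / h) \<midarrow>0\<rightarrow> partial_deriv i \<phi> x"
          using C1_compact_line_derivative[OF \<phi>, of x i 0] by (simp add: DERIV_def)
        then have "(\<lambda>n. (\<phi> (x + X n *\<^sub>R axis i 1) - \<phi> x) / X n) \<longlonglongrightarrow> partial_deriv i \<phi> x"
          using X0 X unfolding tendsto_at_iff_sequentially comp_def by blast
        then have "(\<lambda>n. f x * ((\<phi> (x + X n *\<^sub>R axis i 1) - \<phi> x) / X n)) \<longlonglongrightarrow> f x * partial_deriv i \<phi> x"
          by (intro tendsto_intros)
        then show "(\<lambda>n. ?q n x) \<longlonglongrightarrow> f x * partial_deriv i \<phi> x" by (simp add: algebra_simps)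
      qed
      show "AE x in lebesgue. norm (?q n x) \<le> B * norm (indicator (cball 0 (R + M)) x *\<^sub>R f x)" for n
      proof (intro AE_I2)
        fix x
        have lip: "\<bar>\<phi> (x + X n *\<^sub>R axis i 1) - \<phi> x\<bar> \<le> B * \<bar>X n\<bar>"
          using field_differentiable_bound[of UNIV "\<lambda>t. \<phi> (x + t *\<^sub>R axis i 1)" "\<lambda>t. partial_deriv i \<phi> (x + t *\<^sub>R axis i 1)" B "X n" 0]
            C1_compact_line_derivative[OF \<phi>] B(4) by simp
        have "x \<in> cball 0 (R + M)" if "\<phi> (x + X n *\<^sub>R axis i 1) \<noteq> 0 \<or> \<phi> x \<noteq> 0"
        proof -
          have "norm (x + X n *\<^sub>R axis i 1) < R \<or> norm x < R" using that R(1) not_le by blast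
          moreover have "norm x \<le> norm (x + X n *\<^sub>R axis i 1) + norm (X n *\<^sub>R axis i (1::real) :: real^'n)"
            by (metis add_diff_cancel_right' norm_triangle_ineq4)
          moreover have "norm (X n *\<^sub>R axis i (1::real) :: real^'n) \<le> M" using M[of n] by simp
          moreover have "M \<ge> 0" using M[of n] by linarith
          ultimately show ?thesis by auto
        qed
        then have "\<bar>f x\<bar> * \<bar>\<phi> (x + X n *\<^sub>R axis i 1) - \<phi> x\<bar>
            \<le> B * norm (indicator (cball 0 (R + M)) x *\<^sub>R f x) * \<bar>X n\<bar>"
          using mult_left_mono[OF lip, of "\<bar>f x\<bar>"]
          by (cases "\<phi> (x + X n *\<^sub>R axis i 1) \<noteq> 0 \<or> \<phi> x \<noteq> 0") (auto simp: ac_simps B(1))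
        moreover have "norm (?q n x) = \<bar>f x\<bar> * \<bar>\<phi> (x + X n *\<^sub>R axis i 1) - \<phi> x\<bar> / \<bar>X n\<bar>"
          by (simp add: abs_mult right_diff_distrib[symmetric])
        ultimately show "norm (?q n x) \<le> B * norm (indicator (cball 0 (R + M)) x *\<^sub>R f x)"
          using X0 by (simp add: pos_divide_le_eq)
      qed
    qed
    moreover have "(\<lambda>n. LINT x|lebesgue. ?q n x) = (\<lambda>n. ((LINT x|lebesgue. f x * \<phi> (x + (0 + X n) *\<^sub>R axis i 1)) - (LINT x|lebesgue. f x * \<phi> (x + 0 *\<^sub>R axis i 1))) / X n)"
    proof
      fix n show "(LINT x|lebesgue. ?q n x) = ((LINT x|lebesgue. f x * \<phi> (x + (0 + X n) *\<^sub>R axis i 1)) - (LINT x|lebesgue. f x * \<phi> (x + 0 *\<^sub>R axis i 1))) / X n"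
        using int[of "X n"] int[of 0] by (simp add: integral_divide_zero Bochner_Integration.integral_diff)
    qed
    ultimately show "(\<lambda>n. ((LINT x|lebesgue. f x * \<phi> (x + (0 + X n) *\<^sub>R axis i 1)) - (LINT x|lebesgue. f x * \<phi> (x + 0 *\<^sub>R axis i 1))) / X n)
       \<longlonglongrightarrow> (LINT x|lebesgue. f x * partial_deriv i \<phi> x)" by simp
  qed
  have "((\<lambda>s. LINT x|lebesgue. f x * \<phi> (x + s *\<^sub>R axis i 1 + t *\<^sub>R axis i 1)) has_real_derivative
          (LINT x|lebesgue. f x * partial_deriv i (\<lambda>x. \<phi> (x + t *\<^sub>R axis i 1)) x)) (at 0)"
    using at_0[OF C1_compact_translate(1)[OF \<phi>]] by simp
  then have "((\<lambda>s. LINT x|lebesgue. f x * \<phi> (x + (s + t) *\<^sub>R axis i 1)) has_real_derivative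
          (LINT x|lebesgue. f x * partial_deriv i \<phi> (x + t *\<^sub>R axis i 1))) (at 0)"
    by (simp add: C1_compact_translate(2)[OF \<phi>] scaleR_left_distrib add.assoc)
  then show ?thesis using DERIV_shift[of "\<lambda>t. LINT x|lebesgue. f x * \<phi> (x + t *\<^sub>R axis i 1)" _ 0 t] by simp
qed

text \<open>The integral of a translate does not depend on the translation, so its derivative along the translation is \<open>0\<close>.\<close>
lemma integral_partial_deriv_eq_0:
  assumes \<phi>: "\<phi> \<in> C1_compact"
  shows "(LINT x|lebesgue. partial_deriv i \<phi> x) = 0"
proof -
  have "(LINT x|lebesgue. \<phi> (x + v)) = (LINT x|lebesgue. \<phi> x)" for v
  proof -
    have [measurable]: "\<phi> \<in> borel_measurable borel" by (rule borel_measurable_continuous_onI[OF C1_compact_continuous[OF \<phi>]])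
    have "(LINT x|lborel. \<phi> x) = (LINT x|distr lborel borel ((+) v). \<phi> x)" by (simp add: lborel_distr_plus)
    also have "\<dots> = (LINT x|lborel. \<phi> (x + v))" by (subst integral_distr) (auto simp: add.commute)
    finally show ?thesis by (simp add: integral_completion)
  qed
  then have "((\<lambda>t::real. LINT x|lebesgue. \<phi> x) has_real_derivative (LINT x|lebesgue. partial_deriv i \<phi> x)) (at 0)"
    using translated_pairing_derivative[OF locally_integrable_continuous \<phi>, of "\<lambda>_. 1" i 0] by simp
  then show ?thesis using DERIV_const DERIV_unique by blast
qed

lemma integration_by_parts:
  assumes "\<phi> \<in> C1_compact" "\<psi> \<in> C1_compact"
  shows "(LINT x|lebesgue. \<phi> x * partial_deriv i \<psi> x) = - (LINT x|lebesgue. partial_deriv i \<phi> x * \<psi> x)"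
proof -
  have "partial_deriv i (\<lambda>x. \<phi> x * \<psi> x) = (\<lambda>x. \<phi> x * partial_deriv i \<psi> x + partial_deriv i \<phi> x * \<psi> x)"
    using partial_deriv_mult C1_compact_differentiable assms by fast
  moreover have "integrable lebesgue (\<lambda>x. \<phi> x * partial_deriv i \<psi> x)"
    by (intro integrable_times_C1_compact assms locally_integrable_continuous C1_compact_continuous)
  moreover have "integrable lebesgue (\<lambda>x. partial_deriv i \<phi> x * \<psi> x)"
    by (intro integrable_times_C1_compact assms locally_integrable_continuous C1_compact_partial_continuous)
  ultimately show ?thesis
    using integral_partial_deriv_eq_0[OF C1_compact_mult[OF assms], of i] by simp
qed

section \<open>The fundamental lemma of the calculus of variations\<close>

lemma enn2real_inject: "enn2real a = enn2real b \<Longrightarrow> a \<noteq> \<infinity> \<Longrightarrow> b \<noteq> \<infinity> \<Longrightarrow> a = b"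
  by (cases a; cases b) auto

text \<open>
  The positive and the negative part of \<open>f\<close> are densities of measures that agree on boxes and are finite there.
  Boxes generate the Borel sets, so the measures and hence the densities agree.
\<close>
lemma AE_eq_0_if_box_integrals_eq_0:
  fixes f :: "real^'n \<Rightarrow> real"
  assumes f: "locally_integrable f"
    and int0: "\<And>a b. (LINT x|lebesgue. indicator (box a b) x * f x) = 0"
  shows "AE x in lebesgue. f x = 0"
proof -
  have int: "integrable lebesgue (\<lambda>x. indicator (box a b) x * f x)" for a b
  proof -
    have "set_integrable lebesgue (cbox a b) f" using f by (simp add: locally_integrable_def)
    then have "set_integrable lebesgue (box a b) f"
      by (rule set_integrable_subset) (auto simp: box_subset_cbox)
    then show ?thesis by (simp add: set_integrable_def)
  qed
  have fm: "f \<in> borel_measurable lebesgue" by (rule locally_integrable_measurable[OF f])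
  then obtain g where g[measurable]: "g \<in> borel_measurable lborel" and fg: "AE x in lborel. f x = g x"
    using completion_ex_borel_measurable_real[OF fm] by auto
  have fg': "AE x in lebesgue. f x = g x" using fg by (rule AE_completion)
  have gl: "(\<lambda>x. indicator (box a b) x * g x) \<in> borel_measurable lebesgue" for a b
    by (rule measurable_completion) measurable
  have eq: "(\<integral>\<^sup>+x\<in>box a b. ennreal (g x) \<partial>lborel) = (\<integral>\<^sup>+x\<in>box a b. ennreal (- g x) \<partial>lborel)
     \<and> (\<integral>\<^sup>+x\<in>box a b. ennreal (g x) \<partial>lborel) \<noteq> \<infinity>" for a b
  proof -
    let ?k = "\<lambda>x. indicator (box a b) x * g x"
    have ik: "integrable lebesgue ?k"
      using int[of a b] by (rule integrable_cong_AE_imp) (use fg' gl in auto)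
    then have ik': "integrable lborel ?k" by (subst (asm) integrable_completion) auto
    have "(LINT x|lborel. ?k x) = (LINT x|lebesgue. ?k x)" by (subst integral_completion) auto
    also have "\<dots> = (LINT x|lebesgue. indicator (box a b) x * f x)"
      using fg' by (intro integral_cong_AE borel_measurable_integrable int ik) auto
    finally have "(LINT x|lborel. ?k x) = 0" using int0 by simp
    moreover have fin: "(\<integral>\<^sup>+x. ennreal (?k x) \<partial>lborel) \<noteq> \<infinity>" "(\<integral>\<^sup>+x. ennreal (- ?k x) \<partial>lborel) \<noteq> \<infinity>"
      using ik' unfolding real_integrable_def by blast+
    ultimately have "enn2real (\<integral>\<^sup>+x. ennreal (?k x) \<partial>lborel) = enn2real (\<integral>\<^sup>+x. ennreal (- ?k x) \<partial>lborel)"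
      unfolding real_lebesgue_integral_def[OF ik'] by linarith
    then have eq: "(\<integral>\<^sup>+x. ennreal (?k x) \<partial>lborel) = (\<integral>\<^sup>+x. ennreal (- ?k x) \<partial>lborel)"
      using fin by (rule enn2real_inject)
    have 1: "ennreal (?k x) = ennreal (g x) * indicator (box a b) x" for x
      by (cases "x \<in> box a b") simp_all
    have 2: "ennreal (- ?k x) = ennreal (- g x) * indicator (box a b) x" for x
      by (cases "x \<in> box a b") simp_all
    show ?thesis using eq fin(1) unfolding 1 2 by blast
  qed
  have "density lborel (\<lambda>x. ennreal (g x)) = density lborel (\<lambda>x. ennreal (- g x))"
  proof (rule measure_eqI_generator_eq)
    let ?E = "range (\<lambda>(a, b). box a b::(real^'n) set)"
    show "Int_stable ?E" by (auto simp: Int_stable_def box_Int_box)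
    show "?E \<subseteq> Pow UNIV" "sets (density lborel (\<lambda>x. ennreal (g x))) = sigma_sets UNIV ?E"
      "sets (density lborel (\<lambda>x. ennreal (- g x))) = sigma_sets UNIV ?E"
      by (simp_all add: borel_eq_box)
    let ?A = "\<lambda>n::nat. box (- (real n *\<^sub>R One)) (real n *\<^sub>R One) :: (real^'n) set"
    show "range ?A \<subseteq> ?E" "(\<Union>i. ?A i) = UNIV" unfolding UN_box_eq_UNIV by auto
    show "emeasure (density lborel (\<lambda>x. ennreal (g x))) (?A i) \<noteq> \<infinity>" for i
      using conjunct2[OF eq[of "- (real i *\<^sub>R One)" "real i *\<^sub>R One"]] by (subst emeasure_density) auto
    show "emeasure (density lborel (\<lambda>x. ennreal (g x))) X = emeasure (density lborel (\<lambda>x. ennreal (- g x))) X" if X: "X \<in> ?E" for X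
    proof -
      have "X \<in> sets borel" using X by auto
      then show ?thesis using X eq by (auto simp: emeasure_density)
    qed
  qed
  then have "AE x in lborel. ennreal (g x) = ennreal (- g x)"
    by (intro sigma_finite_measure.density_unique[OF sigma_finite_lborel]) auto
  then have "AE x in lborel. g x = 0"
    by eventually_elim (metis ennreal_neg ennreal_eq_0_iff linear neg_le_0_iff_le order_antisym)
  with fg show ?thesis by (intro AE_completion) auto
qed

theorem fundamental_lemma_calculus_of_variations:
  fixes f :: "real^'n \<Rightarrow> real"
  assumes f: "locally_integrable f"
    and int0: "\<And>\<phi>. \<phi> \<in> test_functions \<Longrightarrow> (LINT x|lebesgue. f x * \<phi> x) = 0"
  shows "AE x in lebesgue. f x = 0"
proof (rule AE_eq_0_if_box_integrals_eq_0[OF f])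
  fix a b :: "real^'n"
  have "(\<lambda>k. LINT x|lebesgue. f x * bump a b k x) \<longlonglongrightarrow> (LINT x|lebesgue. f x * indicator (box a b) x)"
  proof (rule integral_dominated_convergence[where w = "\<lambda>x. norm (indicator (cbox a b) x *\<^sub>R f x)"])
    have si: "set_integrable lebesgue (cbox a b) f" using f by (simp add: locally_integrable_def)
    then show "integrable lebesgue (\<lambda>x. norm (indicator (cbox a b) x *\<^sub>R f x))"
      unfolding set_integrable_def by (rule integrable_norm)
    show "(\<lambda>x. f x * bump a b k x) \<in> borel_measurable lebesgue" for k
      by (intro borel_measurable_integrable integrable_times_C1_compact f test_functions_C1_compact bump_test_function)
    have "set_integrable lebesgue (box a b) f"
      using si by (rule set_integrable_subset) (auto simp: box_subset_cbox)
    then show "(\<lambda>x. f x * indicator (box a b) x) \<in> borel_measurable lebesgue"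
      unfolding set_integrable_def by (auto dest: borel_measurable_integrable simp: mult.commute)
    show "AE x in lebesgue. (\<lambda>k. f x * bump a b k x) \<longlonglongrightarrow> f x * indicator (box a b) x"
      by (intro AE_I2 tendsto_intros bump_tendsto_indicator)
    show "AE x in lebesgue. norm (f x * bump a b k x) \<le> norm (indicator (cbox a b) x *\<^sub>R f x)" for k
    proof (intro AE_I2)
      fix x
      show "norm (f x * bump a b k x) \<le> norm (indicator (cbox a b) x *\<^sub>R f x)"
        using bump_outside[of x a b k] bump_bounds[of a b k x] mult_left_mono[of "bump a b k x" 1 "\<bar>f x\<bar>"]
        by (cases "x \<in> cbox a b") (auto simp: abs_mult)
    qed
  qed
  then have "(\<lambda>k. 0::real) \<longlonglongrightarrow> (LINT x|lebesgue. f x * indicator (box a b) x)"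
    using int0[OF bump_test_function] by simp
  then show "(LINT x|lebesgue. indicator (box a b) x * f x) = 0"
    by (simp add: LIMSEQ_const_iff mult.commute)
qed


section \<open>The Gagliardo product inequality\<close>

text \<open>
  Hoelder's inequality for equal exponents. Natural powers of extended nonnegative integrals avoid
  both fractional powers in \<^typ>\<open>ennreal\<close> and all finiteness assumptions. After normalising each factor to
  integral \<open>1\<close> the claim is the inequality between the arithmetic and the geometric mean.
\<close>
lemma nn_integral_power_le_prod:
  fixes f :: "'a \<Rightarrow> ennreal" and g :: "'i \<Rightarrow> 'a \<Rightarrow> ennreal"
  assumes I: "finite I" "I \<noteq> {}"
    and [measurable]: "f \<in> borel_measurable M" "\<And>i. i \<in> I \<Longrightarrow> g i \<in> borel_measurable M"
    and le: "\<And>x. x \<in> space M \<Longrightarrow> f x ^ card I \<le> (\<Prod>i\<in>I. g i x)"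
  shows "(\<integral>\<^sup>+x. f x \<partial>M) ^ card I \<le> (\<Prod>i\<in>I. \<integral>\<^sup>+x. g i x \<partial>M)"
proof -
  let ?m = "card I"
  have m: "?m > 0" using I by (simp add: card_gt_0_iff)
  consider (zero) i where "i \<in> I" "(\<integral>\<^sup>+x. g i x \<partial>M) = 0"
    | (top) i where "\<And>i. i \<in> I \<Longrightarrow> (\<integral>\<^sup>+x. g i x \<partial>M) \<noteq> 0" "i \<in> I" "(\<integral>\<^sup>+x. g i x \<partial>M) = \<infinity>"
    | (finite) "\<And>i. i \<in> I \<Longrightarrow> (\<integral>\<^sup>+x. g i x \<partial>M) \<noteq> 0" "\<And>i. i \<in> I \<Longrightarrow> (\<integral>\<^sup>+x. g i x \<partial>M) \<noteq> \<infinity>"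
    by metis
  then show ?thesis
  proof cases
    case (zero i)
    then have "AE x in M. g i x = 0" by (subst (asm) nn_integral_0_iff_AE) auto
    then have "AE x in M. f x = 0"
    proof (rule AE_mp, intro AE_I2 impI)
      fix x assume x: "x \<in> space M" "g i x = 0"
      have "f x ^ ?m \<le> (\<Prod>i\<in>I. g i x)" by (rule le[OF x(1)])
      also have "\<dots> = 0" using x(2) zero(1) by (intro prod_zero I(1)) blast
      finally have "f x ^ ?m \<le> 0" .
      then show "f x = 0" using m by simp
    qed
    then have "(\<integral>\<^sup>+x. f x \<partial>M) = 0" by (subst nn_integral_0_iff_AE) auto
    then show ?thesis using m by (simp add: zero_power)
  next
    case (top i)
    then have "(\<Prod>i\<in>I. \<integral>\<^sup>+x. g i x \<partial>M) = \<infinity>" using I by (auto simp: ennreal_prod_eq_top)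
    then show ?thesis by simp
  next
    case finite
    define \<beta> where "\<beta> i = enn2real (\<integral>\<^sup>+x. g i x \<partial>M)" for i
    have \<beta>: "(\<integral>\<^sup>+x. g i x \<partial>M) = ennreal (\<beta> i)" "\<beta> i > 0" if "i \<in> I" for i
      using finite[OF that] unfolding \<beta>_def by (auto simp: less_top enn2real_positive_iff zero_less_iff_neq_zero)
    define K where "K = (\<Prod>i\<in>I. \<beta> i) powr (1 / ?m) / ?m"
    have pos: "(\<Prod>i\<in>I. \<beta> i) > 0" using \<beta>(2) by (rule prod_pos)
    then have K: "K > 0" using m by (simp add: K_def)
    have pointwise: "f x \<le> ennreal K * (\<Sum>i\<in>I. ennreal (1 / \<beta> i) * g i x)" if x: "x \<in> space M" for x
    proof (cases "\<exists>i\<in>I. g i x = \<infinity>")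
      case True
      then obtain i where i: "i \<in> I" "g i x = \<infinity>" by blast
      then have "ennreal (1 / \<beta> i) * g i x = \<infinity>" using \<beta>(2)[OF i(1)] by (simp add: ennreal_mult_top)
      then have "(\<Sum>i\<in>I. ennreal (1 / \<beta> i) * g i x) = \<infinity>" using I i(1) by (auto simp: ennreal_sum_eq_top)
      then show ?thesis using K by (simp add: ennreal_mult_top)
    next
      case False
      define \<gamma> where "\<gamma> i = enn2real (g i x)" for i
      have \<gamma>: "g i x = ennreal (\<gamma> i)" "\<gamma> i \<ge> 0" if "i \<in> I" for i
        using False that unfolding \<gamma>_def by (auto simp: less_top)
      have "(\<Prod>i\<in>I. g i x) = ennreal (\<Prod>i\<in>I. \<gamma> i)"
        using \<gamma> by (simp add: prod_ennreal)
      then have fm: "f x ^ ?m \<le> ennreal (\<Prod>i\<in>I. \<gamma> i)" using le[OF x] by simp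
      then have "f x \<noteq> \<infinity>" using m by (auto simp: power_eq_top_ennreal top_unique)
      then obtain \<phi> where \<phi>: "f x = ennreal \<phi>" "\<phi> \<ge> 0" by (cases "f x") auto
      have le': "\<phi> ^ ?m \<le> (\<Prod>i\<in>I. \<gamma> i)"
        using fm \<phi> \<gamma> by (simp add: ennreal_power prod_nonneg ennreal_le_iff)
      have "\<phi> = (\<phi> ^ ?m) powr (1 / ?m)"
        using \<phi>(2) m by (cases "\<phi> = 0") (simp_all add: powr_realpow[symmetric] powr_powr zero_power)
      also have "\<dots> \<le> ((\<Prod>i\<in>I. \<beta> i) * (\<Prod>i\<in>I. \<gamma> i / \<beta> i)) powr (1 / ?m)"
        using le' \<phi>(2) pos by (intro powr_mono2) (auto simp: prod_dividef)
      also have "\<dots> = (\<Prod>i\<in>I. \<beta> i) powr (1 / ?m) * (\<Prod>i\<in>I. \<gamma> i / \<beta> i) powr (1 / ?m)"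
        by (rule powr_mult)
      also have "\<dots> \<le> (\<Prod>i\<in>I. \<beta> i) powr (1 / ?m) * (\<Sum>i\<in>I. (\<gamma> i / \<beta> i) / ?m)"
        using \<gamma>(2) \<beta>(2) by (intro mult_left_mono arith_geom_mean I) (auto intro!: divide_nonneg_nonneg simp: less_imp_le)
      also have "\<dots> = K * (\<Sum>i\<in>I. 1 / \<beta> i * \<gamma> i)"
      proof -
        have "(\<Sum>i\<in>I. (\<gamma> i / \<beta> i) / ?m) = (\<Sum>i\<in>I. 1 / \<beta> i * \<gamma> i) / ?m"
          by (simp add: sum_divide_distrib)
        then show ?thesis by (simp only: K_def times_divide_eq_left times_divide_eq_right)
      qed
      finally have "ennreal \<phi> \<le> ennreal (K * (\<Sum>i\<in>I. 1 / \<beta> i * \<gamma> i))" by (rule ennreal_leI)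
      also have "\<dots> = ennreal K * (\<Sum>i\<in>I. ennreal (1 / \<beta> i * \<gamma> i))"
      proof -
        have "0 \<le> 1 / \<beta> i * \<gamma> i" if "i \<in> I" for i
          using \<beta>(2)[OF that] \<gamma>(2)[OF that] by simp
        then show ?thesis using K by (simp add: ennreal_mult sum_nonneg sum_ennreal)
      qed
      also have "\<dots> = ennreal K * (\<Sum>i\<in>I. ennreal (1 / \<beta> i) * g i x)"
      proof -
        have "ennreal (1 / \<beta> i * \<gamma> i) = ennreal (1 / \<beta> i) * g i x" if "i \<in> I" for i
          unfolding \<gamma>(1)[OF that] using \<gamma>(2)[OF that] \<beta>(2)[OF that] by (intro ennreal_mult) auto
        then show ?thesis by (simp cong: sum.cong)
      qed
      finally show ?thesis using \<phi> by simp
    qed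
    have "(\<integral>\<^sup>+x. f x \<partial>M) \<le> (\<integral>\<^sup>+x. ennreal K * (\<Sum>i\<in>I. ennreal (1 / \<beta> i) * g i x) \<partial>M)"
      by (intro nn_integral_mono pointwise)
    also have "\<dots> = ennreal K * (\<Sum>i\<in>I. ennreal (1 / \<beta> i) * (\<integral>\<^sup>+x. g i x \<partial>M))"
      by (simp add: nn_integral_cmult nn_integral_sum)
    also have "\<dots> = ennreal K * of_nat ?m"
    proof -
      have "ennreal (1 / \<beta> i) * (\<integral>\<^sup>+x. g i x \<partial>M) = 1" if "i \<in> I" for i
        unfolding \<beta>(1)[OF that] using \<beta>(2)[OF that] by (simp add: ennreal_mult[symmetric])
      then show ?thesis by simp
    qed
    also have "\<dots> = ennreal ((\<Prod>i\<in>I. \<beta> i) powr (1 / ?m))"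
      using K m by (simp add: K_def ennreal_of_nat_eq_real_of_nat ennreal_mult[symmetric])
    finally have le1: "(\<integral>\<^sup>+x. f x \<partial>M) \<le> ennreal ((\<Prod>i\<in>I. \<beta> i) powr (1 / ?m))" .
    have pw: "((\<Prod>i\<in>I. \<beta> i) powr (1 / ?m)) ^ ?m = (\<Prod>i\<in>I. \<beta> i)"
      using m pos by (simp add: powr_realpow[symmetric] powr_powr)
    have "(\<integral>\<^sup>+x. f x \<partial>M) ^ ?m \<le> ennreal ((\<Prod>i\<in>I. \<beta> i) powr (1 / ?m)) ^ ?m"
      using le1 by (rule power_mono) simp
    also have "\<dots> = ennreal (\<Prod>i\<in>I. \<beta> i)"
      by (simp add: ennreal_power pw)
    also have "\<dots> = (\<Prod>i\<in>I. \<integral>\<^sup>+x. g i x \<partial>M)"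
      using \<beta> by (simp add: prod_ennreal less_imp_le)
    finally show ?thesis .
  qed
qed

text \<open>A constant can be absorbed into one of the factors, whatever its value in \<open>[0, \<infinity>]\<close>.\<close>
lemma nn_integral_power_le_cmult_prod:
  fixes f :: "'a \<Rightarrow> ennreal" and g :: "'i \<Rightarrow> 'a \<Rightarrow> ennreal"
  assumes I: "finite I" "I \<noteq> {}"
    and f: "f \<in> borel_measurable M" and g: "\<And>i. i \<in> I \<Longrightarrow> g i \<in> borel_measurable M"
    and le: "\<And>x. x \<in> space M \<Longrightarrow> f x ^ card I \<le> c * (\<Prod>i\<in>I. g i x)"
  shows "(\<integral>\<^sup>+x. f x \<partial>M) ^ card I \<le> c * (\<Prod>i\<in>I. \<integral>\<^sup>+x. g i x \<partial>M)"
proof -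
  obtain j where j: "j \<in> I" using I by blast
  define g' where "g' i x = (if i = j then c else 1) * g i x" for i x
  have prod_g': "(\<Prod>i\<in>I. (if i = j then c else 1) * h i) = c * (\<Prod>i\<in>I. h i)" for h :: "'i \<Rightarrow> ennreal"
    using I(1) j by (simp add: prod.distrib prod.delta')
  have "(\<integral>\<^sup>+x. f x \<partial>M) ^ card I \<le> (\<Prod>i\<in>I. \<integral>\<^sup>+x. g' i x \<partial>M)"
    using g le by (intro nn_integral_power_le_prod I f) (auto simp: g'_def prod_g')
  also have "\<dots> = (\<Prod>i\<in>I. (if i = j then c else 1) * (\<integral>\<^sup>+x. g i x \<partial>M))"
    using g by (intro prod.cong refl) (auto simp: g'_def nn_integral_cmult)
  finally show ?thesis by (simp only: prod_g')
qed

text \<open>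
  Keeping the full point \<open>x\<close> as argument makes integrals over
  different sets of coordinates functions on the same space, so that their products can be formed.
\<close>
definition partial_nn_integral :: "'i set \<Rightarrow> (('i \<Rightarrow> real) \<Rightarrow> ennreal) \<Rightarrow> ('i \<Rightarrow> real) \<Rightarrow> ennreal" where
  "partial_nn_integral J f x = (\<integral>\<^sup>+y. f (override_on x y J) \<partial>Pi\<^sub>M J (\<lambda>_. lborel))"

context
  fixes I :: "'i set" assumes finite_I: "finite I"
begin

abbreviation (input) "PI \<equiv> Pi\<^sub>M I (\<lambda>_. lborel :: real measure)"

interpretation lb: product_sigma_finite "\<lambda>_. lborel :: real measure" ..

lemma override_measurable:
  assumes "J \<subseteq> I"
  shows "(\<lambda>(x, y). override_on x y J) \<in> PI \<Otimes>\<^sub>M Pi\<^sub>M J (\<lambda>_. lborel) \<rightarrow>\<^sub>M PI"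
proof (rule measurable_PiM_single')
  fix k assume k: "k \<in> I"
  show "(\<lambda>z. (case z of (x, y) \<Rightarrow> override_on x y J) k) \<in> PI \<Otimes>\<^sub>M Pi\<^sub>M J (\<lambda>_. lborel) \<rightarrow>\<^sub>M lborel"
  proof (cases "k \<in> J")
    case True
    then have eq: "(\<lambda>z. (case z of (x, y) \<Rightarrow> override_on x y J) k) = (\<lambda>z. snd z k)"
      by (auto simp: override_on_def)
    show ?thesis unfolding eq using True by simp
  next
    case False
    then have eq: "(\<lambda>z. (case z of (x, y) \<Rightarrow> override_on x y J) k) = (\<lambda>z. fst z k)"
      by (auto simp: override_on_def)
    show ?thesis unfolding eq using k by simp
  qed
next
  show "(\<lambda>(x, y). override_on x y J) \<in> space (PI \<Otimes>\<^sub>M Pi\<^sub>M J (\<lambda>_. lborel)) \<rightarrow> (\<Pi>\<^sub>E i\<in>I. space lborel)"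
    using assms by (auto simp: space_pair_measure space_PiM PiE_def extensional_def override_on_def)
qed

lemma override_section_measurable:
  assumes "J \<subseteq> I" "x \<in> space PI"
  shows "(\<lambda>y. override_on x y J) \<in> Pi\<^sub>M J (\<lambda>_. lborel) \<rightarrow>\<^sub>M PI"
proof -
  have "(\<lambda>y. (\<lambda>(x, y). override_on x y J) (x, y)) \<in> Pi\<^sub>M J (\<lambda>_. lborel) \<rightarrow>\<^sub>M PI"
    by (rule measurable_compose[OF measurable_Pair1'[OF assms(2)] override_measurable[OF assms(1)]])
  then show ?thesis by simp
qed

lemma partial_nn_integral_measurable:
  assumes J: "J \<subseteq> I" and f: "f \<in> borel_measurable PI"
  shows "partial_nn_integral J f \<in> borel_measurable PI"
proof -
  have fin: "finite J" using J finite_subset[OF _ finite_I] by simp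
  interpret J: finite_product_sigma_finite "\<lambda>_. lborel :: real measure" J by standard (rule fin)
  have "(\<lambda>(x, y). f (override_on x y J)) \<in> borel_measurable (PI \<Otimes>\<^sub>M Pi\<^sub>M J (\<lambda>_. lborel))"
    using measurable_compose[OF override_measurable[OF J] f] by (simp add: case_prod_unfold)
  then show ?thesis
    unfolding partial_nn_integral_def[abs_def] by (rule J.borel_measurable_nn_integral)
qed

lemma update_measurable:
  assumes "j \<in> I" "x \<in> space PI"
  shows "(\<lambda>t. x(j := t)) \<in> lborel \<rightarrow>\<^sub>M PI"
  using assms measurable_component_update[of x "I - {j}" "\<lambda>_. lborel" j] 
  by (intro measurable_PiM_single') (auto simp: space_PiM PiE_def extensional_def)

lemma partial_nn_integral_insert:
  assumes J: "insert j J \<subseteq> I" "j \<notin> J" and f: "f \<in> borel_measurable PI" and x: "x \<in> space PI"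
  shows "partial_nn_integral (insert j J) f x = (\<integral>\<^sup>+t. partial_nn_integral J f (x(j := t)) \<partial>lborel)"
proof -
  have fin: "finite J" using J finite_subset[OF _ finite_I] by simp
  have m: "(\<lambda>y. f (override_on x y (insert j J))) \<in> borel_measurable (Pi\<^sub>M (insert j J) (\<lambda>_. lborel))"
    by (rule measurable_compose[OF override_section_measurable[OF J(1) x] f])
  have "override_on x (z(j := t)) (insert j J) = override_on (x(j := t)) z J" for z t
    using J(2) by (auto simp: override_on_def)
  then show ?thesis
    unfolding partial_nn_integral_def lb.product_nn_integral_insert_rev[OF fin J(2) m] by simp
qed

lemma partial_nn_integral_empty: "partial_nn_integral {} f x = f x"
  unfolding partial_nn_integral_def by (subst lb.nn_integral_empty) (simp_all add: override_on_def[abs_def])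

lemma partial_nn_integral_all:
  assumes "x \<in> space PI"
  shows "partial_nn_integral I f x = (\<integral>\<^sup>+y. f y \<partial>PI)"
proof -
  have "override_on x y I = y" if "y \<in> space PI" for y
    using that assms by (auto simp: override_on_def fun_eq_iff space_PiM PiE_def extensional_def)
  then show ?thesis unfolding partial_nn_integral_def by (intro nn_integral_cong) simp
qed

text \<open>
  Integrate one variable at a time. When \<open>x\<^sub>j\<close> is integrated, the \<open>j\<close>-th factor is already
  independent of \<open>x\<^sub>j\<close>, so Hoelder's inequality is applied to the remaining \<open>card I - 1\<close> factors only.
\<close>
lemma gagliardo_partial:
  assumes card: "card I \<ge> 2"
    and f: "f \<in> borel_measurable PI" and g: "\<And>i. i \<in> I \<Longrightarrow> g i \<in> borel_measurable PI"
    and le: "\<And>x. x \<in> space PI \<Longrightarrow> f x ^ (card I - 1) \<le> (\<Prod>i\<in>I. partial_nn_integral {i} (g i) x)"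
    and J: "J \<subseteq> I" and x: "x \<in> space PI"
  shows "partial_nn_integral J f x ^ (card I - 1) \<le> (\<Prod>i\<in>I. partial_nn_integral (insert i J) (g i) x)"
proof -
  have "finite J" using J finite_subset[OF _ finite_I] by simp
  then show ?thesis using J x
  proof (induction J arbitrary: x rule: finite_induct)
    case empty
    then show ?case using le by (simp add: partial_nn_integral_empty)
  next
    case (insert j J)
    have j: "j \<in> I" and J: "J \<subseteq> I" using insert.prems by auto
    let ?c = "partial_nn_integral (insert j J) (g j) x"
    let ?b = "\<lambda>i t. partial_nn_integral (insert i J) (g i) (x(j := t))"
    have upd: "x(j := t) \<in> space PI" for t
      using insert.prems(2) j by (auto simp: space_PiM PiE_def extensional_def)
    have card_I': "card (I - {j}) = card I - 1" using j by (rule card_Diff_singleton)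
    have "card (I - {j}) \<noteq> 0" using card card_I' by linarith
    then have I': "I - {j} \<noteq> {}" "card (I - {j}) = card I - 1" using card_I' by fastforce+
    have const: "?b j t = ?c" for t
      unfolding partial_nn_integral_def
      by (intro nn_integral_cong arg_cong[where f = "g j"]) (auto simp: override_on_def)
    have bm: "?b i \<in> borel_measurable lborel" if "i \<in> I" for i
      using measurable_compose[OF update_measurable[OF j insert.prems(2)] partial_nn_integral_measurable[OF _ g[OF that]]] J that by simp
    have am: "(\<lambda>t. partial_nn_integral J f (x(j := t))) \<in> borel_measurable lborel"
      by (rule measurable_compose[OF update_measurable[OF j insert.prems(2)] partial_nn_integral_measurable[OF J f]])
    have "partial_nn_integral (insert j J) f x ^ card (I - {j}) =
        (\<integral>\<^sup>+t. partial_nn_integral J f (x(j := t)) \<partial>lborel) ^ card (I - {j})"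
      using partial_nn_integral_insert[OF insert.prems(1) insert.hyps(2) f insert.prems(2)] by simp
    also have "\<dots> \<le> ?c * (\<Prod>i\<in>I - {j}. \<integral>\<^sup>+t. ?b i t \<partial>lborel)"
    proof (rule nn_integral_power_le_cmult_prod)
      fix t
      have "partial_nn_integral J f (x(j := t)) ^ card (I - {j}) \<le> (\<Prod>i\<in>I. ?b i t)"
        unfolding I'(2) by (rule insert.IH[OF J upd])
      also have "\<dots> = ?c * (\<Prod>i\<in>I - {j}. ?b i t)"
        using prod.remove[OF finite_I j, of "\<lambda>i. ?b i t"] const[of t] by simp
      finally show "partial_nn_integral J f (x(j := t)) ^ card (I - {j}) \<le> ?c * (\<Prod>i\<in>I - {j}. ?b i t)" .
    qed (use finite_I I' bm am in auto)
    also have "\<dots> = ?c * (\<Prod>i\<in>I - {j}. partial_nn_integral (insert i (insert j J)) (g i) x)"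
    proof (intro arg_cong[where f = "\<lambda>z. ?c * z"] prod.cong refl)
      fix i assume i: "i \<in> I - {j}"
      have "partial_nn_integral (insert j (insert i J)) (g i) x = (\<integral>\<^sup>+t. ?b i t \<partial>lborel)"
        using i insert.prems insert.hyps g by (intro partial_nn_integral_insert) auto
      then show "(\<integral>\<^sup>+t. ?b i t \<partial>lborel) = partial_nn_integral (insert i (insert j J)) (g i) x"
        by (simp add: insert_commute)
    qed
    also have "\<dots> = (\<Prod>i\<in>I. partial_nn_integral (insert i (insert j J)) (g i) x)"
      using prod.remove[OF finite_I j, of "\<lambda>i. partial_nn_integral (insert i (insert j J)) (g i) x"] by simp
    finally show ?case using I'(2) by simp
  qed
qed

lemma gagliardo_product:
  assumes card: "card I \<ge> 2"
    and f: "f \<in> borel_measurable PI" and g: "\<And>i. i \<in> I \<Longrightarrow> g i \<in> borel_measurable PI"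
    and le: "\<And>x. x \<in> space PI \<Longrightarrow> f x ^ (card I - 1) \<le> (\<Prod>i\<in>I. \<integral>\<^sup>+t. g i (x(i := t)) \<partial>lborel)"
  shows "(\<integral>\<^sup>+x. f x \<partial>PI) ^ (card I - 1) \<le> (\<Prod>i\<in>I. \<integral>\<^sup>+x. g i x \<partial>PI)"
proof -
  have sp: "(\<lambda>i\<in>I. 0) \<in> space PI" by (auto simp: space_PiM)
  have "partial_nn_integral {i} (g i) x = (\<integral>\<^sup>+t. g i (x(i := t)) \<partial>lborel)" if "i \<in> I" "x \<in> space PI" for i x
    using partial_nn_integral_insert[of i "{}" "g i" x] g that by (simp add: partial_nn_integral_empty)
  then have le': "f x ^ (card I - 1) \<le> (\<Prod>i\<in>I. partial_nn_integral {i} (g i) x)" if "x \<in> space PI" for x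
    using le[OF that] that by (simp cong: prod.cong)
  have "insert i I = I" if "i \<in> I" for i using that by blast
  then show ?thesis
    using gagliardo_partial[OF card f g le' order_refl sp] by (simp add: partial_nn_integral_all[OF sp] cong: prod.cong)
qed

end

text \<open>
  The same inequality on a Euclidean space: integration over one coordinate becomes integration along
  the line through \<open>x\<close> in that direction, since Lebesgue measure is translation invariant.
\<close>
theorem gagliardo_lborel:
  fixes f :: "'a::euclidean_space \<Rightarrow> ennreal" and g :: "'a \<Rightarrow> 'a \<Rightarrow> ennreal"
  assumes dim: "DIM('a) \<ge> 2"
    and f: "f \<in> borel_measurable borel" and g: "\<And>b. b \<in> Basis \<Longrightarrow> g b \<in> borel_measurable borel"
    and le: "\<And>x. f x ^ (DIM('a) - 1) \<le> (\<Prod>b\<in>Basis. \<integral>\<^sup>+t. g b (x + t *\<^sub>R b) \<partial>lborel)"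
  shows "(\<integral>\<^sup>+x. f x \<partial>lborel) ^ (DIM('a) - 1) \<le> (\<Prod>b\<in>Basis. \<integral>\<^sup>+x. g b x \<partial>lborel)"
proof -
  let ?T = "\<lambda>y. \<Sum>b\<in>Basis. y b *\<^sub>R b :: 'a"
  let ?P = "Pi\<^sub>M Basis (\<lambda>_::'a. lborel :: real measure)"
  have T: "?T \<in> ?P \<rightarrow>\<^sub>M borel" by measurable
  have tr: "(\<integral>\<^sup>+x. F x \<partial>lborel) = (\<integral>\<^sup>+y. F (?T y) \<partial>?P)" if "F \<in> borel_measurable borel" for F :: "'a \<Rightarrow> ennreal"
    using that T by (subst lborel_eq) (simp add: nn_integral_distr)
  have line: "(\<integral>\<^sup>+t. g b (?T y + t *\<^sub>R b) \<partial>lborel) = (\<integral>\<^sup>+t. g b (?T (y(b := t))) \<partial>lborel)" if b: "b \<in> Basis" for b y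
  proof -
    have "?T (y(b := t)) = ?T y + (t - y b) *\<^sub>R b" for t
    proof -
      have "?T (y(b := t)) = t *\<^sub>R b + (\<Sum>c\<in>Basis - {b}. y c *\<^sub>R c)"
        using b by (subst sum.remove[OF finite_Basis b]) (auto intro: sum.cong)
      moreover have "?T y = y b *\<^sub>R b + (\<Sum>c\<in>Basis - {b}. y c *\<^sub>R c)"
        by (rule sum.remove[OF finite_Basis b])
      ultimately show ?thesis by (simp add: algebra_simps)
    qed
    moreover have "(\<lambda>t. g b (?T y + t *\<^sub>R b)) \<in> borel_measurable borel"
      using g[OF b] by measurable
    from nn_integral_real_affine[OF this, of 1 "- y b"]
    have "(\<integral>\<^sup>+t. g b (?T y + t *\<^sub>R b) \<partial>lborel) = (\<integral>\<^sup>+t. g b (?T y + (t - y b) *\<^sub>R b) \<partial>lborel)" by simp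
    ultimately show ?thesis by simp
  qed
  have "(\<integral>\<^sup>+y. f (?T y) \<partial>?P) ^ (card (Basis::'a set) - 1) \<le> (\<Prod>b\<in>Basis. \<integral>\<^sup>+y. g b (?T y) \<partial>?P)"
  proof (rule gagliardo_product)
    show "f (?T x) ^ (DIM('a) - 1) \<le> (\<Prod>i\<in>Basis. \<integral>\<^sup>+t. g i (?T (x(i := t))) \<partial>lborel)" for x
      using le[of "?T x"] by (simp add: line cong: prod.cong)
  qed (use dim f g T in \<open>auto intro: measurable_compose\<close>)
  then show ?thesis using tr f g by (simp cong: prod.cong)
qed


section \<open>The Sobolev inequality for smooth functions\<close>

definition classical_grad :: "(real ^ 'n \<Rightarrow> real) \<Rightarrow> real ^ 'n \<Rightarrow> real ^ 'n" where
  "classical_grad \<phi> x = (\<chi> i. partial_deriv i \<phi> x)"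

lemma classical_grad_continuous: "\<phi> \<in> C1_compact \<Longrightarrow> continuous_on UNIV (classical_grad \<phi>)"
  unfolding classical_grad_def[abs_def] by (intro continuous_on_vec_lambda C1_compact_partial_continuous)

lemma abs_powr_has_derivative:
  fixes \<kappa> :: real
  assumes "\<kappa> > 0"
  shows "((\<lambda>s. \<bar>s\<bar> powr (\<kappa> + 1)) has_real_derivative (\<kappa> + 1) * \<bar>s\<bar> powr \<kappa> * sgn s) (at s)"
proof (cases s "0::real" rule: linorder_cases)
  case less
  have "((\<lambda>s. (- s) powr (\<kappa> + 1)) has_real_derivative (\<kappa> + 1) * (- s) powr \<kappa> * (- 1)) (at s)"
    using less by (auto intro!: derivative_eq_intros)
  moreover have "\<forall>\<^sub>F t in nhds s. t < 0" using eventually_nhds_in_open[of "{..<0}" s] less by simp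
  ultimately show ?thesis using less
    by (subst DERIV_cong_ev[OF refl, where g = "\<lambda>s. (- s) powr (\<kappa> + 1)"]) (auto elim!: eventually_mono)
next
  case greater
  have "((\<lambda>s. s powr (\<kappa> + 1)) has_real_derivative (\<kappa> + 1) * s powr \<kappa>) (at s)"
    using greater by (auto intro!: derivative_eq_intros)
  moreover have "\<forall>\<^sub>F t in nhds s. t > 0" using eventually_nhds_in_open[of "{0<..}" s] greater by simp
  ultimately show ?thesis using greater
    by (subst DERIV_cong_ev[OF refl, where g = "\<lambda>s. s powr (\<kappa> + 1)"]) (auto elim!: eventually_mono)
next
  case equal
  have "((\<lambda>h::real. \<bar>h\<bar> powr \<kappa>) \<longlongrightarrow> \<bar>0\<bar> powr \<kappa>) (at 0)"
    using assms by (intro tendsto_powr' tendsto_rabs tendsto_ident_at tendsto_const) auto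
  then have "((\<lambda>h::real. \<bar>h\<bar> powr \<kappa>) \<longlongrightarrow> 0) (at 0)" by simp
  then have "((\<lambda>h. \<bar>h\<bar> powr (\<kappa> + 1) / h) \<longlongrightarrow> 0) (at (0::real))"
    by (rule tendsto_rabs_zero_cancel[OF Lim_transform_eventually])
       (auto simp: eventually_at_filter powr_add)
  then show ?thesis using equal by (simp add: DERIV_def)
qed

text \<open>The fundamental theorem of calculus along the line, starting at a point outside the support.\<close>
lemma powr_le_line_integral:
  fixes \<phi> :: "real^'n \<Rightarrow> real"
  assumes \<phi>: "\<phi> \<in> C1_compact" and \<kappa>: "\<kappa> > 0"
  shows "ennreal (\<bar>\<phi> x\<bar> powr (\<kappa> + 1)) \<le>
    (\<integral>\<^sup>+t. ennreal ((\<kappa> + 1) * \<bar>\<phi> (x + t *\<^sub>R axis i 1)\<bar> powr \<kappa> * \<bar>partial_deriv i \<phi> (x + t *\<^sub>R axis i 1)\<bar>) \<partial>lborel)"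
proof -
  obtain B R where "B \<ge> 0" "R > 0" "\<And>x. \<bar>\<phi> x\<bar> \<le> B" "\<And>x. \<bar>partial_deriv i \<phi> x\<bar> \<le> B"
      and R: "\<And>x. R \<le> norm x \<Longrightarrow> \<phi> x = 0" and "\<And>x. R \<le> norm x \<Longrightarrow> partial_deriv i \<phi> x = 0"
    by (rule C1_compact_bounds[OF \<phi>, of i]) blast
  define a where "a = - (norm x + R)"
  have "norm (x + a *\<^sub>R axis i 1) \<ge> norm (a *\<^sub>R axis i (1::real) :: real^'n) - norm x"
    by (metis norm_diff_ineq add.commute)
  moreover have "norm (a *\<^sub>R axis i (1::real) :: real^'n) = norm x + R"
    using \<open>R > 0\<close> norm_ge_zero[of x] unfolding a_def norm_scaleR norm_axis_1 mult_1_right real_norm_def by linarith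
  ultimately have far: "\<phi> (x + a *\<^sub>R axis i 1) = 0" using R by auto
  have a: "a \<le> 0" using \<open>R > 0\<close> norm_ge_zero[of x] unfolding a_def by linarith
  let ?w = "\<lambda>t. \<phi> (x + t *\<^sub>R axis i 1)"
  let ?d = "\<lambda>t. partial_deriv i \<phi> (x + t *\<^sub>R axis i 1)"
  let ?D = "\<lambda>t. (\<kappa> + 1) * \<bar>?w t\<bar> powr \<kappa> * sgn (?w t) * ?d t"
  let ?G = "\<lambda>t. (\<kappa> + 1) * \<bar>?w t\<bar> powr \<kappa> * \<bar>?d t\<bar>"
  have contw: "continuous_on UNIV ?w" "continuous_on UNIV ?d"
    by (auto intro!: continuous_on_compose2[OF C1_compact_continuous[OF \<phi>]]
        continuous_on_compose2[OF C1_compact_partial_continuous[OF \<phi>]] continuous_intros)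
  have contG: "continuous_on UNIV ?G"
    using \<kappa> by (intro continuous_intros continuous_on_powr' contw) auto
  have "((\<lambda>t. \<bar>?w t\<bar> powr (\<kappa> + 1)) has_vector_derivative ?D t) (at t within {a..0})" for t
    using DERIV_chain2[OF abs_powr_has_derivative[OF \<kappa>] C1_compact_line_derivative[OF \<phi>]]
    by (simp add: has_real_derivative_iff_has_vector_derivative has_vector_derivative_at_within)
  then have D: "(?D has_integral (\<bar>?w 0\<bar> powr (\<kappa> + 1) - \<bar>?w a\<bar> powr (\<kappa> + 1))) {a..0}"
    using a by (intro fundamental_theorem_of_calculus) auto
  have G: "?G integrable_on {a..0}"
    by (rule integrable_continuous_real) (use contG continuous_on_subset in blast)
  have "norm (integral {a..0} ?D) \<le> integral {a..0} ?G"
    using D G \<kappa> by (intro integral_norm_bound_integral) (auto simp: abs_mult abs_sgn_eq has_integral_integrable intro!: mult_nonneg_nonneg)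
  then have "\<bar>\<phi> x\<bar> powr (\<kappa> + 1) \<le> integral {a..0} ?G"
    using integral_unique[OF D] far by simp
  then have "ennreal (\<bar>\<phi> x\<bar> powr (\<kappa> + 1)) \<le> ennreal (integral {a..0} ?G)" by (rule ennreal_leI)
  also have "\<dots> = (\<integral>\<^sup>+t. ennreal (?G t) * indicator {a..0} t \<partial>lborel)"
    using \<kappa> G borel_measurable_continuous_onI[OF contG]
    by (intro nn_integral_has_integral_lebesgue'[symmetric] integrable_integral) auto
  also have "\<dots> \<le> (\<integral>\<^sup>+t. ennreal (?G t) \<partial>lborel)"
    by (intro nn_integral_mono) (auto simp: indicator_def)
  finally show ?thesis .
qed


text \<open>
  Gagliardo's argument applied to \<open>\<bar>\<phi>\<bar> powr (\<kappa> + 1)\<close> with \<open>\<kappa> = N / (N - 2)\<close>: this is the exponent for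
  which the Cauchy--Schwarz inequality reproduces the integral of \<open>\<bar>\<phi>\<bar> powr (2 * \<kappa>)\<close>, which can
  then be cancelled because it is finite.
\<close>
theorem sobolev_inequality_C1_compact:
  fixes \<phi> :: "real^'n \<Rightarrow> real"
  assumes N: "CARD('n) \<ge> 3" and \<phi>: "\<phi> \<in> C1_compact"
  defines "\<kappa> \<equiv> real CARD('n) / (real CARD('n) - 2)"
  shows "(\<integral>\<^sup>+x. ennreal (\<bar>\<phi> x\<bar> powr (2 * \<kappa>)) \<partial>lborel) ^ (CARD('n) - 2)
    \<le> ennreal ((\<kappa> + 1) ^ (2 * CARD('n))) * (\<integral>\<^sup>+x. ennreal ((norm (classical_grad \<phi> x))\<^sup>2) \<partial>lborel) ^ CARD('n)"
proof -
  let ?N = "CARD('n)"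
  define S where "S = (\<integral>\<^sup>+x. ennreal (\<bar>\<phi> x\<bar> powr (2 * \<kappa>)) \<partial>lborel)"
  define G where "G = (\<integral>\<^sup>+x. ennreal ((norm (classical_grad \<phi> x))\<^sup>2) \<partial>lborel)"
  define A where "A = (\<integral>\<^sup>+x. ennreal (\<bar>\<phi> x\<bar> powr \<kappa> * norm (classical_grad \<phi> x)) \<partial>lborel)"
  have \<kappa>: "\<kappa> > 0" using N by (simp add: \<kappa>_def)
  have \<kappa>_eq: "(\<kappa> + 1) * real ?N = 2 * \<kappa> * real (?N - 1)"
    using N by (simp add: \<kappa>_def field_simps of_nat_diff)
  have [measurable]: "\<phi> \<in> borel_measurable borel" "classical_grad \<phi> \<in> borel_measurable borel"
    by (intro borel_measurable_continuous_onI C1_compact_continuous classical_grad_continuous \<phi>)+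
  have dim: "DIM(real^'n) = ?N" by simp
  have step: "S ^ (?N - 1) \<le> (ennreal (\<kappa> + 1) * A) ^ ?N"
  proof -
    let ?g = "\<lambda>x. ennreal ((\<kappa> + 1) * \<bar>\<phi> x\<bar> powr \<kappa> * norm (classical_grad \<phi> x))"
    have "S ^ (DIM(real^'n) - 1) \<le> (\<Prod>b\<in>(Basis::(real^'n) set). \<integral>\<^sup>+x. ?g x \<partial>lborel)"
      unfolding S_def
    proof (rule gagliardo_lborel)
      fix x :: "real^'n"
      have "ennreal (\<bar>\<phi> x\<bar> powr (2 * \<kappa>)) ^ (?N - 1) = ennreal (\<bar>\<phi> x\<bar> powr (\<kappa> + 1)) ^ ?N"
      proof (cases "\<phi> x = 0")
        case False
        have "(\<bar>\<phi> x\<bar> powr (2 * \<kappa>)) ^ (?N - 1) = \<bar>\<phi> x\<bar> powr (2 * \<kappa> * real (?N - 1))"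
          using False by (simp add: powr_realpow[symmetric] powr_powr)
        also have "\<dots> = (\<bar>\<phi> x\<bar> powr (\<kappa> + 1)) ^ ?N"
          using False by (simp add: powr_realpow[symmetric] powr_powr \<kappa>_eq)
        finally show ?thesis by (simp add: ennreal_power)
      qed (use N in \<open>simp add: zero_power\<close>)
      also have "\<dots> = (\<Prod>b\<in>(Basis::(real^'n) set). ennreal (\<bar>\<phi> x\<bar> powr (\<kappa> + 1)))"
        by simp
      also have "\<dots> \<le> (\<Prod>b\<in>Basis. \<integral>\<^sup>+t. ?g (x + t *\<^sub>R b) \<partial>lborel)"
      proof (rule prod_mono_ennreal)
        fix b :: "real^'n" assume "b \<in> Basis"
        then obtain i where b: "b = axis i 1" by (auto simp: Basis_vec_def)
        have "ennreal (\<bar>\<phi> x\<bar> powr (\<kappa> + 1)) \<le>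
          (\<integral>\<^sup>+t. ennreal ((\<kappa> + 1) * \<bar>\<phi> (x + t *\<^sub>R b)\<bar> powr \<kappa> * \<bar>partial_deriv i \<phi> (x + t *\<^sub>R b)\<bar>) \<partial>lborel)"
          unfolding b by (rule powr_le_line_integral[OF \<phi> \<kappa>])
        also have "\<dots> \<le> (\<integral>\<^sup>+t. ?g (x + t *\<^sub>R b) \<partial>lborel)"
        proof (intro nn_integral_mono ennreal_leI mult_left_mono)
          fix t
          show "\<bar>partial_deriv i \<phi> (x + t *\<^sub>R b)\<bar> \<le> norm (classical_grad \<phi> (x + t *\<^sub>R b))"
            using component_le_norm_cart[of "classical_grad \<phi> (x + t *\<^sub>R b)" i] by (simp add: classical_grad_def)
        qed (use \<kappa> in auto)
        finally show "ennreal (\<bar>\<phi> x\<bar> powr (\<kappa> + 1)) \<le> (\<integral>\<^sup>+t. ?g (x + t *\<^sub>R b) \<partial>lborel)" .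
      qed
      finally show "ennreal (\<bar>\<phi> x\<bar> powr (2 * \<kappa>)) ^ (DIM(real^'n) - 1) \<le> (\<Prod>b\<in>Basis. \<integral>\<^sup>+t. ?g (x + t *\<^sub>R b) \<partial>lborel)"
        unfolding dim .
    qed (use N in auto)
    moreover have "(\<integral>\<^sup>+x. ?g x \<partial>lborel) = ennreal (\<kappa> + 1) * A"
    proof -
      have "?g x = ennreal (\<kappa> + 1) * ennreal (\<bar>\<phi> x\<bar> powr \<kappa> * norm (classical_grad \<phi> x))" for x
        using \<kappa> by (subst ennreal_mult[symmetric]) (simp_all add: mult.assoc)
      then show ?thesis unfolding A_def by (simp only: nn_integral_cmult) (simp add: nn_integral_cmult)
    qed
    ultimately show ?thesis by simp
  qed
  have CS: "A\<^sup>2 \<le> S * G"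
  proof -
    let ?h = "\<lambda>b x. if b then ennreal (\<bar>\<phi> x\<bar> powr (2 * \<kappa>)) else ennreal ((norm (classical_grad \<phi> x))\<^sup>2)"
    have "A ^ card (UNIV::bool set) \<le> (\<Prod>b\<in>UNIV. \<integral>\<^sup>+x. ?h b x \<partial>lborel)"
      unfolding A_def
    proof (rule nn_integral_power_le_prod)
      fix x
      have "(\<bar>\<phi> x\<bar> powr \<kappa> * norm (classical_grad \<phi> x))\<^sup>2 = \<bar>\<phi> x\<bar> powr (2 * \<kappa>) * (norm (classical_grad \<phi> x))\<^sup>2"
        by (simp add: power_mult_distrib power2_eq_square[of "_ powr _"] powr_add[symmetric])
      then show "ennreal (\<bar>\<phi> x\<bar> powr \<kappa> * norm (classical_grad \<phi> x)) ^ card (UNIV::bool set) \<le> (\<Prod>b\<in>UNIV. ?h b x)"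
        by (simp add: UNIV_bool card_insert_if ennreal_power ennreal_mult[symmetric] mult.commute numeral_2_eq_2[symmetric])
    qed auto
    then show ?thesis by (simp add: UNIV_bool S_def G_def mult.commute numeral_2_eq_2[symmetric])
  qed
  have S_fin: "S \<noteq> \<infinity>"
  proof -
    obtain B R where B: "B \<ge> 0" "R > 0" "\<And>x. \<bar>\<phi> x\<bar> \<le> B" "\<And>x. \<bar>partial_deriv undefined \<phi> x\<bar> \<le> B"
      and R: "\<And>x. R \<le> norm x \<Longrightarrow> \<phi> x = 0" and "\<And>x. R \<le> norm x \<Longrightarrow> partial_deriv undefined \<phi> x = 0"
      by (rule C1_compact_bounds[OF \<phi>, of undefined]) blast
    have "S \<le> (\<integral>\<^sup>+x. ennreal (B powr (2 * \<kappa>)) * indicator (cball (0::real^'n) R) x \<partial>lborel)"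
      unfolding S_def
    proof (intro nn_integral_mono)
      fix x
      show "ennreal (\<bar>\<phi> x\<bar> powr (2 * \<kappa>)) \<le> ennreal (B powr (2 * \<kappa>)) * indicator (cball 0 R) x"
        using R[of x] B(3)[of x] \<kappa> by (cases "x \<in> cball 0 R") (auto intro!: ennreal_leI powr_mono2)
    qed
    also have "\<dots> = ennreal (B powr (2 * \<kappa>)) * emeasure lborel (cball (0::real^'n) R)"
      by (rule nn_integral_cmult_indicator) simp
    also have "\<dots> < \<infinity>"
      using emeasure_lborel_cball_finite[of "0::real^'n" R] by (simp add: ennreal_mult_less_top)
    finally show ?thesis by simp
  qed
  have "?N + (?N - 2) = (?N - 1) * 2" using N by linarith
  then have "S ^ ?N * S ^ (?N - 2) = (S ^ (?N - 1))\<^sup>2"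
    by (simp only: power_add[symmetric] power_mult[symmetric])
  also have "\<dots> \<le> ((ennreal (\<kappa> + 1) * A) ^ ?N)\<^sup>2"
    using step by (rule power_mono) simp
  also have "\<dots> = ennreal ((\<kappa> + 1) ^ (2 * ?N)) * (A\<^sup>2) ^ ?N"
    using \<kappa> by (simp add: power_mult_distrib power_mult[symmetric] ennreal_power[symmetric] mult.commute)
  also have "\<dots> \<le> ennreal ((\<kappa> + 1) ^ (2 * ?N)) * (S * G) ^ ?N"
    by (intro mult_left_mono power_mono CS) auto
  also have "\<dots> = S ^ ?N * (ennreal ((\<kappa> + 1) ^ (2 * ?N)) * G ^ ?N)"
    by (simp add: power_mult_distrib ac_simps)
  finally have le: "S ^ ?N * S ^ (?N - 2) \<le> S ^ ?N * (ennreal ((\<kappa> + 1) ^ (2 * ?N)) * G ^ ?N)" .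
  have "S ^ (?N - 2) \<le> ennreal ((\<kappa> + 1) ^ (2 * ?N)) * G ^ ?N"
  proof (cases "S = 0")
    case False
    then have "S ^ ?N \<noteq> 0" "S ^ ?N \<noteq> \<infinity>" using S_fin by (auto simp: power_eq_top_ennreal)
    then show ?thesis using le by (simp add: ennreal_mult_le_mult_iff)
  qed (use N in \<open>simp add: zero_power\<close>)
  then show ?thesis by (simp add: S_def G_def)
qed


section \<open>Completeness of \<open>L\<^sup>q\<close>\<close>

text \<open>
  The \<open>q\<close>-th power of the \<open>L\<^sup>q\<close> norm. Convergence of the norm to \<open>0\<close> is the same as convergence of this power, and
  countable sums and Fatou's lemma apply to it directly.
\<close>
abbreviation powr_integral :: "'a measure \<Rightarrow> real \<Rightarrow> ('a \<Rightarrow> 'b::euclidean_space) \<Rightarrow> ennreal" where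
  "powr_integral M q f \<equiv> \<integral>\<^sup>+x. ennreal (norm (f x) powr q) \<partial>M"

lemma tendsto_0_ennreal_iff:
  fixes X :: "'a \<Rightarrow> ennreal"
  shows "(X \<longlongrightarrow> 0) F \<longleftrightarrow> (\<forall>e>0. \<forall>\<^sub>F n in F. X n \<le> ennreal e)"
proof
  assume "(X \<longlongrightarrow> 0) F"
  then have "\<forall>\<^sub>F n in F. X n < ennreal e" if "e > 0" for e
    using that by (intro order_tendstoD(2)) auto
  then show "\<forall>e>0. \<forall>\<^sub>F n in F. X n \<le> ennreal e"
    by (intro allI impI) (rule eventually_mono[OF _ less_imp_le])
next
  assume *: "\<forall>e>0. \<forall>\<^sub>F n in F. X n \<le> ennreal e"
  show "(X \<longlongrightarrow> 0) F"
  proof (rule order_tendstoI)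
    fix a :: ennreal assume "0 < a"
    then obtain b where b: "0 < b" "b < a" using dense by blast
    then obtain e where e: "b = ennreal e" by (cases b) auto
    then have "e > 0" using b by (simp add: ennreal_less_zero_iff)
    then show "\<forall>\<^sub>F n in F. X n < a"
      using * b unfolding e by (auto elim!: eventually_mono)
  qed auto
qed

text \<open>
  A subsequence with fast decaying increments converges almost everywhere, and Fatou's lemma upgrades this to
  convergence of the integrals. No triangle inequality for the norm enters, so any \<open>q > 0\<close> is possible.
\<close>
lemma Lq_Cauchy_imp_convergent:
  fixes f :: "nat \<Rightarrow> 'a \<Rightarrow> 'b::euclidean_space"
  assumes q: "q > 0" and f[measurable]: "\<And>n. f n \<in> borel_measurable M"
    and Cauchy: "\<And>e. e > 0 \<Longrightarrow> \<exists>N. \<forall>m\<ge>N. \<forall>n\<ge>N. (powr_integral M q (\<lambda>x. f m x - f n x)) \<le> ennreal e"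
  obtains g where "g \<in> borel_measurable M" "(\<lambda>n. powr_integral M q (\<lambda>x. f n x - g x)) \<longlonglongrightarrow> 0"
proof -
  \<comment> \<open>This rate makes \<open>\<Sum>k. 2 powr (k * q) * \<integral>\<bar>f (r (k + 1)) - f (r k)\<bar> powr q\<close> converge.\<close>
  define e where "e k = (1/2) ^ k * (2 powr - (real k * q))" for k :: nat
  have "\<forall>k. \<exists>N. \<forall>m\<ge>N. \<forall>n\<ge>N. (powr_integral M q (\<lambda>x. f m x - f n x)) \<le> ennreal (e k)"
    using Cauchy by (simp add: e_def)
  then obtain N where N: "\<And>k m n. m \<ge> N k \<Longrightarrow> n \<ge> N k \<Longrightarrow> (powr_integral M q (\<lambda>x. f m x - f n x)) \<le> ennreal (e k)"
    by metis
  define r where "r k = (\<Sum>i\<le>k. N i) + k" for k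
  have N_le: "N k \<le> (\<Sum>i\<le>k. N i)" for k by (rule member_le_sum) auto
  have rN: "r k \<ge> N k" "r (Suc k) \<ge> N k" for k
    using N_le[of k] unfolding r_def by simp_all
  have rk: "r k \<ge> k" for k
    unfolding r_def by simp
  let ?d = "\<lambda>k x. f (r (Suc k)) x - f (r k) x"
  have "(\<integral>\<^sup>+x. (\<Sum>k. ennreal (2 powr (real k * q)) * ennreal (norm (?d k x) powr q)) \<partial>M)
      = (\<Sum>k. \<integral>\<^sup>+x. ennreal (2 powr (real k * q)) * ennreal (norm (?d k x) powr q) \<partial>M)"
    by (intro nn_integral_suminf) auto
  also have "\<dots> = (\<Sum>k. ennreal (2 powr (real k * q)) * (powr_integral M q (\<lambda>x. ?d k x)))"
    by (simp add: nn_integral_cmult)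
  also have "\<dots> \<le> (\<Sum>k. ennreal (2 powr (real k * q)) * ennreal (e k))"
    by (intro suminf_le mult_left_mono N rN) auto
  also have "\<dots> = (\<Sum>k. ennreal ((1/2) ^ k))"
    by (simp add: e_def ennreal_mult[symmetric] powr_minus field_simps)
  also have "\<dots> = ennreal (\<Sum>k. (1/2) ^ k)"
    by (intro suminf_ennreal2) (auto intro: summable_geometric)
  finally have "(\<integral>\<^sup>+x. (\<Sum>k. ennreal (2 powr (real k * q)) * ennreal (norm (?d k x) powr q)) \<partial>M) \<noteq> \<infinity>"
    by (auto simp: top_unique)
  then have ae_fin: "AE x in M. (\<Sum>k. ennreal (2 powr (real k * q)) * ennreal (norm (?d k x) powr q)) \<noteq> \<infinity>"
    by (intro nn_integral_PInf_AE) auto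
  have ae: "AE x in M. convergent (\<lambda>k. f (r k) x)"
  proof (rule AE_mp[OF ae_fin], intro AE_I2 impI)
    fix x assume fin: "(\<Sum>k. ennreal (2 powr (real k * q)) * ennreal (norm (?d k x) powr q)) \<noteq> \<infinity>"
    then have "(\<Sum>k. ennreal (2 powr (real k * q) * norm (?d k x) powr q)) \<noteq> \<infinity>"
      by (simp add: ennreal_mult)
    then have "summable (\<lambda>k. 2 powr (real k * q) * norm (?d k x) powr q)"
      by (intro summable_suminf_not_top) auto
    then have "(\<lambda>k. 2 powr (real k * q) * norm (?d k x) powr q) \<longlonglongrightarrow> 0"
      by (rule summable_LIMSEQ_zero)
    then have "\<forall>\<^sub>F k in sequentially. 2 powr (real k * q) * norm (?d k x) powr q < 1"
      by (rule order_tendstoD) simp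
    then have "\<forall>\<^sub>F k in sequentially. norm (?d k x) \<le> (1/2) ^ k"
    proof (rule eventually_mono)
      fix k assume "2 powr (real k * q) * norm (?d k x) powr q < 1"
      then have "(2 ^ k * norm (?d k x)) powr q < 1 powr q"
        by (simp add: powr_mult powr_powr[symmetric] powr_realpow)
      then have "2 ^ k * norm (?d k x) \<le> 1"
        using q by (meson linorder_not_le powr_mono2 less_imp_le zero_le_one)
      then show "norm (?d k x) \<le> (1/2) ^ k" by (simp add: field_simps power_one_over)
    qed
    then have "summable (\<lambda>k. ?d k x)"
      by (intro summable_comparison_test_ev[OF _ summable_geometric]) auto
    then have "convergent (\<lambda>k. f (r 0) x + (\<Sum>i<k. ?d i x))"
      by (intro convergent_add convergent_const) (simp add: summable_iff_convergent)
    moreover have "f (r 0) x + (\<Sum>i<k. ?d i x) = f (r k) x" for k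
      using sum_lessThan_telescope[of "\<lambda>k. f (r k) x" k] by simp
    ultimately show "convergent (\<lambda>k. f (r k) x)" by simp
  qed
  define g where "g x = lim (\<lambda>k. f (r k) x)" for x
  have g[measurable]: "g \<in> borel_measurable M"
    unfolding g_def[abs_def] by (rule borel_measurable_lim_metric) auto
  have lim: "AE x in M. (\<lambda>k. f (r k) x) \<longlonglongrightarrow> g x"
    using ae by eventually_elim (simp add: g_def convergent_LIMSEQ_iff)
  have "(\<lambda>n. powr_integral M q (\<lambda>x. f n x - g x)) \<longlonglongrightarrow> 0"
    unfolding tendsto_0_ennreal_iff
  proof (intro allI impI)
    fix \<epsilon> :: real assume "\<epsilon> > 0"
    from Cauchy[OF this] obtain N0
      where N0: "\<And>m n. m \<ge> N0 \<Longrightarrow> n \<ge> N0 \<Longrightarrow> (powr_integral M q (\<lambda>x. f m x - f n x)) \<le> ennreal \<epsilon>"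
      by blast
    have "(powr_integral M q (\<lambda>x. f n x - g x)) \<le> ennreal \<epsilon>" if n: "n \<ge> N0" for n
    proof -
      have "(powr_integral M q (\<lambda>x. f n x - g x)) = (\<integral>\<^sup>+x. liminf (\<lambda>k. ennreal (norm (f n x - f (r k) x) powr q)) \<partial>M)"
      proof (rule nn_integral_cong_AE, rule AE_mp[OF lim], intro AE_I2 impI)
        fix x assume "(\<lambda>k. f (r k) x) \<longlonglongrightarrow> g x"
        then have "(\<lambda>k. ennreal (norm (f n x - f (r k) x) powr q)) \<longlonglongrightarrow> ennreal (norm (f n x - g x) powr q)"
          using q by (intro tendsto_ennrealI tendsto_powr' tendsto_intros) auto
        from lim_imp_Liminf[OF _ this]
        show "ennreal (norm (f n x - g x) powr q) = liminf (\<lambda>k. ennreal (norm (f n x - f (r k) x) powr q))" by simp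
      qed
      also have "\<dots> \<le> liminf (\<lambda>k. powr_integral M q (\<lambda>x. f n x - f (r k) x))"
        by (rule nn_integral_liminf) auto
      also have "\<dots> \<le> limsup (\<lambda>k. powr_integral M q (\<lambda>x. f n x - f (r k) x))"
        by (rule Liminf_le_Limsup) simp
      also have "\<dots> \<le> ennreal \<epsilon>"
        using n rk by (intro Limsup_bounded eventually_sequentiallyI[of N0] N0) (auto intro: order_trans)
      finally show ?thesis .
    qed
    then show "\<forall>\<^sub>F n in sequentially. (powr_integral M q (\<lambda>x. f n x - g x)) \<le> ennreal \<epsilon>"
      by (auto simp: eventually_sequentially)
  qed
  with g show thesis by (rule that)
qed

lemma Lq_convergent_imp_AE_subseq:
  fixes f :: "nat \<Rightarrow> 'a \<Rightarrow> 'b::euclidean_space"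
  assumes q: "q > 0" and f[measurable]: "\<And>n. f n \<in> borel_measurable M" and g[measurable]: "g \<in> borel_measurable M"
    and lim: "(\<lambda>n. powr_integral M q (\<lambda>x. f n x - g x)) \<longlonglongrightarrow> 0"
  obtains r where "strict_mono r" "AE x in M. (\<lambda>n. f (r n) x) \<longlonglongrightarrow> g x"
proof -
  let ?I = "\<lambda>n. powr_integral M q (\<lambda>x. f n x - g x)"
  have "\<forall>\<^sub>F n in sequentially. ?I n \<le> ennreal 1" using lim[unfolded tendsto_0_ennreal_iff, rule_format, of 1] by simp
  then obtain n0 where n0: "\<And>n. n \<ge> n0 \<Longrightarrow> ?I n \<le> 1" by (auto simp: eventually_sequentially)
  let ?u = "\<lambda>n x. norm (f (n + n0) x - g x) powr q"
  have fin: "?I (n + n0) < \<infinity>" for n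
    using n0[of "n + n0"] by (auto simp: less_top[symmetric] top_unique)
  have int: "integrable M (?u n)" for n
    using fin[of n] by (intro integrableI_nonneg) auto
  have "ennreal (LINT x|M. norm (?u n x)) = ?I (n + n0)" for n
    using nn_integral_eq_integral[OF int[of n]] by simp
  then have "(\<lambda>n. ennreal (LINT x|M. norm (?u n x))) \<longlonglongrightarrow> ennreal 0"
    using LIMSEQ_ignore_initial_segment[OF lim, of n0] by simp
  then have "(\<lambda>n. LINT x|M. norm (?u n x)) \<longlonglongrightarrow> 0"
    by (subst (asm) tendsto_ennreal_iff) auto
  from tendsto_L1_AE_subseq[OF int this] obtain r where r: "strict_mono r" "AE x in M. (\<lambda>n. ?u (r n) x) \<longlonglongrightarrow> 0"
    by blast
  show thesis
  proof (rule that[of "\<lambda>n. r n + n0"])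
    show "strict_mono (\<lambda>n. r n + n0)" using r(1) by (auto simp: strict_mono_def)
    show "AE x in M. (\<lambda>n. f (r n + n0) x) \<longlonglongrightarrow> g x"
    proof (rule AE_mp[OF r(2)], intro AE_I2 impI)
      fix x assume "(\<lambda>n. ?u (r n) x) \<longlonglongrightarrow> 0"
      then have "(\<lambda>n. ?u (r n) x powr (1 / q)) \<longlonglongrightarrow> 0 powr (1 / q)"
        using q by (intro tendsto_powr' tendsto_const) auto
      then have "(\<lambda>n. norm (f (r n + n0) x - g x)) \<longlonglongrightarrow> 0"
        using q by (simp add: powr_powr)
      then show "(\<lambda>n. f (r n + n0) x) \<longlonglongrightarrow> g x"
        using tendsto_norm_zero_iff LIM_zero_iff by blast
    qed
  qed
qed

text \<open>
  The pointwise form of the embedding of \<open>L\<^sup>q\<close> into \<open>L\<^sup>1\<close> on sets of finite measure. The free parameter \<open>\<epsilon>\<close>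
  replaces Hoelder's inequality: the first term is small uniformly, the second as soon as the \<open>L\<^sup>q\<close> norm is small.
\<close>
lemma le_add_powr:
  assumes "(t::real) \<ge> 0" "\<epsilon> > 0" "q \<ge> 1"
  shows "t \<le> \<epsilon> + \<epsilon> powr (1 - q) * t powr q"
proof (cases "t \<le> \<epsilon>")
  case True
  then show ?thesis by (simp add: add_increasing2)
next
  case False
  then have "t = t powr (1 - q) * t powr q" using assms by (simp add: powr_add[symmetric])
  also have "\<dots> \<le> \<epsilon> powr (1 - q) * t powr q"
    using False assms by (intro mult_right_mono powr_mono2') auto
  finally show ?thesis using assms(2) by linarith
qed

lemma nn_integral_finite_set_le:
  fixes f :: "'a \<Rightarrow> 'b::euclidean_space"
  assumes "\<epsilon> > 0" "q \<ge> 1" and [measurable]: "f \<in> borel_measurable M" "K \<in> sets M"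
  shows "(\<integral>\<^sup>+x. ennreal (norm (f x)) * indicator K x \<partial>M)
    \<le> ennreal \<epsilon> * emeasure M K + ennreal (\<epsilon> powr (1 - q)) * (\<integral>\<^sup>+x. ennreal (norm (f x) powr q) \<partial>M)"
proof -
  have "(\<integral>\<^sup>+x. ennreal (norm (f x)) * indicator K x \<partial>M)
      \<le> (\<integral>\<^sup>+x. ennreal \<epsilon> * indicator K x + ennreal (\<epsilon> powr (1 - q)) * ennreal (norm (f x) powr q) \<partial>M)"
  proof (intro nn_integral_mono)
    fix x
    have "ennreal (norm (f x)) \<le> ennreal (\<epsilon> + \<epsilon> powr (1 - q) * norm (f x) powr q)"
      using assms by (intro ennreal_leI le_add_powr) auto
    also have "\<dots> = ennreal \<epsilon> + ennreal (\<epsilon> powr (1 - q)) * ennreal (norm (f x) powr q)"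
      using assms(1) by (simp add: ennreal_plus ennreal_mult)
    finally show "ennreal (norm (f x)) * indicator K x \<le> ennreal \<epsilon> * indicator K x + ennreal (\<epsilon> powr (1 - q)) * ennreal (norm (f x) powr q)"
      by (cases "x \<in> K") auto
  qed
  also have "\<dots> = ennreal \<epsilon> * emeasure M K + ennreal (\<epsilon> powr (1 - q)) * (powr_integral M q f)"
    by (simp add: nn_integral_add nn_integral_cmult nn_integral_cmult_indicator)
  finally show ?thesis .
qed

lemma Lq_locally_integrable:
  fixes f :: "real^'n \<Rightarrow> 'b::euclidean_space"
  assumes q: "q \<ge> 1" and f: "f \<in> borel_measurable lebesgue" and fin: "(powr_integral lebesgue q f) \<noteq> \<infinity>"
  shows "locally_integrable f"
  unfolding locally_integrable_def
proof (intro allI impI)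
  fix K :: "(real^'n) set" assume K: "compact K"
  have Ks: "K \<in> sets lebesgue" and Kf: "emeasure lebesgue K < \<infinity>"
    using lmeasurable_compact[OF K] by (auto simp: fmeasurable_def)
  have "(\<integral>\<^sup>+x. ennreal (norm (indicator K x *\<^sub>R f x)) \<partial>lebesgue) = (\<integral>\<^sup>+x. ennreal (norm (f x)) * indicator K x \<partial>lebesgue)"
    by (intro nn_integral_cong) (auto simp: indicator_def)
  also have "\<dots> \<le> ennreal 1 * emeasure lebesgue K + ennreal (1 powr (1 - q)) * (\<integral>\<^sup>+x. ennreal (norm (f x) powr q) \<partial>lebesgue)"
    by (rule nn_integral_finite_set_le) (use q f Ks in auto)
  also have "\<dots> < \<infinity>" using Kf fin by (auto simp: less_top)
  finally have "(\<integral>\<^sup>+x. ennreal (norm (indicator K x *\<^sub>R f x)) \<partial>lebesgue) < \<infinity>" .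
  moreover have "(\<lambda>x. indicator K x *\<^sub>R f x) \<in> borel_measurable lebesgue"
    by (intro borel_measurable_scaleR borel_measurable_indicator f Ks)
  ultimately show "set_integrable lebesgue K f"
    unfolding set_integrable_def by (intro integrableI_bounded)
qed

lemma Lq_convergence_imp_pairing_convergence:
  fixes f :: "nat \<Rightarrow> real^'n \<Rightarrow> real"
  assumes q: "q \<ge> 1" and f: "\<And>n. locally_integrable (f n)" and g: "locally_integrable g"
    and lim: "(\<lambda>n. \<integral>\<^sup>+x. ennreal (norm (f n x - g x) powr q) \<partial>lebesgue) \<longlonglongrightarrow> 0"
    and \<psi>: "continuous_on UNIV \<psi>" "compact (closure {x. \<psi> x \<noteq> 0})"
  shows "(\<lambda>n. LINT x|lebesgue. f n x * \<psi> x) \<longlonglongrightarrow> (LINT x|lebesgue. g x * \<psi> x)"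
proof -
  obtain B R where B: "B \<ge> 0" "R > 0" "\<And>x. \<bar>\<psi> x\<bar> \<le> B" and R: "\<And>x. R \<le> norm x \<Longrightarrow> \<psi> x = 0"
    by (rule compactly_supported_bounded[OF \<psi>]) blast
  let ?K = "cball (0::real^'n) R"
  have fm: "(\<lambda>x. f n x - g x) \<in> borel_measurable lebesgue" for n
    by (intro borel_measurable_diff locally_integrable_measurable f g)
  have bound: "norm ((LINT x|lebesgue. f n x * \<psi> x) - (LINT x|lebesgue. g x * \<psi> x))
     \<le> B * \<epsilon> * measure lebesgue ?K + B * \<epsilon> powr (1 - q) * enn2real (powr_integral lebesgue q (\<lambda>x. f n x - g x))"
    if "\<epsilon> > 0" and fin: "(powr_integral lebesgue q (\<lambda>x. f n x - g x)) \<noteq> \<infinity>" for n \<epsilon>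
  proof -
    let ?I = "powr_integral lebesgue q (\<lambda>x. f n x - g x)"
    have int: "integrable lebesgue (\<lambda>x. f n x * \<psi> x)" "integrable lebesgue (\<lambda>x. g x * \<psi> x)"
      by (intro locally_integrable_times_bounded f g \<psi>)+
    have "ennreal (norm ((LINT x|lebesgue. f n x * \<psi> x) - (LINT x|lebesgue. g x * \<psi> x)))
        = ennreal (norm (LINT x|lebesgue. f n x * \<psi> x - g x * \<psi> x))" using int by simp
    also have "\<dots> \<le> (\<integral>\<^sup>+x. ennreal (norm (f n x * \<psi> x - g x * \<psi> x)) \<partial>lebesgue)"
      using int by (intro integral_norm_bound_ennreal) auto
    also have "\<dots> \<le> (\<integral>\<^sup>+x. ennreal B * (ennreal (norm (f n x - g x)) * indicator ?K x) \<partial>lebesgue)"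
    proof (intro nn_integral_mono)
      fix x
      have "norm (f n x * \<psi> x - g x * \<psi> x) = \<bar>\<psi> x\<bar> * norm (f n x - g x)"
        by (simp add: left_diff_distrib[symmetric] abs_mult)
      also have "\<dots> \<le> B * norm (f n x - g x)" by (intro mult_right_mono B) auto
      finally have "ennreal (norm (f n x * \<psi> x - g x * \<psi> x)) \<le> ennreal B * ennreal (norm (f n x - g x))"
        using B(1) by (simp add: ennreal_mult[symmetric] ennreal_leI)
      then show "ennreal (norm (f n x * \<psi> x - g x * \<psi> x)) \<le> ennreal B * (ennreal (norm (f n x - g x)) * indicator ?K x)"
        using R[of x] by (cases "x \<in> ?K") auto
    qed
    also have "\<dots> = ennreal B * (\<integral>\<^sup>+x. ennreal (norm (f n x - g x)) * indicator ?K x \<partial>lebesgue)"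
    proof -
      note fm[measurable]
      have [measurable]: "?K \<in> sets lebesgue" by simp
      show ?thesis by (intro nn_integral_cmult) measurable
    qed
    also have "\<dots> \<le> ennreal B * (ennreal \<epsilon> * emeasure lebesgue ?K + ennreal (\<epsilon> powr (1 - q)) * ?I)"
      using that q fm by (intro mult_left_mono nn_integral_finite_set_le) auto
    also have "\<dots> = ennreal (B * \<epsilon> * measure lebesgue ?K + B * \<epsilon> powr (1 - q) * enn2real ?I)"
    proof -
      have I: "?I = ennreal (enn2real ?I)" using fin by (simp add: less_top)
      have K: "emeasure lebesgue ?K = ennreal (measure lebesgue ?K)"
        using lmeasurable_cball[of "0::real^'n" R] by (simp add: fmeasurable_def emeasure_eq_ennreal_measure less_top)
      show ?thesis
        using B(1) that(1) by (subst I, subst K) (simp add: ennreal_mult ennreal_plus distrib_left mult.assoc)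
    qed
    finally show ?thesis
      using B(1) that(1) by (subst (asm) ennreal_le_iff) (auto intro!: add_nonneg_nonneg mult_nonneg_nonneg)
  qed
  have Ifin: "\<forall>\<^sub>F n in sequentially. (\<integral>\<^sup>+x. ennreal (norm (f n x - g x) powr q) \<partial>lebesgue) \<noteq> \<infinity>"
    using order_tendstoD(2)[OF lim, of \<infinity>] by (auto elim: eventually_mono)
  have Ilim: "(\<lambda>n. enn2real (powr_integral lebesgue q (\<lambda>x. f n x - g x))) \<longlonglongrightarrow> 0"
    using tendsto_enn2real[OF lim[folded ennreal_0]] by simp
  show ?thesis
  proof (rule LIM_zero_cancel, rule tendstoI)
    fix e :: real assume e: "e > 0"
    define \<epsilon> where "\<epsilon> = e / (2 * (B * measure lebesgue ?K + 1))"
    have d: "B * measure lebesgue ?K + 1 > 0" using B(1) by (simp add: add_nonneg_pos)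
    then have \<epsilon>: "\<epsilon> > 0" using e by (simp add: \<epsilon>_def)
    have "(\<lambda>n. B * \<epsilon> powr (1 - q) * enn2real (powr_integral lebesgue q (\<lambda>x. f n x - g x))) \<longlonglongrightarrow> B * \<epsilon> powr (1 - q) * 0"
      by (intro tendsto_mult tendsto_const Ilim)
    then have "\<forall>\<^sub>F n in sequentially. B * \<epsilon> powr (1 - q) * enn2real (powr_integral lebesgue q (\<lambda>x. f n x - g x)) < e / 2"
      using e by (intro order_tendstoD(2)[where y = "B * \<epsilon> powr (1 - q) * 0"]) auto
    moreover have "B * \<epsilon> * measure lebesgue ?K \<le> e / 2"
    proof -
      have "B * \<epsilon> * measure lebesgue ?K \<le> \<epsilon> * (B * measure lebesgue ?K + 1)" using \<epsilon> by (simp add: algebra_simps)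
      also have "\<dots> = e / 2" using d by (simp add: \<epsilon>_def field_simps)
      finally show ?thesis .
    qed
    ultimately have small: "\<forall>\<^sub>F n in sequentially. B * \<epsilon> * measure lebesgue ?K + B * \<epsilon> powr (1 - q) * enn2real (powr_integral lebesgue q (\<lambda>x. f n x - g x)) < e"
      by (auto elim!: eventually_mono)
    show "\<forall>\<^sub>F n in sequentially. dist ((LINT x|lebesgue. f n x * \<psi> x) - (LINT x|lebesgue. g x * \<psi> x)) 0 < e"
      using small Ifin
    proof eventually_elim
      case (elim n)
      from bound[OF \<epsilon> elim(2)] elim(1) show ?case by simp
    qed
  qed
qed


section \<open>Weak gradients\<close>

lemma has_weak_gradient_locally_integrable:
  assumes "has_weak_gradient u g"
  shows "locally_integrable u" "locally_integrable g"
  using assms by (auto simp: has_weak_gradient_def)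

lemma locally_integrable_component:
  assumes "locally_integrable (g :: real^'n \<Rightarrow> real^'n)"
  shows "locally_integrable (\<lambda>x. g x $ i)"
  unfolding locally_integrable_def set_integrable_def
proof (intro allI impI)
  fix K :: "(real^'n) set" assume "compact K"
  then have "integrable lebesgue (\<lambda>x. indicator K x *\<^sub>R g x)"
    using assms by (simp add: locally_integrable_def set_integrable_def)
  from integrable_bounded_linear[OF bounded_linear_vec_nth this, of i]
  show "integrable lebesgue (\<lambda>x. indicator K x *\<^sub>R g x $ i)" by simp
qed

lemma locally_integrable_add:
  assumes "locally_integrable f" "locally_integrable g"
  shows "locally_integrable (\<lambda>x. f x + g x)"
  using assms by (auto simp: locally_integrable_def intro: set_integral_add)

lemma locally_integrable_scaleR:
  assumes "locally_integrable f"
  shows "locally_integrable (\<lambda>x. c *\<^sub>R f x)"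
  unfolding locally_integrable_def set_integrable_def
proof (intro allI impI)
  fix K :: "(real^'a) set" assume "compact K"
  then have "integrable lebesgue (\<lambda>x. c *\<^sub>R (indicator K x *\<^sub>R f x))"
    using assms by (intro integrable_scaleR_right) (auto simp: locally_integrable_def set_integrable_def)
  then show "integrable lebesgue (\<lambda>x. indicator K x *\<^sub>R c *\<^sub>R f x)"
    by (simp only: scaleR_left_commute)
qed

lemma has_weak_gradient_pairing:
  assumes "has_weak_gradient u g" "\<phi> \<in> test_functions"
  shows "(LINT x|lebesgue. u x * partial_deriv i \<phi> x) = - (LINT x|lebesgue. g x $ i * \<phi> x)"
  using assms unfolding has_weak_gradient_def by blast

lemma weak_gradient_pairing_integrable:
  assumes "has_weak_gradient u g" "\<phi> \<in> test_functions"
  shows "integrable lebesgue (\<lambda>x. u x * partial_deriv i \<phi> x)" "integrable lebesgue (\<lambda>x. g x $ i * \<phi> x)"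
  by (intro integrable_times_C1_compact locally_integrable_component has_weak_gradient_locally_integrable[OF assms(1)]
      test_functions_C1_compact[OF assms(2)])+

lemma has_weak_gradient_lincomb:
  assumes u: "has_weak_gradient u g" and v: "has_weak_gradient v h"
  shows "has_weak_gradient (\<lambda>x. a * u x + b * v x) (\<lambda>x. a *\<^sub>R g x + b *\<^sub>R h x)"
  unfolding has_weak_gradient_def
proof (intro conjI ballI allI)
  show "locally_integrable (\<lambda>x. a * u x + b * v x)"
    using locally_integrable_add[OF locally_integrable_scaleR[OF has_weak_gradient_locally_integrable(1)[OF u], of a]
      locally_integrable_scaleR[OF has_weak_gradient_locally_integrable(1)[OF v], of b]] by simp
  show "locally_integrable (\<lambda>x. a *\<^sub>R g x + b *\<^sub>R h x)"
    by (intro locally_integrable_add locally_integrable_scaleR has_weak_gradient_locally_integrable[OF u]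
        has_weak_gradient_locally_integrable[OF v])
  fix \<phi> :: "real^'a \<Rightarrow> real" and i assume \<phi>: "\<phi> \<in> test_functions"
  note int = weak_gradient_pairing_integrable[OF u \<phi>, of i] weak_gradient_pairing_integrable[OF v \<phi>, of i]
  have "(LINT x|lebesgue. (a * u x + b * v x) * partial_deriv i \<phi> x)
     = (LINT x|lebesgue. a * (u x * partial_deriv i \<phi> x) + b * (v x * partial_deriv i \<phi> x))"
    by (simp add: algebra_simps)
  also have "\<dots> = a * (LINT x|lebesgue. u x * partial_deriv i \<phi> x) + b * (LINT x|lebesgue. v x * partial_deriv i \<phi> x)"
    using int by simp
  also have "\<dots> = - (a * (LINT x|lebesgue. g x $ i * \<phi> x) + b * (LINT x|lebesgue. h x $ i * \<phi> x))"
    by (simp add: has_weak_gradient_pairing[OF u \<phi>] has_weak_gradient_pairing[OF v \<phi>])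
  also have "a * (LINT x|lebesgue. g x $ i * \<phi> x) + b * (LINT x|lebesgue. h x $ i * \<phi> x)
     = (LINT x|lebesgue. a * (g x $ i * \<phi> x) + b * (h x $ i * \<phi> x))"
    using int by simp
  also have "\<dots> = (LINT x|lebesgue. (a *\<^sub>R g x + b *\<^sub>R h x) $ i * \<phi> x)"
    by (simp add: algebra_simps)
  finally show "(LINT x|lebesgue. (a * u x + b * v x) * partial_deriv i \<phi> x) = - (LINT x|lebesgue. (a *\<^sub>R g x + b *\<^sub>R h x) $ i * \<phi> x)" .
qed

lemma has_weak_gradient_unique:
  assumes g: "has_weak_gradient u g" and h: "has_weak_gradient u h"
  shows "AE x in lebesgue. g x = h x"
proof -
  have "AE x in lebesgue. g x $ i - h x $ i = 0" for i
  proof (rule fundamental_lemma_calculus_of_variations)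
    show "locally_integrable (\<lambda>x. g x $ i - h x $ i)"
      using locally_integrable_add[OF locally_integrable_component[OF has_weak_gradient_locally_integrable(2)[OF g]]
        locally_integrable_scaleR[OF locally_integrable_component[OF has_weak_gradient_locally_integrable(2)[OF h]], of "-1"]] by simp
    fix \<phi> :: "real^'a \<Rightarrow> real" assume \<phi>: "\<phi> \<in> test_functions"
    have "(LINT x|lebesgue. (g x $ i - h x $ i) * \<phi> x) = (LINT x|lebesgue. g x $ i * \<phi> x) - (LINT x|lebesgue. h x $ i * \<phi> x)"
      using weak_gradient_pairing_integrable[OF g \<phi>, of i] weak_gradient_pairing_integrable[OF h \<phi>, of i]
      by (simp add: left_diff_distrib)
    then show "(LINT x|lebesgue. (g x $ i - h x $ i) * \<phi> x) = 0"
      using has_weak_gradient_pairing[OF g \<phi>, of i] has_weak_gradient_pairing[OF h \<phi>, of i] by simp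
  qed
  then have "AE x in lebesgue. \<forall>i. g x $ i - h x $ i = 0" by (subst AE_all_countable) auto
  then show ?thesis by eventually_elim (simp add: vec_eq_iff)
qed

lemma has_weak_gradient_classical:
  assumes "\<phi> \<in> C1_compact"
  shows "has_weak_gradient \<phi> (classical_grad \<phi>)"
  unfolding has_weak_gradient_def
proof (intro conjI ballI allI)
  show "locally_integrable \<phi>" "locally_integrable (classical_grad \<phi>)"
    by (intro locally_integrable_continuous C1_compact_continuous classical_grad_continuous assms)+
  fix \<psi> :: "real^'a \<Rightarrow> real" and i assume "\<psi> \<in> test_functions"
  then show "(LINT x|lebesgue. \<phi> x * partial_deriv i \<psi> x) = - (LINT x|lebesgue. classical_grad \<phi> x $ i * \<psi> x)"
    using integration_by_parts[OF assms test_functions_C1_compact] by (simp add: classical_grad_def)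
qed

text \<open>
  Both sides of the defining identity are continuous along \<open>L\<^sup>q\<close> and \<open>L\<^sup>2\<close> convergence, as test functions are
  bounded with compact support. The exponents for functions and gradients may differ.
\<close>
lemma has_weak_gradient_limit:
  fixes u :: "nat \<Rightarrow> real^'n \<Rightarrow> real"
  assumes q: "q \<ge> 1" and u: "\<And>n. has_weak_gradient (u n) (g n)"
    and v: "locally_integrable v" and h: "locally_integrable h"
    and uv: "(\<lambda>n. powr_integral lebesgue q (\<lambda>x. u n x - v x)) \<longlonglongrightarrow> 0"
    and gh: "(\<lambda>n. powr_integral lebesgue 2 (\<lambda>x. g n x - h x)) \<longlonglongrightarrow> 0"
  shows "has_weak_gradient v h"
  unfolding has_weak_gradient_def
proof (intro conjI ballI allI v h)
  fix \<psi> :: "real^'n \<Rightarrow> real" and i assume \<psi>: "\<psi> \<in> test_functions"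
  then have c: "continuous_on UNIV \<psi>" "compact (closure {x. \<psi> x \<noteq> 0})"
    using C1_compact_continuous[OF test_functions_C1_compact] by (auto simp: test_functions_def)
  have d: "continuous_on UNIV (partial_deriv i \<psi>)" "compact (closure {x. partial_deriv i \<psi> x \<noteq> 0})"
    using C1_compact_partial_continuous[OF test_functions_C1_compact[OF \<psi>]] test_functions_partial_deriv[OF \<psi>]
    by (auto simp: test_functions_def)
  have 1: "(\<lambda>n. LINT x|lebesgue. u n x * partial_deriv i \<psi> x) \<longlonglongrightarrow> (LINT x|lebesgue. v x * partial_deriv i \<psi> x)"
    by (rule Lq_convergence_imp_pairing_convergence[OF q _ v uv d]) (rule has_weak_gradient_locally_integrable[OF u])
  have "(\<lambda>n. powr_integral lebesgue 2 (\<lambda>x. g n x $ i - h x $ i)) \<longlonglongrightarrow> 0"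
  proof (rule tendsto_sandwich[OF _ _ tendsto_const gh])
    have "ennreal (norm (g n x $ i - h x $ i) powr 2) \<le> ennreal (norm (g n x - h x) powr 2)" for n x
      using component_le_norm_cart[of "g n x - h x" i] by (intro ennreal_leI powr_mono2) auto
    then show "\<forall>\<^sub>F n in sequentially. (powr_integral lebesgue 2 (\<lambda>x. g n x $ i - h x $ i))
        \<le> (powr_integral lebesgue 2 (\<lambda>x. g n x - h x))"
      by (intro always_eventually allI nn_integral_mono)
  qed auto
  then have 2: "(\<lambda>n. LINT x|lebesgue. g n x $ i * \<psi> x) \<longlonglongrightarrow> (LINT x|lebesgue. h x $ i * \<psi> x)"
    by (intro Lq_convergence_imp_pairing_convergence[of 2] c locally_integrable_component h has_weak_gradient_locally_integrable[OF u]) auto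
  have "(\<lambda>n. LINT x|lebesgue. u n x * partial_deriv i \<psi> x) \<longlonglongrightarrow> - (LINT x|lebesgue. h x $ i * \<psi> x)"
    using tendsto_minus[OF 2] by (simp add: has_weak_gradient_pairing[OF u \<psi>])
  with 1 show "(LINT x|lebesgue. v x * partial_deriv i \<psi> x) = - (LINT x|lebesgue. h x $ i * \<psi> x)"
    by (rule LIMSEQ_unique)
qed

lemma C_diff_translate: "C_diff m \<phi> \<Longrightarrow> C_diff m (\<lambda>x::real^'n. \<phi> (x + v))"
proof (induction m arbitrary: \<phi>)
  case 0
  then show ?case by (auto intro!: continuous_on_compose2[of UNIV \<phi>] continuous_intros)
next
  case (Suc m)
  have d: "((\<lambda>x. \<phi> (x + v)) has_derivative frechet_derivative \<phi> (at (y + v))) (at y)" for y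
  proof -
    have "(\<phi> has_derivative frechet_derivative \<phi> (at z)) (at z)" for z
      using Suc.prems by (auto simp: differentiable_on_def frechet_derivative_works)
    then show ?thesis
      by (rule has_derivative_compose[rotated]) (auto intro!: derivative_eq_intros)
  qed
  have "partial_deriv i (\<lambda>x. \<phi> (x + v)) = (\<lambda>x. partial_deriv i \<phi> (x + v))" for i
    using d by (intro ext) (simp add: partial_deriv_eq partial_deriv_def[of i \<phi>])
  moreover have "(\<lambda>x. \<phi> (x + v)) differentiable_on UNIV"
    using d unfolding differentiable_on_def differentiable_def by blast
  ultimately show ?case using Suc by simp
qed

lemma test_functions_translate:
  assumes "\<phi> \<in> test_functions"
  shows "(\<lambda>x. \<phi> (x + v)) \<in> test_functions"
  using assms C1_compact_translate(1)[OF test_functions_C1_compact[OF assms], of v]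
  unfolding test_functions_def C1_compact_def by (blast intro: C_diff_translate)

text \<open>
  A function with vanishing weak gradient pairs equally with all translates of a test function;
  if it lies in \<open>L\<^sup>q\<close>, these pairings tend to \<open>0\<close> as the support of the translate moves to infinity.
\<close>
lemma weak_gradient_0_imp_AE_0:
  fixes f :: "real^'n \<Rightarrow> real"
  assumes q: "q \<ge> 1" and int: "integrable lebesgue (\<lambda>x. \<bar>f x\<bar> powr q)"
    and grad: "has_weak_gradient f g" and g: "AE x in lebesgue. g x = 0"
  shows "AE x in lebesgue. f x = 0"
proof (rule fundamental_lemma_calculus_of_variations)
  show li: "locally_integrable f" by (rule has_weak_gradient_locally_integrable[OF grad])
  fix \<phi> :: "real^'n \<Rightarrow> real" assume \<phi>: "\<phi> \<in> test_functions"
  obtain i :: 'n where True by blast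
  define e where "e = (axis i 1 :: real^'n)"
  \<comment> \<open>\<open>F\<close> is constant since its derivative is a pairing with the weak gradient, and \<open>F n\<close> tends to \<open>0\<close>.\<close>
  define F where "F t = (LINT x|lebesgue. f x * \<phi> (x + t *\<^sub>R e))" for t
  have C1: "\<phi> \<in> C1_compact" by (rule test_functions_C1_compact[OF \<phi>])
  have "(LINT x|lebesgue. f x * partial_deriv i \<phi> (x + t *\<^sub>R e)) = 0" for t
  proof -
    have "(LINT x|lebesgue. f x * partial_deriv i (\<lambda>x. \<phi> (x + t *\<^sub>R e)) x) = - (LINT x|lebesgue. g x $ i * \<phi> (x + t *\<^sub>R e))"
      by (rule has_weak_gradient_pairing[OF grad test_functions_translate[OF \<phi>]])
    also have "(LINT x|lebesgue. g x $ i * \<phi> (x + t *\<^sub>R e)) = 0"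
      by (rule integral_eq_zero_AE) (use g in \<open>auto elim!: eventually_mono\<close>)
    finally show ?thesis by (simp add: C1_compact_translate(2)[OF C1])
  qed
  then have "(F has_real_derivative 0) (at t)" for t
    using translated_pairing_derivative[OF li C1, of i t] unfolding F_def[abs_def] e_def by simp
  then have F_const: "F t = F 0" for t using DERIV_isconst_all by blast
  obtain B R where B: "B \<ge> 0" "R > 0" "\<And>x. \<bar>\<phi> x\<bar> \<le> B" "\<And>x. \<bar>partial_deriv i \<phi> x\<bar> \<le> B"
    and R: "\<And>x. R \<le> norm x \<Longrightarrow> \<phi> x = 0" and "\<And>x. R \<le> norm x \<Longrightarrow> partial_deriv i \<phi> x = 0"
    by (rule C1_compact_bounds[OF C1, of i]) blast
  define A where "A n = ball (- (real n *\<^sub>R e)) R" for n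
  have Am[measurable]: "A n \<in> sets lebesgue" for n by (simp add: A_def)
  have A_measure: "measure lebesgue (A n) = measure lebesgue (ball (0::real^'n) R)" for n
    using B(2) by (simp add: A_def content_ball)
  have A_int: "integrable lebesgue (indicator (A n) :: _ \<Rightarrow> real)" for n
    unfolding A_def by (intro integrable_real_indicator) (use lmeasurable_ball in \<open>auto simp: fmeasurable_def\<close>)
  have Aq_int: "integrable lebesgue (\<lambda>x. indicator (A n) x * \<bar>f x\<bar> powr q)" for n
    using integrable_mult_indicator[OF Am int] by simp
  have lim: "(\<lambda>n. LINT x|lebesgue. indicator (A n) x * \<bar>f x\<bar> powr q) \<longlonglongrightarrow> (LINT x::real^'n|lebesgue. 0)"
  proof (rule integral_dominated_convergence[OF _ _ int])
    show "AE x in lebesgue. (\<lambda>n. indicator (A n) x * \<bar>f x\<bar> powr q) \<longlonglongrightarrow> 0"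
    proof (intro AE_I2 tendsto_eventually)
      fix x :: "real^'n"
      obtain n0 :: nat where n0: "norm x + R \<le> real n0" using real_arch_simple by blast
      have "x \<notin> A n" if "n \<ge> n0" for n
      proof -
        have "norm (real n *\<^sub>R e) \<le> norm (x + real n *\<^sub>R e) + norm x"
          by (metis add.commute add_diff_cancel_right' norm_triangle_ineq4)
        moreover have "norm (real n *\<^sub>R e) = real n" unfolding norm_scaleR e_def by simp
        moreover have "dist (- (real n *\<^sub>R e)) x = norm (x + real n *\<^sub>R e)"
          by (metis dist_commute dist_norm diff_minus_eq_add)
        moreover have "norm x + R \<le> real n" using n0 that by linarith
        ultimately show ?thesis unfolding A_def mem_ball by linarith
      qed
      then show "\<forall>\<^sub>F n in sequentially. indicator (A n) x * \<bar>f x\<bar> powr q = 0"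
        unfolding eventually_sequentially by (intro exI[of _ n0]) simp
    qed
  qed (use Aq_int in \<open>auto simp: indicator_def\<close>)
  have bound: "\<bar>F 0\<bar> \<le> B * \<epsilon> * measure lebesgue (ball (0::real^'n) R)" if \<epsilon>: "\<epsilon> > 0" for \<epsilon>
  proof -
    have le: "\<bar>F 0\<bar> \<le> B * \<epsilon> * measure lebesgue (ball (0::real^'n) R) + B * \<epsilon> powr (1 - q) * (LINT x|lebesgue. indicator (A n) x * \<bar>f x\<bar> powr q)" for n
    proof -
      have "\<bar>F (real n)\<bar> \<le> (LINT x|lebesgue. (B * \<epsilon>) * indicator (A n) x + (B * \<epsilon> powr (1 - q)) * (indicator (A n) x * \<bar>f x\<bar> powr q))"
        unfolding F_def
      proof (rule integral_abs_bound_integral)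
        show "integrable lebesgue (\<lambda>x. f x * \<phi> (x + real n *\<^sub>R e))"
          by (intro integrable_times_C1_compact li C1_compact_translate C1)
        show "integrable lebesgue (\<lambda>x. (B * \<epsilon>) * indicator (A n) x + (B * \<epsilon> powr (1 - q)) * (indicator (A n) x * \<bar>f x\<bar> powr q))"
          by (intro Bochner_Integration.integrable_add integrable_mult_right A_int Aq_int)
        fix x
        show "\<bar>f x * \<phi> (x + real n *\<^sub>R e)\<bar> \<le> (B * \<epsilon>) * indicator (A n) x + (B * \<epsilon> powr (1 - q)) * (indicator (A n) x * \<bar>f x\<bar> powr q)"
        proof (cases "x \<in> A n")
          case True
          have "\<bar>f x * \<phi> (x + real n *\<^sub>R e)\<bar> = \<bar>\<phi> (x + real n *\<^sub>R e)\<bar> * \<bar>f x\<bar>" by (simp add: abs_mult)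
          also have "\<dots> \<le> B * (\<epsilon> + \<epsilon> powr (1 - q) * \<bar>f x\<bar> powr q)"
            using \<epsilon> q B by (intro mult_mono le_add_powr) auto
          finally show ?thesis using True by (simp add: algebra_simps)
        next
          case False
          then have "R \<le> norm (x + real n *\<^sub>R e)"
            unfolding A_def mem_ball by (metis dist_commute dist_norm diff_minus_eq_add not_less)
          then show ?thesis using R False by simp
        qed
      qed
      also have "\<dots> = B * \<epsilon> * measure lebesgue (A n) + B * \<epsilon> powr (1 - q) * (LINT x|lebesgue. indicator (A n) x * \<bar>f x\<bar> powr q)"
        using A_int[of n] Aq_int[of n] by simp
      finally show ?thesis by (simp add: F_const[of "real n"] A_measure)
    qed
    have "(\<lambda>n. B * \<epsilon> * measure lebesgue (ball (0::real^'n) R) + B * \<epsilon> powr (1 - q) * (LINT x|lebesgue. indicator (A n) x * \<bar>f x\<bar> powr q))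
       \<longlonglongrightarrow> B * \<epsilon> * measure lebesgue (ball (0::real^'n) R) + B * \<epsilon> powr (1 - q) * (LINT x::real^'n|lebesgue. 0)"
      by (intro tendsto_intros lim)
    from LIMSEQ_le_const[OF this, of "\<bar>F 0\<bar>"] le show ?thesis by auto
  qed
  have "((\<lambda>\<epsilon>. B * \<epsilon> * measure lebesgue (ball (0::real^'n) R)) \<longlongrightarrow> B * 0 * measure lebesgue (ball (0::real^'n) R)) (at_right 0)"
    by (intro tendsto_intros)
  then have "\<bar>F 0\<bar> \<le> B * 0 * measure lebesgue (ball (0::real^'n) R)"
    by (rule tendsto_lowerbound) (use bound in \<open>auto simp: eventually_at_filter intro!: always_eventually\<close>)
  then show "(LINT x|lebesgue. f x * \<phi> x) = 0" by (simp add: F_def)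
qed


section \<open>Functions of finite Dirichlet energy\<close>

definition finite_energy :: "(real ^ 'n \<Rightarrow> real) \<Rightarrow> bool" where
  "finite_energy u \<longleftrightarrow> (\<exists>g. has_weak_gradient u g \<and> integrable lebesgue (\<lambda>x. (norm (g x))\<^sup>2))"

lemma weak_gradient_measurable:
  "has_weak_gradient u g \<Longrightarrow> g \<in> borel_measurable lebesgue"
  by (intro locally_integrable_measurable has_weak_gradient_locally_integrable)

abbreviation energy_dist :: "(real ^ 'n \<Rightarrow> real) \<Rightarrow> (real ^ 'n \<Rightarrow> real) \<Rightarrow> real" where
  "energy_dist u v \<equiv> (grad_norm (\<lambda>x. u x - v x))\<^sup>2"

lemma grad_norm_nonneg: "grad_norm u \<ge> 0"
  by (simp add: grad_norm_def)

lemma grad_norm_power2: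
  assumes "has_weak_gradient u g"
  shows "(grad_norm u)\<^sup>2 = (LINT x|lebesgue. (norm (g x))\<^sup>2)"
proof -
  have w: "has_weak_gradient u (weak_grad u)"
    unfolding weak_grad_def by (rule someI[of "has_weak_gradient u", OF assms])
  have "(LINT x|lebesgue. (norm (weak_grad u x))\<^sup>2) = (LINT x|lebesgue. (norm (g x))\<^sup>2)"
    using weak_gradient_measurable[OF w] weak_gradient_measurable[OF assms] has_weak_gradient_unique[OF w assms]
    by (intro integral_cong_AE) (auto elim!: eventually_mono)
  moreover have "(LINT x|lebesgue. (norm (g x))\<^sup>2) \<ge> 0" by simp
  ultimately show ?thesis by (simp add: grad_norm_def)
qed

lemma finite_energy_integrable:
  assumes "finite_energy u" "has_weak_gradient u g"
  shows "integrable lebesgue (\<lambda>x. (norm (g x))\<^sup>2)"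
proof -
  obtain h where h: "has_weak_gradient u h" "integrable lebesgue (\<lambda>x. (norm (h x))\<^sup>2)"
    using assms(1) by (auto simp: finite_energy_def)
  have "AE x in lebesgue. (norm (h x))\<^sup>2 = (norm (g x))\<^sup>2"
    using has_weak_gradient_unique[OF h(1) assms(2)] by eventually_elim simp
  moreover have "(\<lambda>x. (norm (g x))\<^sup>2) \<in> borel_measurable lebesgue"
    using weak_gradient_measurable[OF assms(2)] by simp
  ultimately show ?thesis using integrable_cong_AE_imp[OF h(2)] by blast
qed

lemma nn_integral_weak_gradient:
  assumes "finite_energy u" "has_weak_gradient u g"
  shows "(powr_integral lebesgue 2 g) = ennreal ((grad_norm u)\<^sup>2)"
  using nn_integral_eq_integral[OF finite_energy_integrable[OF assms]] by (simp add: grad_norm_power2[OF assms(2)])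

text \<open>
  A triangle inequality for squares. The case \<open>\<delta> = 1\<close> suffices for convergence arguments; letting \<open>\<delta>\<close> tend to
  \<open>0\<close> after the other term has vanished gives sharp bounds for limits.
\<close>
lemma norm_add_power2_le:
  fixes x y :: "'a::real_inner"
  assumes "\<delta> > 0"
  shows "(norm (x + y))\<^sup>2 \<le> (1 + \<delta>) * (norm x)\<^sup>2 + (1 + 1 / \<delta>) * (norm y)\<^sup>2"
proof -
  have "0 \<le> (norm (sqrt \<delta> *\<^sub>R x - (1 / sqrt \<delta>) *\<^sub>R y))\<^sup>2" by simp
  also have "\<dots> = \<delta> * (norm x)\<^sup>2 + (1 / \<delta>) * (norm y)\<^sup>2 - 2 * (x \<bullet> y)"
    using assms by (simp add: power2_norm_eq_inner inner_diff inner_commute field_simps flip: power2_eq_square)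
  finally show ?thesis
    by (simp add: power2_norm_eq_inner inner_add inner_commute algebra_simps)
qed

lemma finite_energy_lincomb:
  assumes "finite_energy u" "finite_energy v"
  shows "finite_energy (\<lambda>x. a * u x + b * v x)"
proof -
  obtain g h where g: "has_weak_gradient u g" "integrable lebesgue (\<lambda>x. (norm (g x))\<^sup>2)"
    and h: "has_weak_gradient v h" "integrable lebesgue (\<lambda>x. (norm (h x))\<^sup>2)"
    using assms by (auto simp: finite_energy_def)
  have "integrable lebesgue (\<lambda>x. (norm (a *\<^sub>R g x + b *\<^sub>R h x))\<^sup>2)"
  proof (rule Bochner_Integration.integrable_bound)
    show "integrable lebesgue (\<lambda>x. 2 * a\<^sup>2 * (norm (g x))\<^sup>2 + 2 * b\<^sup>2 * (norm (h x))\<^sup>2)"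
      using g h by simp
    show "(\<lambda>x. (norm (a *\<^sub>R g x + b *\<^sub>R h x))\<^sup>2) \<in> borel_measurable lebesgue"
      using weak_gradient_measurable[OF g(1)] weak_gradient_measurable[OF h(1)] by simp
    show "AE x in lebesgue. norm ((norm (a *\<^sub>R g x + b *\<^sub>R h x))\<^sup>2) \<le> norm (2 * a\<^sup>2 * (norm (g x))\<^sup>2 + 2 * b\<^sup>2 * (norm (h x))\<^sup>2)"
    proof (intro AE_I2)
      fix x
      show "norm ((norm (a *\<^sub>R g x + b *\<^sub>R h x))\<^sup>2) \<le> norm (2 * a\<^sup>2 * (norm (g x))\<^sup>2 + 2 * b\<^sup>2 * (norm (h x))\<^sup>2)"
        using norm_add_power2_le[of 1 "a *\<^sub>R g x" "b *\<^sub>R h x"] by (simp add: power_mult_distrib)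
    qed
  qed
  then show ?thesis unfolding finite_energy_def using has_weak_gradient_lincomb[OF g(1) h(1)] by blast
qed

lemma finite_energy_diff: "finite_energy u \<Longrightarrow> finite_energy v \<Longrightarrow> finite_energy (\<lambda>x. u x - v x)"
  using finite_energy_lincomb[of u v 1 "-1"] by simp

lemma finite_energy_add: "finite_energy u \<Longrightarrow> finite_energy v \<Longrightarrow> finite_energy (\<lambda>x. u x + v x)"
  using finite_energy_lincomb[of u v 1 1] by simp

lemma grad_norm_power2_cmult:
  assumes "finite_energy u"
  shows "(grad_norm (\<lambda>x. a * u x))\<^sup>2 = a\<^sup>2 * (grad_norm u)\<^sup>2"
proof -
  obtain g where g: "has_weak_gradient u g" using assms by (auto simp: finite_energy_def)
  have "has_weak_gradient (\<lambda>x. a * u x) (\<lambda>x. a *\<^sub>R g x)"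
    using has_weak_gradient_lincomb[OF g g, of a 0] by simp
  then show ?thesis by (simp add: grad_norm_power2[OF g] grad_norm_power2 power_mult_distrib)
qed

lemma grad_norm_power2_add_le:
  assumes "finite_energy u" "finite_energy v" "\<delta> > 0"
  shows "(grad_norm (\<lambda>x. u x + v x))\<^sup>2 \<le> (1 + \<delta>) * (grad_norm u)\<^sup>2 + (1 + 1 / \<delta>) * (grad_norm v)\<^sup>2"
proof -
  obtain g h where g: "has_weak_gradient u g" and h: "has_weak_gradient v h"
    using assms by (auto simp: finite_energy_def)
  note int = finite_energy_integrable[OF assms(1) g] finite_energy_integrable[OF assms(2) h]
  have gh: "has_weak_gradient (\<lambda>x. u x + v x) (\<lambda>x. g x + h x)"
    using has_weak_gradient_lincomb[OF g h, of 1 1] by simp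
  have "(grad_norm (\<lambda>x. u x + v x))\<^sup>2 = (LINT x|lebesgue. (norm (g x + h x))\<^sup>2)" by (rule grad_norm_power2[OF gh])
  also have "\<dots> \<le> (LINT x|lebesgue. (1 + \<delta>) * (norm (g x))\<^sup>2 + (1 + 1 / \<delta>) * (norm (h x))\<^sup>2)"
    by (intro integral_mono norm_add_power2_le assms(3) finite_energy_integrable[OF finite_energy_add[OF assms(1,2)] gh]
        Bochner_Integration.integrable_add integrable_mult_right int)
  also have "\<dots> = (1 + \<delta>) * (grad_norm u)\<^sup>2 + (1 + 1 / \<delta>) * (grad_norm v)\<^sup>2"
    using int by (simp add: grad_norm_power2[OF g] grad_norm_power2[OF h])
  finally show ?thesis .
qed

lemma grad_norm_power2_triangle:
  assumes "finite_energy u" "finite_energy v" "finite_energy w"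
  shows "energy_dist u w \<le> 2 * energy_dist u v + 2 * energy_dist v w"
  using grad_norm_power2_add_le[of "\<lambda>x. u x - v x" "\<lambda>x. v x - w x" 1] assms by (simp add: finite_energy_diff)

lemma grad_norm_power2_commute:
  assumes "finite_energy u" "finite_energy v"
  shows "energy_dist u v = energy_dist v u"
  using grad_norm_power2_cmult[OF finite_energy_diff[OF assms], of "-1"] by simp

lemma grad_norm_parallelogram:
  assumes "finite_energy u" "finite_energy v"
  shows "energy_dist u v =
    2 * (grad_norm u)\<^sup>2 + 2 * (grad_norm v)\<^sup>2 - 4 * (grad_norm (\<lambda>x. (u x + v x) / 2))\<^sup>2"
proof -
  obtain g h where g: "has_weak_gradient u g" and h: "has_weak_gradient v h"
    using assms by (auto simp: finite_energy_def)
  have d: "has_weak_gradient (\<lambda>x. u x - v x) (\<lambda>x. g x - h x)"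
    using has_weak_gradient_lincomb[OF g h, of 1 "-1"] by simp
  have m: "has_weak_gradient (\<lambda>x. (u x + v x) / 2) (\<lambda>x. (1/2) *\<^sub>R g x + (1/2) *\<^sub>R h x)"
    using has_weak_gradient_lincomb[OF g h, of "1/2" "1/2"] by (simp add: add_divide_distrib)
  have fm: "finite_energy (\<lambda>x. (u x + v x) / 2)"
    using finite_energy_lincomb[OF assms, of "1/2" "1/2"] by (simp add: add_divide_distrib)
  note int = finite_energy_integrable[OF assms(1) g] finite_energy_integrable[OF assms(2) h] finite_energy_integrable[OF fm m]
  have "(norm (g x - h x))\<^sup>2 = 2 * (norm (g x))\<^sup>2 + 2 * (norm (h x))\<^sup>2 - 4 * (norm ((1/2) *\<^sub>R g x + (1/2) *\<^sub>R h x))\<^sup>2" for x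
    by (simp add: power2_norm_eq_inner inner_diff inner_add inner_commute algebra_simps)
  then have "energy_dist u v = (LINT x|lebesgue. 2 * (norm (g x))\<^sup>2 + 2 * (norm (h x))\<^sup>2 - 4 * (norm ((1/2) *\<^sub>R g x + (1/2) *\<^sub>R h x))\<^sup>2)"
    by (simp only: grad_norm_power2[OF d])
  also have "\<dots> = 2 * (LINT x|lebesgue. (norm (g x))\<^sup>2) + 2 * (LINT x|lebesgue. (norm (h x))\<^sup>2)
      - 4 * (LINT x|lebesgue. (norm ((1/2) *\<^sub>R g x + (1/2) *\<^sub>R h x))\<^sup>2)"
    using int by (simp only: Bochner_Integration.integral_add Bochner_Integration.integral_diff integral_mult_right_zero
        Bochner_Integration.integrable_add integrable_mult_right)
  finally show ?thesis
    by (simp only: grad_norm_power2[OF g] grad_norm_power2[OF h] grad_norm_power2[OF m])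
qed

lemma finite_energy_C1_compact:
  fixes \<phi> :: "real^'n \<Rightarrow> real"
  assumes "\<phi> \<in> C1_compact"
  shows "finite_energy \<phi>"
proof -
  have "integrable lebesgue (\<lambda>x. 1 * (norm (classical_grad \<phi> x))\<^sup>2)"
  proof (rule locally_integrable_times_bounded)
    show "locally_integrable (\<lambda>x::real^'n. 1::real)" by (intro locally_integrable_continuous continuous_intros)
    show "continuous_on UNIV (\<lambda>x. (norm (classical_grad \<phi> x))\<^sup>2)"
      by (intro continuous_intros classical_grad_continuous assms)
    have c: "compact (closure {x. \<phi> x \<noteq> 0})" using assms by (simp add: C1_compact_def)
    show "compact (closure {x. (norm (classical_grad \<phi> x))\<^sup>2 \<noteq> 0})"
    proof (rule compact_support_subset[OF c], rule ccontr)
      fix x assume 1: "(norm (classical_grad \<phi> x))\<^sup>2 \<noteq> 0" and "x \<notin> closure {x. \<phi> x \<noteq> 0}"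
      then have "classical_grad \<phi> x = 0"
        by (simp add: classical_grad_def partial_deriv_outside_support vec_eq_iff)
      then show False using 1 by simp
    qed
  qed
  then show ?thesis unfolding finite_energy_def using has_weak_gradient_classical[OF assms] by auto
qed

lemma test_functions_lincomb:
  assumes "\<phi> \<in> test_functions" "\<psi> \<in> test_functions"
  shows "(\<lambda>x::real^'n. a * \<phi> x + b * \<psi> x) \<in> test_functions"
proof -
  have "C_diff m (\<lambda>x. a * \<phi> x + b * \<psi> x)" for m
    using assms by (intro C_diff_add C_diff_mult C_diff_const) (auto simp: test_functions_def)
  moreover have "{x. a * \<phi> x + b * \<psi> x \<noteq> 0} \<subseteq> {x. \<phi> x \<noteq> 0} \<union> {x. \<psi> x \<noteq> 0}" by auto
  then have "bounded {x. a * \<phi> x + b * \<psi> x \<noteq> 0}"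
    by (rule bounded_subset[rotated])
       (use assms in \<open>auto simp: test_functions_def compact_eq_bounded_closed intro: bounded_subset[OF _ closure_subset]\<close>)
  ultimately show ?thesis by (auto simp: test_functions_def compact_eq_bounded_closed)
qed

lemma test_functions_diff: "\<phi> \<in> test_functions \<Longrightarrow> \<psi> \<in> test_functions \<Longrightarrow> (\<lambda>x. \<phi> x - \<psi> x) \<in> test_functions"
  using test_functions_lincomb[of \<phi> \<psi> 1 "-1"] by simp

lemma finite_energy_test_function: "\<phi> \<in> test_functions \<Longrightarrow> finite_energy \<phi>"
  by (intro finite_energy_C1_compact test_functions_C1_compact)

lemma nn_integral_powr_finite_add:
  fixes f g :: "'a \<Rightarrow> 'b::euclidean_space"
  assumes q: "q > 0" and [measurable]: "f \<in> borel_measurable M" "g \<in> borel_measurable M"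
    and "(powr_integral M q f) \<noteq> \<infinity>" "(powr_integral M q g) \<noteq> \<infinity>"
  shows "(powr_integral M q (\<lambda>x. f x + g x)) \<noteq> \<infinity>"
proof -
  have "norm (f x + g x) powr q \<le> 2 powr q * (norm (f x) powr q + norm (g x) powr q)" for x
  proof -
    have "norm (f x + g x) \<le> 2 * max (norm (f x)) (norm (g x))" using norm_triangle_ineq[of "f x" "g x"] by linarith
    then have "norm (f x + g x) powr q \<le> (2 * max (norm (f x)) (norm (g x))) powr q"
      using q by (intro powr_mono2) auto
    also have "\<dots> = 2 powr q * max (norm (f x)) (norm (g x)) powr q" by (rule powr_mult)
    also have "\<dots> \<le> 2 powr q * (norm (f x) powr q + norm (g x) powr q)"
      by (intro mult_left_mono) (auto simp: max_def)
    finally show ?thesis .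
  qed
  then have "(powr_integral M q (\<lambda>x. f x + g x)) \<le> (\<integral>\<^sup>+x. ennreal (2 powr q) * (ennreal (norm (f x) powr q) + ennreal (norm (g x) powr q)) \<partial>M)"
    by (intro nn_integral_mono) (simp add: ennreal_mult[symmetric] ennreal_leI flip: ennreal_plus)
  also have "\<dots> = ennreal (2 powr q) * ((powr_integral M q f) + (powr_integral M q g))"
    by (simp add: nn_integral_cmult nn_integral_add)
  also have "\<dots> < \<infinity>" using assms(4,5) by (simp add: ennreal_mult_less_top less_top)
  finally show ?thesis by simp
qed

section \<open>The Sobolev embedding and completeness of \<open>D\<^sup>1\<^sup>,\<^sup>2\<close>\<close>

lemma sobolev_exponent_gt_1: "CARD('n) \<ge> 3 \<Longrightarrow> sobolev_exponent TYPE('n::finite) > 1"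
  by (simp add: sobolev_exponent_def field_simps)

lemma ennreal_power_le_cancel:
  assumes "X ^ m \<le> ennreal e ^ m" "m > 0" "e \<ge> 0"
  shows "X \<le> ennreal e"
proof (rule ccontr)
  assume "\<not> X \<le> ennreal e"
  then have lt: "ennreal e < X" by simp
  show False
  proof (cases X)
    case (real x)
    then have "e < x" using lt assms(3) by (simp add: ennreal_less_iff)
    then show False using assms real by (simp add: ennreal_power)
  next
    case top
    then show False using assms by (simp add: ennreal_power top_unique)
  qed
qed

text \<open>
  Sobolev's inequality in the form of continuity at \<open>0\<close>. For linear spaces this contains all that is needed, and it
  avoids fractional powers of extended reals.
\<close>
lemma sobolev_small_C1_compact:
  assumes N: "CARD('n::finite) \<ge> 3" and e: "e > 0"
  obtains \<delta> where "\<delta> > 0"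
    "\<And>\<phi>::real^'n \<Rightarrow> real. \<phi> \<in> C1_compact \<Longrightarrow> (grad_norm \<phi>)\<^sup>2 \<le> \<delta> \<Longrightarrow>
       (powr_integral lebesgue (sobolev_exponent TYPE('n)) \<phi>) \<le> ennreal e"
proof -
  let ?N = "CARD('n)"
  define \<kappa> where "\<kappa> = real ?N / (real ?N - 2)"
  define C where "C = (\<kappa> + 1) ^ (2 * ?N)"
  have C: "C > 0" using N by (simp add: C_def \<kappa>_def add_nonneg_pos)
  have q: "sobolev_exponent TYPE('n) = 2 * \<kappa>" by (simp add: sobolev_exponent_def \<kappa>_def)
  \<comment> \<open>chosen so that \<open>C * \<delta> ^ N = e ^ (N - 2)\<close>\<close>
  define \<delta> where "\<delta> = (e ^ (?N - 2) / C) powr (1 / real ?N)"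
  have \<delta>: "\<delta> > 0" using e C by (simp add: \<delta>_def)
  have "\<delta> ^ ?N = e ^ (?N - 2) / C"
    using e C N by (simp add: \<delta>_def powr_realpow[symmetric] powr_powr)
  then have C\<delta>: "C * \<delta> ^ ?N = e ^ (?N - 2)" using C by simp
  show thesis
  proof (rule that[OF \<delta>])
    fix \<phi> :: "real^'n \<Rightarrow> real" assume \<phi>: "\<phi> \<in> C1_compact" and le: "(grad_norm \<phi>)\<^sup>2 \<le> \<delta>"
    have G: "(\<integral>\<^sup>+x. ennreal ((norm (classical_grad \<phi> x))\<^sup>2) \<partial>lborel) = ennreal ((grad_norm \<phi>)\<^sup>2)"
      using nn_integral_weak_gradient[OF finite_energy_C1_compact[OF \<phi>] has_weak_gradient_classical[OF \<phi>]]
      by (simp add: nn_integral_completion)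
    have "(\<integral>\<^sup>+x. ennreal (\<bar>\<phi> x\<bar> powr (2 * \<kappa>)) \<partial>lborel) ^ (?N - 2) \<le> ennreal C * ennreal ((grad_norm \<phi>)\<^sup>2) ^ ?N"
      using sobolev_inequality_C1_compact[OF N \<phi>] unfolding G C_def \<kappa>_def .
    also have "\<dots> \<le> ennreal C * ennreal \<delta> ^ ?N"
      by (intro mult_left_mono power_mono ennreal_leI le) auto
    also have "\<dots> = ennreal e ^ (?N - 2)"
      using C \<delta> e by (simp add: ennreal_power ennreal_mult[symmetric] C\<delta>)
    finally have "(\<integral>\<^sup>+x. ennreal (\<bar>\<phi> x\<bar> powr (2 * \<kappa>)) \<partial>lborel) \<le> ennreal e"
      by (rule ennreal_power_le_cancel) (use N e in auto)
    then show "(powr_integral lebesgue (sobolev_exponent TYPE('n)) \<phi>) \<le> ennreal e"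
      by (simp add: nn_integral_completion q)
  qed
qed

lemma C1_compact_Lq_finite:
  fixes \<phi> :: "real^'n \<Rightarrow> real"
  assumes \<phi>: "\<phi> \<in> C1_compact" and q: "q > 0"
  shows "(powr_integral lebesgue q \<phi>) \<noteq> \<infinity>"
proof -
  have "integrable lebesgue (\<lambda>x. 1 * norm (\<phi> x) powr q)"
  proof (rule locally_integrable_times_bounded)
    show "locally_integrable (\<lambda>x::real^'n. 1::real)" by (intro locally_integrable_continuous continuous_intros)
    show "continuous_on UNIV (\<lambda>x. norm (\<phi> x) powr q)"
      using q by (intro continuous_on_powr' continuous_on_norm continuous_on_const C1_compact_continuous \<phi>) auto
    show "compact (closure {x. norm (\<phi> x) powr q \<noteq> 0})"
      using \<phi> by (simp add: C1_compact_def)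
  qed
  then show ?thesis by (subst nn_integral_eq_integral) auto
qed


lemma D12_finite_energy: "u \<in> D12 \<Omega> \<Longrightarrow> finite_energy u"
  by (auto simp: D12_def finite_energy_def)

lemma D12_measurable: "u \<in> D12 \<Omega> \<Longrightarrow> u \<in> borel_measurable lebesgue"
  by (auto simp: D12_def Lq_def)

lemma D12_Lq_finite:
  fixes u :: "real^'n \<Rightarrow> real"
  shows "u \<in> D12 \<Omega> \<Longrightarrow> (powr_integral lebesgue (sobolev_exponent TYPE('n)) u) \<noteq> \<infinity>"
  by (subst nn_integral_eq_integral) (auto simp: D12_def Lq_def)

lemma D12_UNIV_I:
  fixes u :: "real^'n \<Rightarrow> real"
  assumes "u \<in> borel_measurable lebesgue" "(powr_integral lebesgue (sobolev_exponent TYPE('n)) u) \<noteq> \<infinity>"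
    "finite_energy u" "\<And>n. \<phi> n \<in> test_functions" "(\<lambda>n. energy_dist u (\<phi> n)) \<longlonglongrightarrow> 0"
  shows "u \<in> D12 UNIV"
proof -
  have "integrable lebesgue (\<lambda>x. 1 * \<bar>u x\<bar> powr sobolev_exponent TYPE('n))"
    using assms(1,2) by (intro integrableI_nonneg) (auto simp: less_top)
  moreover have "(\<lambda>n. grad_norm (\<lambda>x. u x - \<phi> n x)) \<longlonglongrightarrow> 0"
    using tendsto_real_sqrt[OF assms(5)] by (simp add: abs_of_nonneg grad_norm_nonneg)
  ultimately show ?thesis using assms(1,3,4) by (auto simp: D12_def Lq_def finite_energy_def)
qed

lemma D12_approximation:
  assumes "u \<in> D12 \<Omega>"
  obtains \<phi> where "\<And>n. \<phi> n \<in> test_functions" "(\<lambda>n. energy_dist u (\<phi> n)) \<longlonglongrightarrow> 0"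
proof -
  obtain \<phi> where "\<forall>n. \<phi> n \<in> test_functions" "(\<lambda>n. grad_norm (\<lambda>x. u x - \<phi> n x)) \<longlonglongrightarrow> 0"
    using assms by (auto simp: D12_def)
  then show thesis using tendsto_power[of "\<lambda>n. grad_norm (\<lambda>x. u x - \<phi> n x)" 0 sequentially 2] by (intro that[of \<phi>]) auto
qed

text \<open>
  By the Sobolev inequality a sequence of test functions that is Cauchy for the energy is Cauchy in \<open>L\<close>
  with the critical exponent as well, so functions and gradients converge simultaneously.
\<close>
lemma test_function_completion:
  fixes \<phi> :: "nat \<Rightarrow> real^'n \<Rightarrow> real"
  assumes N: "CARD('n) \<ge> 3" and \<phi>: "\<And>n. \<phi> n \<in> test_functions"
    and Cauchy: "\<And>e. e > 0 \<Longrightarrow> \<exists>M. \<forall>m\<ge>M. \<forall>n\<ge>M. energy_dist (\<phi> m) (\<phi> n) \<le> e"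
  obtains u where "u \<in> D12 UNIV" "(\<lambda>n. energy_dist u (\<phi> n)) \<longlonglongrightarrow> 0"
    "(\<lambda>n. powr_integral lebesgue (sobolev_exponent TYPE('n)) (\<lambda>x. \<phi> n x - u x)) \<longlonglongrightarrow> 0"
proof -
  let ?q = "sobolev_exponent TYPE('n)"
  have q: "?q > 1" by (rule sobolev_exponent_gt_1[OF N])
  have C1: "\<phi> n \<in> C1_compact" for n by (rule test_functions_C1_compact[OF \<phi>])
  have \<phi>m: "\<phi> n \<in> borel_measurable lebesgue" for n
    by (intro borel_measurable_continuous_lebesgue C1_compact_continuous C1)
  have wg: "has_weak_gradient (\<phi> n) (classical_grad (\<phi> n))" for n
    by (rule has_weak_gradient_classical[OF C1])
  have gm: "classical_grad (\<phi> n) \<in> borel_measurable lebesgue" for n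
    by (rule weak_gradient_measurable[OF wg])
  have q0: "?q > 0" using q by simp
  have Cauchy_q: "\<exists>M. \<forall>m\<ge>M. \<forall>n\<ge>M. (powr_integral lebesgue ?q (\<lambda>x. \<phi> m x - \<phi> n x)) \<le> ennreal e" if e: "e > 0" for e
  proof -
    obtain \<delta> where \<delta>: "\<delta> > 0" "\<And>\<phi>::real^'n \<Rightarrow> real. \<phi> \<in> C1_compact \<Longrightarrow> (grad_norm \<phi>)\<^sup>2 \<le> \<delta> \<Longrightarrow>
       (powr_integral lebesgue ?q \<phi>) \<le> ennreal e"
      by (rule sobolev_small_C1_compact[OF N e]) blast
    obtain M where M: "\<And>m n. m \<ge> M \<Longrightarrow> n \<ge> M \<Longrightarrow> energy_dist (\<phi> m) (\<phi> n) \<le> \<delta>"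
      using Cauchy[OF \<delta>(1)] by blast
    have "(powr_integral lebesgue ?q (\<lambda>x. \<phi> m x - \<phi> n x)) \<le> ennreal e" if "m \<ge> M" "n \<ge> M" for m n
      by (rule \<delta>(2)[OF test_functions_C1_compact[OF test_functions_diff[OF \<phi> \<phi>]] M[OF that]])
    then show ?thesis by blast
  qed
  obtain u where um: "u \<in> borel_measurable lebesgue"
    and u: "(\<lambda>n. powr_integral lebesgue ?q (\<lambda>x. \<phi> n x - u x)) \<longlonglongrightarrow> 0"
    by (rule Lq_Cauchy_imp_convergent[OF q0 \<phi>m Cauchy_q])
  have energy: "(powr_integral lebesgue 2 (\<lambda>x. classical_grad (\<phi> m) x - classical_grad (\<phi> n) x))
      = ennreal (energy_dist (\<phi> m) (\<phi> n))" for m n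
    using has_weak_gradient_lincomb[OF wg[of m] wg[of n], of 1 "-1"]
    by (intro nn_integral_weak_gradient finite_energy_test_function test_functions_diff \<phi>) simp
  have Cauchy_g: "\<exists>M. \<forall>m\<ge>M. \<forall>n\<ge>M. (powr_integral lebesgue 2 (\<lambda>x. classical_grad (\<phi> m) x - classical_grad (\<phi> n) x)) \<le> ennreal e" if e: "e > 0" for e
    using Cauchy[OF e] unfolding energy by (meson ennreal_leI)
  have two: "(2::real) > 0" by simp
  obtain h where hm: "h \<in> borel_measurable lebesgue"
    and h: "(\<lambda>n. powr_integral lebesgue 2 (\<lambda>x. classical_grad (\<phi> n) x - h x)) \<longlonglongrightarrow> 0"
    by (rule Lq_Cauchy_imp_convergent[OF two gm Cauchy_g])
  have limit_finite: "(powr_integral lebesgue s v) \<noteq> \<infinity>"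
    if s: "s > 0" and f: "\<And>n. f n \<in> borel_measurable lebesgue" "\<And>n. (powr_integral lebesgue s (f n)) \<noteq> \<infinity>"
      and v: "v \<in> borel_measurable lebesgue" "(\<lambda>n. powr_integral lebesgue s (\<lambda>x. f n x - v x)) \<longlonglongrightarrow> 0"
    for f :: "nat \<Rightarrow> real^'n \<Rightarrow> 'b::euclidean_space" and v s
  proof -
    have "\<forall>\<^sub>F n in sequentially. (powr_integral lebesgue s (\<lambda>x. f n x - v x)) < \<infinity>"
      by (rule order_tendstoD(2)[OF v(2)]) simp
    then obtain n where "(powr_integral lebesgue s (\<lambda>x. f n x - v x)) < \<infinity>"
      by (auto simp: eventually_sequentially)
    then have "(powr_integral lebesgue s (\<lambda>x. v x - f n x)) \<noteq> \<infinity>"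
      by (simp add: norm_minus_commute)
    then have "(powr_integral lebesgue s (\<lambda>x. f n x + (v x - f n x))) \<noteq> \<infinity>"
      by (intro nn_integral_powr_finite_add s f borel_measurable_diff v)
    then show ?thesis by simp
  qed
  have ufin: "(powr_integral lebesgue ?q u) \<noteq> \<infinity>"
    by (rule limit_finite[OF q0 \<phi>m C1_compact_Lq_finite[OF C1 q0] um u])
  have "(powr_integral lebesgue 2 (\<lambda>x. classical_grad (\<phi> n) x)) \<noteq> \<infinity>" for n
    unfolding nn_integral_weak_gradient[OF finite_energy_C1_compact[OF C1] wg] by simp
  then have hfin: "(powr_integral lebesgue 2 h) \<noteq> \<infinity>"
    by (rule limit_finite[OF two gm _ hm h])
  have uh: "has_weak_gradient u h"
  proof (rule has_weak_gradient_limit[OF _ wg _ _ u h])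
    show "locally_integrable u" by (rule Lq_locally_integrable[OF _ um ufin]) (use q in simp)
    show "locally_integrable h" by (rule Lq_locally_integrable[OF _ hm hfin]) simp
  qed (use q in simp)
  have "integrable lebesgue (\<lambda>x. (norm (h x))\<^sup>2)"
    using hm hfin by (intro integrableI_nonneg) (auto simp: less_top)
  then have ue: "finite_energy u" using uh by (auto simp: finite_energy_def)
  have "ennreal (energy_dist u (\<phi> n)) = (powr_integral lebesgue 2 (\<lambda>x. classical_grad (\<phi> n) x - h x))" for n
    using nn_integral_weak_gradient[OF finite_energy_diff[OF ue finite_energy_C1_compact[OF C1[of n]]], of "\<lambda>x. h x - classical_grad (\<phi> n) x"]
      has_weak_gradient_lincomb[OF uh wg[of n], of 1 "-1"]
    by (simp add: norm_minus_commute)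
  then have "(\<lambda>n. ennreal (energy_dist u (\<phi> n))) \<longlonglongrightarrow> ennreal 0" using h by simp
  then have lim: "(\<lambda>n. energy_dist u (\<phi> n)) \<longlonglongrightarrow> 0"
    by (subst (asm) tendsto_ennreal_iff) auto
  show thesis
    by (rule that[OF D12_UNIV_I[OF um ufin ue \<phi> lim] lim u])
qed

text \<open>
  The test functions converge in the critical \<open>L\<^sup>q\<close> space to some function with the same weak
  gradient as \<open>u\<close>. The difference of the two lies in that space and has weak gradient \<open>0\<close>, so it vanishes.
\<close>
lemma D12_approximation_Lq:
  fixes u :: "real^'n \<Rightarrow> real"
  assumes N: "CARD('n) \<ge> 3" and u: "u \<in> D12 \<Omega>" and \<phi>: "\<And>n. \<phi> n \<in> test_functions"
    and lim: "(\<lambda>n. energy_dist u (\<phi> n)) \<longlonglongrightarrow> 0"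
  shows "(\<lambda>n. powr_integral lebesgue (sobolev_exponent TYPE('n)) (\<lambda>x. \<phi> n x - u x)) \<longlonglongrightarrow> 0"
proof -
  let ?q = "sobolev_exponent TYPE('n)"
  have q: "?q > 1" by (rule sobolev_exponent_gt_1[OF N])
  note ue = D12_finite_energy[OF u] and \<phi>e = finite_energy_test_function[OF \<phi>]
  have Cauchy: "\<exists>M. \<forall>m\<ge>M. \<forall>n\<ge>M. energy_dist (\<phi> m) (\<phi> n) \<le> e" if e: "e > 0" for e
  proof -
    have "\<forall>\<^sub>F n in sequentially. energy_dist u (\<phi> n) < e / 4"
      using e by (intro order_tendstoD(2)[OF lim]) simp
    then obtain M where M: "\<And>n. n \<ge> M \<Longrightarrow> energy_dist u (\<phi> n) < e / 4"
      by (auto simp: eventually_sequentially)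
    have "energy_dist (\<phi> m) (\<phi> n) \<le> e" if "m \<ge> M" "n \<ge> M" for m n
      using grad_norm_power2_triangle[OF \<phi>e[of m] ue \<phi>e[of n]] grad_norm_power2_commute[OF \<phi>e[of m] ue] M[OF that(1)] M[OF that(2)]
      by linarith
    then show ?thesis by blast
  qed
  obtain v where v: "v \<in> D12 UNIV" "(\<lambda>n. energy_dist v (\<phi> n)) \<longlonglongrightarrow> 0"
    and vq: "(\<lambda>n. powr_integral lebesgue ?q (\<lambda>x. \<phi> n x - v x)) \<longlonglongrightarrow> 0"
    by (rule test_function_completion[OF N \<phi> Cauchy])
  note ve = D12_finite_energy[OF v(1)]
  have "energy_dist u v \<le> 2 * 0 + 2 * 0"
  proof (rule LIMSEQ_le_const)
    show "(\<lambda>n. 2 * energy_dist u (\<phi> n) + 2 * energy_dist v (\<phi> n)) \<longlonglongrightarrow> 2 * 0 + 2 * 0"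
      by (intro tendsto_intros lim v)
    show "\<exists>N. \<forall>n\<ge>N. energy_dist u v \<le> 2 * energy_dist u (\<phi> n) + 2 * energy_dist v (\<phi> n)"
      using grad_norm_power2_triangle[OF ue \<phi>e ve] grad_norm_power2_commute[OF \<phi>e ve] by simp
  qed
  then have zero: "energy_dist u v = 0" by simp
  obtain g where g: "has_weak_gradient (\<lambda>x. u x - v x) g"
    using finite_energy_diff[OF ue ve] by (auto simp: finite_energy_def)
  have "(powr_integral lebesgue 2 g) = 0"
    using nn_integral_weak_gradient[OF finite_energy_diff[OF ue ve] g] zero by simp
  then have "AE x in lebesgue. ennreal (norm (g x) powr 2) = 0"
    using weak_gradient_measurable[OF g] by (subst (asm) nn_integral_0_iff_AE) auto
  then have g0: "AE x in lebesgue. g x = 0"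
    by eventually_elim (simp add: ennreal_eq_0_iff)
  have "(powr_integral lebesgue ?q (\<lambda>x. u x + (- v x))) \<noteq> \<infinity>"
    using q D12_measurable[OF u] D12_measurable[OF v(1)] D12_Lq_finite[OF u] D12_Lq_finite[OF v(1)]
    by (intro nn_integral_powr_finite_add) auto
  then have int: "integrable lebesgue (\<lambda>x. \<bar>u x - v x\<bar> powr ?q)"
    using D12_measurable[OF u] D12_measurable[OF v(1)] by (intro integrableI_nonneg) (auto simp: less_top)
  have "AE x in lebesgue. u x - v x = 0"
    by (rule weak_gradient_0_imp_AE_0[OF _ int g g0]) (use q in simp)
  then have eq: "(powr_integral lebesgue ?q (\<lambda>x. \<phi> n x - u x)) = (powr_integral lebesgue ?q (\<lambda>x. \<phi> n x - v x))" for n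
    by (intro nn_integral_cong_AE) (auto elim!: eventually_mono)
  show ?thesis unfolding eq by (rule vq)
qed

text \<open>Sobolev's inequality extends from test functions to their completion by Fatou's lemma.\<close>
lemma sobolev_small_D12:
  assumes N: "CARD('n::finite) \<ge> 3" and e: "e > 0"
  obtains \<delta> where "\<delta> > 0"
    "\<And>u::real^'n \<Rightarrow> real. u \<in> D12 UNIV \<Longrightarrow> (grad_norm u)\<^sup>2 \<le> \<delta> \<Longrightarrow>
       (powr_integral lebesgue (sobolev_exponent TYPE('n)) u) \<le> ennreal e"
proof -
  let ?q = "sobolev_exponent TYPE('n)"
  have q: "?q > 0" using sobolev_exponent_gt_1[OF N] by simp
  obtain \<delta> where \<delta>: "\<delta> > 0" "\<And>\<phi>::real^'n \<Rightarrow> real. \<phi> \<in> C1_compact \<Longrightarrow> (grad_norm \<phi>)\<^sup>2 \<le> \<delta> \<Longrightarrow>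
       (powr_integral lebesgue ?q \<phi>) \<le> ennreal e"
    by (rule sobolev_small_C1_compact[OF N e]) blast
  show thesis
  proof (rule that[of "\<delta> / 4"])
    show "\<delta> / 4 > 0" using \<delta> by simp
    fix u :: "real^'n \<Rightarrow> real" assume u: "u \<in> D12 UNIV" and le: "(grad_norm u)\<^sup>2 \<le> \<delta> / 4"
    note ue = D12_finite_energy[OF u] and [measurable] = D12_measurable[OF u]
    obtain \<phi> where \<phi>: "\<And>n. \<phi> n \<in> test_functions" and lim: "(\<lambda>n. energy_dist u (\<phi> n)) \<longlonglongrightarrow> 0"
      by (rule D12_approximation[OF u]) blast
    note \<phi>e = finite_energy_test_function[OF \<phi>]
    have \<phi>m[measurable]: "\<phi> n \<in> borel_measurable lebesgue" for n
      by (intro borel_measurable_continuous_lebesgue C1_compact_continuous test_functions_C1_compact \<phi>)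
    obtain r where r: "strict_mono r" "AE x in lebesgue. (\<lambda>n. \<phi> (r n) x) \<longlonglongrightarrow> u x"
      by (rule Lq_convergent_imp_AE_subseq[OF q \<phi>m D12_measurable[OF u] D12_approximation_Lq[OF N u \<phi> lim]])
    have "\<forall>\<^sub>F n in sequentially. energy_dist u (\<phi> n) < \<delta> / 4"
      using \<delta> by (intro order_tendstoD(2)[OF lim]) simp
    then have "\<forall>\<^sub>F n in sequentially. (powr_integral lebesgue ?q (\<phi> n)) \<le> ennreal e"
    proof eventually_elim
      case (elim n)
      have "(grad_norm (\<lambda>x. u x + (\<phi> n x - u x)))\<^sup>2 \<le> 2 * (grad_norm u)\<^sup>2 + 2 * energy_dist (\<phi> n) u"
        using grad_norm_power2_add_le[OF ue finite_energy_diff[OF \<phi>e ue], of 1] by simp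
      then have "(grad_norm (\<phi> n))\<^sup>2 \<le> \<delta>"
        using le elim grad_norm_power2_commute[OF \<phi>e[of n] ue] by simp
      then show ?case by (rule \<delta>(2)[OF test_functions_C1_compact[OF \<phi>]])
    qed
    then have ev: "\<forall>\<^sub>F n in sequentially. (powr_integral lebesgue ?q (\<phi> (r n))) \<le> ennreal e"
      using filterlim_subseq[OF r(1)] by (rule eventually_compose_filterlim)
    have "(powr_integral lebesgue ?q u) = (\<integral>\<^sup>+x. liminf (\<lambda>n. ennreal (norm (\<phi> (r n) x) powr ?q)) \<partial>lebesgue)"
    proof (rule nn_integral_cong_AE, rule AE_mp[OF r(2)], intro AE_I2 impI)
      fix x assume "(\<lambda>n. \<phi> (r n) x) \<longlonglongrightarrow> u x"
      then have "(\<lambda>n. ennreal (norm (\<phi> (r n) x) powr ?q)) \<longlonglongrightarrow> ennreal (norm (u x) powr ?q)"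
        using q by (intro tendsto_ennrealI tendsto_powr' tendsto_intros) auto
      from lim_imp_Liminf[OF _ this]
      show "ennreal (norm (u x) powr ?q) = liminf (\<lambda>n. ennreal (norm (\<phi> (r n) x) powr ?q))" by simp
    qed
    also have "\<dots> \<le> liminf (\<lambda>n. powr_integral lebesgue ?q (\<phi> (r n)))"
      by (rule nn_integral_liminf) measurable
    also have "\<dots> \<le> limsup (\<lambda>n. powr_integral lebesgue ?q (\<phi> (r n)))"
      by (rule Liminf_le_Limsup) simp
    also have "\<dots> \<le> ennreal e" by (rule Limsup_bounded[OF ev])
    finally show "(powr_integral lebesgue ?q u) \<le> ennreal e" .
  qed
qed

lemma D12_lincomb:
  fixes u v :: "real^'n \<Rightarrow> real"
  assumes N: "CARD('n) \<ge> 3" and u: "u \<in> D12 UNIV" and v: "v \<in> D12 UNIV"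
  shows "(\<lambda>x. a * u x + b * v x) \<in> D12 UNIV"
proof -
  let ?q = "sobolev_exponent TYPE('n)"
  have q: "?q > 0" using sobolev_exponent_gt_1[OF N] by simp
  note ue = D12_finite_energy[OF u] and ve = D12_finite_energy[OF v]
  obtain \<phi> where \<phi>: "\<And>n. \<phi> n \<in> test_functions" "(\<lambda>n. energy_dist u (\<phi> n)) \<longlonglongrightarrow> 0"
    by (rule D12_approximation[OF u]) blast
  obtain \<psi> where \<psi>: "\<And>n. \<psi> n \<in> test_functions" "(\<lambda>n. energy_dist v (\<psi> n)) \<longlonglongrightarrow> 0"
    by (rule D12_approximation[OF v]) blast
  have scaled: "(powr_integral lebesgue ?q (\<lambda>x. c * w x)) \<noteq> \<infinity>"
    if w: "w \<in> D12 UNIV" for c and w :: "real^'n \<Rightarrow> real"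
  proof -
    have "(powr_integral lebesgue ?q (\<lambda>x. c * w x)) = (\<integral>\<^sup>+x. ennreal (\<bar>c\<bar> powr ?q) * ennreal (norm (w x) powr ?q) \<partial>lebesgue)"
      by (simp add: abs_mult powr_mult ennreal_mult)
    also have "\<dots> = ennreal (\<bar>c\<bar> powr ?q) * (powr_integral lebesgue ?q w)"
      using D12_measurable[OF w] by (intro nn_integral_cmult) auto
    finally show ?thesis using D12_Lq_finite[OF w] by (simp add: ennreal_mult_eq_top_iff)
  qed
  show ?thesis
  proof (rule D12_UNIV_I[where \<phi> = "\<lambda>n x. a * \<phi> n x + b * \<psi> n x"])
    show "(\<lambda>x. a * u x + b * v x) \<in> borel_measurable lebesgue"
      using D12_measurable[OF u] D12_measurable[OF v] by simp
    show "(powr_integral lebesgue ?q (\<lambda>x. a * u x + b * v x)) \<noteq> \<infinity>"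
      using q D12_measurable[OF u] D12_measurable[OF v] by (intro nn_integral_powr_finite_add scaled u v) auto
    show "finite_energy (\<lambda>x. a * u x + b * v x)" by (rule finite_energy_lincomb[OF ue ve])
    show "(\<lambda>x. a * \<phi> n x + b * \<psi> n x) \<in> test_functions" for n by (rule test_functions_lincomb[OF \<phi>(1) \<psi>(1)])
    show "(\<lambda>n. (grad_norm (\<lambda>x. (a * u x + b * v x) - (a * \<phi> n x + b * \<psi> n x)))\<^sup>2) \<longlonglongrightarrow> 0"
    proof (rule tendsto_sandwich[OF _ _ tendsto_const])
      show "(\<lambda>n. 2 * (a\<^sup>2 * energy_dist u (\<phi> n)) + 2 * (b\<^sup>2 * energy_dist v (\<psi> n))) \<longlonglongrightarrow> 0"
        using tendsto_add[OF tendsto_mult_left[OF \<phi>(2), of "2 * a\<^sup>2"] tendsto_mult_left[OF \<psi>(2), of "2 * b\<^sup>2"]] by (simp add: mult.assoc)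
      show "\<forall>\<^sub>F n in sequentially. (grad_norm (\<lambda>x. (a * u x + b * v x) - (a * \<phi> n x + b * \<psi> n x)))\<^sup>2
          \<le> 2 * (a\<^sup>2 * energy_dist u (\<phi> n)) + 2 * (b\<^sup>2 * energy_dist v (\<psi> n))"
      proof (intro always_eventually allI)
        fix n
        note du = finite_energy_diff[OF ue finite_energy_test_function[OF \<phi>(1)[of n]]]
          and dv = finite_energy_diff[OF ve finite_energy_test_function[OF \<psi>(1)[of n]]]
        have "finite_energy (\<lambda>x. a * (u x - \<phi> n x))" "finite_energy (\<lambda>x. b * (v x - \<psi> n x))"
          using finite_energy_lincomb[OF du du, of a 0] finite_energy_lincomb[OF dv dv, of b 0] by simp_all
        from grad_norm_power2_add_le[OF this, of 1]
        have "(grad_norm (\<lambda>x. a * (u x - \<phi> n x) + b * (v x - \<psi> n x)))\<^sup>2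
          \<le> 2 * (a\<^sup>2 * energy_dist u (\<phi> n)) + 2 * (b\<^sup>2 * energy_dist v (\<psi> n))"
          by (simp add: grad_norm_power2_cmult[OF du] grad_norm_power2_cmult[OF dv])
        moreover have "(\<lambda>x. a * (u x - \<phi> n x) + b * (v x - \<psi> n x)) = (\<lambda>x. (a * u x + b * v x) - (a * \<phi> n x + b * \<psi> n x))"
          by (simp add: algebra_simps)
        ultimately show "(grad_norm (\<lambda>x. (a * u x + b * v x) - (a * \<phi> n x + b * \<psi> n x)))\<^sup>2
          \<le> 2 * (a\<^sup>2 * energy_dist u (\<phi> n)) + 2 * (b\<^sup>2 * energy_dist v (\<psi> n))" by simp
      qed
    qed auto
  qed
qed

text \<open>
  Replacing each \<open>v n\<close> by a test function at distance tending to \<open>0\<close> reduces completeness to Cauchy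
  sequences of test functions.
\<close>
lemma D12_complete:
  fixes v :: "nat \<Rightarrow> real^'n \<Rightarrow> real"
  assumes N: "CARD('n) \<ge> 3" and v: "\<And>n. v n \<in> D12 UNIV"
    and Cauchy: "\<And>e. e > 0 \<Longrightarrow> \<exists>M. \<forall>m\<ge>M. \<forall>n\<ge>M. energy_dist (v m) (v n) \<le> e"
  obtains u where "u \<in> D12 UNIV" "(\<lambda>n. energy_dist (v n) u) \<longlonglongrightarrow> 0"
    "(\<lambda>n. powr_integral lebesgue (sobolev_exponent TYPE('n)) (\<lambda>x. v n x - u x)) \<longlonglongrightarrow> 0"
proof -
  let ?q = "sobolev_exponent TYPE('n)"
  note ve = D12_finite_energy[OF v]
  have "\<exists>\<phi>. \<phi> \<in> test_functions \<and> energy_dist (v n) \<phi> < 1 / real (Suc n)" for n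
  proof -
    obtain \<phi> where \<phi>: "\<And>k. \<phi> k \<in> test_functions" "(\<lambda>k. energy_dist (v n) (\<phi> k)) \<longlonglongrightarrow> 0"
      by (rule D12_approximation[OF v[of n]]) blast
    have "\<forall>\<^sub>F k in sequentially. energy_dist (v n) (\<phi> k) < 1 / real (Suc n)"
      by (rule order_tendstoD(2)[OF \<phi>(2)]) simp
    then show ?thesis using \<phi>(1) by (auto simp: eventually_sequentially)
  qed
  then obtain \<phi> where \<phi>: "\<And>n. \<phi> n \<in> test_functions" and close: "\<And>n. energy_dist (v n) (\<phi> n) < 1 / real (Suc n)"
    by metis
  note \<phi>e = finite_energy_test_function[OF \<phi>]
  have close_lim: "(\<lambda>n. energy_dist (v n) (\<phi> n)) \<longlonglongrightarrow> 0"
    by (rule tendsto_sandwich[OF _ _ tendsto_const LIMSEQ_inverse_real_of_nat])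
       (use close in \<open>auto intro!: always_eventually less_imp_le simp: inverse_eq_divide\<close>)
  have Cauchy_\<phi>: "\<exists>M. \<forall>m\<ge>M. \<forall>n\<ge>M. energy_dist (\<phi> m) (\<phi> n) \<le> e" if e: "e > 0" for e
  proof -
    have "e / 16 > 0" using e by simp
    from Cauchy[OF this] obtain M1 where M1: "\<And>m n. m \<ge> M1 \<Longrightarrow> n \<ge> M1 \<Longrightarrow> energy_dist (v m) (v n) \<le> e / 16"
      by blast
    have "\<forall>\<^sub>F n in sequentially. energy_dist (v n) (\<phi> n) < e / 16"
      using e by (intro order_tendstoD(2)[OF close_lim]) simp
    then obtain M2 where M2: "\<And>n. n \<ge> M2 \<Longrightarrow> energy_dist (v n) (\<phi> n) < e / 16"
      by (auto simp: eventually_sequentially)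
    have "energy_dist (\<phi> m) (\<phi> n) \<le> e" if mn: "m \<ge> max M1 M2" "n \<ge> max M1 M2" for m n
    proof -
      have "energy_dist (\<phi> m) (\<phi> n) \<le> 2 * energy_dist (\<phi> m) (v m) + 2 * energy_dist (v m) (\<phi> n)"
        by (rule grad_norm_power2_triangle[OF \<phi>e ve \<phi>e])
      moreover have "energy_dist (v m) (\<phi> n) \<le> 2 * energy_dist (v m) (v n) + 2 * energy_dist (v n) (\<phi> n)"
        by (rule grad_norm_power2_triangle[OF ve ve \<phi>e])
      moreover have "energy_dist (\<phi> m) (v m) < e / 16"
        using M2[of m] mn grad_norm_power2_commute[OF \<phi>e[of m] ve[of m]] by simp
      moreover have "energy_dist (v n) (\<phi> n) < e / 16" "energy_dist (v m) (v n) \<le> e / 16"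
        using M1[of m n] M2[of n] mn by simp_all
      ultimately show ?thesis using e by linarith
    qed
    then show ?thesis by blast
  qed
  obtain u where u: "u \<in> D12 UNIV" and u\<phi>: "(\<lambda>n. energy_dist u (\<phi> n)) \<longlonglongrightarrow> 0"
    by (rule test_function_completion[OF N \<phi> Cauchy_\<phi>]) blast
  note ue = D12_finite_energy[OF u]
  have lim: "(\<lambda>n. energy_dist (v n) u) \<longlonglongrightarrow> 0"
  proof (rule tendsto_sandwich[OF _ _ tendsto_const])
    show "(\<lambda>n. 2 * energy_dist (v n) (\<phi> n) + 2 * energy_dist u (\<phi> n)) \<longlonglongrightarrow> 0"
      using tendsto_add[OF tendsto_mult_left[OF close_lim, of 2] tendsto_mult_left[OF u\<phi>, of 2]] by simp
    show "\<forall>\<^sub>F n in sequentially. energy_dist (v n) u \<le> 2 * energy_dist (v n) (\<phi> n) + 2 * energy_dist u (\<phi> n)"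
      using grad_norm_power2_triangle[OF ve \<phi>e ue] grad_norm_power2_commute[OF \<phi>e ue] by (intro always_eventually) simp
  qed auto
  have "(\<lambda>n. powr_integral lebesgue ?q (\<lambda>x. v n x - u x)) \<longlonglongrightarrow> 0"
    unfolding tendsto_0_ennreal_iff
  proof (intro allI impI)
    fix e :: real assume e: "e > 0"
    obtain \<delta> where \<delta>: "\<delta> > 0" "\<And>u::real^'n \<Rightarrow> real. u \<in> D12 UNIV \<Longrightarrow> (grad_norm u)\<^sup>2 \<le> \<delta> \<Longrightarrow>
       (powr_integral lebesgue ?q u) \<le> ennreal e"
      by (rule sobolev_small_D12[OF N e]) blast
    have "\<forall>\<^sub>F n in sequentially. energy_dist (v n) u < \<delta>"
      by (rule order_tendstoD(2)[OF lim \<delta>(1)])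
    then show "\<forall>\<^sub>F n in sequentially. (powr_integral lebesgue ?q (\<lambda>x. v n x - u x)) \<le> ennreal e"
    proof eventually_elim
      case (elim n)
      have "(\<lambda>x. v n x - u x) \<in> D12 UNIV" using D12_lincomb[OF N v[of n] u, of 1 "-1"] by simp
      then show ?case by (rule \<delta>(2)) (use elim in simp)
    qed
  qed
  with u lim show thesis by (rule that)
qed


section \<open>Minimising the energy over nested midpoint-convex sets\<close>

text \<open>
  A substitute for weak compactness. Almost minimisers over the sets \<open>K n\<close> form a Cauchy
  sequence by the parallelogram identity, because the infima increase to a finite limit.
\<close>
lemma nested_energy_minimisation:
  fixes K :: "nat \<Rightarrow> (real^'n \<Rightarrow> real) set"
  assumes N: "CARD('n) \<ge> 3" and K: "\<And>n. K n \<subseteq> D12 UNIV" and antimono: "\<And>m n. m \<le> n \<Longrightarrow> K n \<subseteq> K m"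
    and mid: "\<And>n u v. u \<in> K n \<Longrightarrow> v \<in> K n \<Longrightarrow> (\<lambda>x. (u x + v x) / 2) \<in> K n"
    and energy: "\<And>n e. e > 0 \<Longrightarrow> \<exists>u\<in>K n. (grad_norm u)\<^sup>2 \<le> L + e"
  obtains v u where "\<And>n. v n \<in> K n" "u \<in> D12 UNIV" "(grad_norm u)\<^sup>2 \<le> L"
    "(\<lambda>n. powr_integral lebesgue (sobolev_exponent TYPE('n)) (\<lambda>x. v n x - u x)) \<longlonglongrightarrow> 0"
proof -
  define d where "d n = (INF u\<in>K n. (grad_norm u)\<^sup>2)" for n
  have ne: "K n \<noteq> {}" for n using energy[of 1 n] by auto
  have bdd: "bdd_below ((\<lambda>u. (grad_norm u)\<^sup>2) ` K n)" for n by (rule bdd_belowI[of _ 0]) auto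
  have d_le: "d n \<le> (grad_norm u)\<^sup>2" if "u \<in> K n" for n u
    unfolding d_def by (rule cINF_lower[OF bdd that])
  have d_L: "d n \<le> L" for n
  proof (rule field_le_epsilon)
    fix e :: real assume "e > 0"
    then obtain u where "u \<in> K n" "(grad_norm u)\<^sup>2 \<le> L + e" using energy by blast
    then show "d n \<le> L + e" using d_le by fastforce
  qed
  have d_mono: "d m \<le> d n" if "m \<le> n" for m n
    unfolding d_def by (rule cINF_superset_mono[OF ne bdd antimono[OF that]]) simp
  have "\<exists>v\<in>K n. (grad_norm v)\<^sup>2 < d n + 1 / real (Suc n)" for n
  proof -
    have "d n < d n + 1 / real (Suc n)" by simp
    then show ?thesis unfolding d_def using cINF_less_iff[OF ne bdd] by blast
  qed
  then obtain v where v: "\<And>n. v n \<in> K n" and v_lt: "\<And>n. (grad_norm (v n))\<^sup>2 < d n + 1 / real (Suc n)" by metis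
  have vD: "v n \<in> D12 UNIV" for n using v K by blast
  note ve = D12_finite_energy[OF vD]
  obtain dl where dl: "d \<longlonglongrightarrow> dl" and "\<forall>n. d n \<le> dl"
    by (rule incseq_convergent[of d L]) (use d_mono d_L in \<open>auto simp: incseq_def\<close>)
  then have d_dl: "d n \<le> dl" for n by blast
  have Cauchy: "\<exists>M. \<forall>m\<ge>M. \<forall>n\<ge>M. energy_dist (v m) (v n) \<le> e" if e: "e > 0" for e
  proof -
    have "\<forall>\<^sub>F n in sequentially. d n > dl - e / 8"
      using e by (intro order_tendstoD(1)[OF dl]) simp
    moreover have "\<forall>\<^sub>F n in sequentially. inverse (real (Suc n)) < e / 8"
      using e by (intro order_tendstoD(2)[OF LIMSEQ_inverse_real_of_nat]) simp
    ultimately have "\<forall>\<^sub>F n in sequentially. d n > dl - e / 8 \<and> inverse (real (Suc n)) < e / 8"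
      by (rule eventually_conj)
    then obtain M where M: "d M > dl - e / 8" "inverse (real (Suc M)) < e / 8"
      by (auto simp: eventually_sequentially)
    have "energy_dist (v m) (v n) \<le> e" if mn: "m \<ge> M" "n \<ge> M" for m n
    proof -
      have "(\<lambda>x. (v m x + v n x) / 2) \<in> K M"
        using v[of m] v[of n] antimono mn by (intro mid) blast+
      then have 1: "d M \<le> (grad_norm (\<lambda>x. (v m x + v n x) / 2))\<^sup>2" by (rule d_le)
      have small: "(grad_norm (v k))\<^sup>2 < dl + e / 8" if "k \<ge> M" for k
      proof -
        have "1 / real (Suc k) \<le> inverse (real (Suc M))" using that by (simp add: field_simps)
        then show ?thesis using v_lt[of k] d_dl[of k] M by linarith
      qed
      show ?thesis
        using grad_norm_parallelogram[OF ve ve, of m n] 1 small[OF mn(1)] small[OF mn(2)] M(1) by linarith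
    qed
    then show ?thesis by blast
  qed
  obtain u where u: "u \<in> D12 UNIV" and lim: "(\<lambda>n. energy_dist (v n) u) \<longlonglongrightarrow> 0"
    and lim_q: "(\<lambda>n. powr_integral lebesgue (sobolev_exponent TYPE('n)) (\<lambda>x. v n x - u x)) \<longlonglongrightarrow> 0"
    by (rule D12_complete[OF N vD Cauchy]) blast
  note ue = D12_finite_energy[OF u]
  have bound: "(grad_norm u)\<^sup>2 \<le> (1 + \<delta>) * L" if \<delta>: "\<delta> > 0" for \<delta>
  proof -
    have "(\<lambda>n. (1 + \<delta>) * (L + inverse (real (Suc n))) + (1 + 1 / \<delta>) * energy_dist (v n) u)
        \<longlonglongrightarrow> (1 + \<delta>) * (L + 0) + (1 + 1 / \<delta>) * 0"
      by (intro tendsto_intros lim LIMSEQ_inverse_real_of_nat)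
    moreover have "(grad_norm u)\<^sup>2 \<le> (1 + \<delta>) * (L + inverse (real (Suc n))) + (1 + 1 / \<delta>) * energy_dist (v n) u" for n
    proof -
      have "(grad_norm (\<lambda>x. v n x + (u x - v n x)))\<^sup>2 \<le> (1 + \<delta>) * (grad_norm (v n))\<^sup>2 + (1 + 1 / \<delta>) * energy_dist u (v n)"
        by (rule grad_norm_power2_add_le[OF ve finite_energy_diff[OF ue ve] \<delta>])
      moreover have "(1 + \<delta>) * (grad_norm (v n))\<^sup>2 \<le> (1 + \<delta>) * (L + inverse (real (Suc n)))"
        using v_lt[of n] d_L[of n] \<delta> by (intro mult_left_mono) (auto simp: inverse_eq_divide)
      ultimately show ?thesis using grad_norm_power2_commute[OF ue ve[of n]] by simp
    qed
    ultimately have "(grad_norm u)\<^sup>2 \<le> (1 + \<delta>) * (L + 0) + (1 + 1 / \<delta>) * 0"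
      by (intro LIMSEQ_le_const) auto
    then show ?thesis by simp
  qed
  have "((\<lambda>\<delta>. (1 + \<delta>) * L) \<longlongrightarrow> (1 + 0) * L) (at_right 0)" by (intro tendsto_intros)
  then have "(grad_norm u)\<^sup>2 \<le> (1 + 0) * L"
    by (rule tendsto_lowerbound) (use bound in \<open>auto simp: eventually_at_filter intro!: always_eventually\<close>)
  then show thesis using that[OF v u _ lim_q] by simp
qed

section \<open>Constrained minimisers in the limit of large penalties\<close>

lemma Fatou_le:
  fixes f :: "nat \<Rightarrow> 'a \<Rightarrow> ennreal"
  assumes [measurable]: "\<And>n. f n \<in> borel_measurable M"
    and lim: "AE x in M. (\<lambda>n. f n x) \<longlonglongrightarrow> g x"
    and le: "\<And>n. (\<integral>\<^sup>+x. f n x \<partial>M) \<le> b n" and b: "b \<longlonglongrightarrow> B"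
  shows "(\<integral>\<^sup>+x. g x \<partial>M) \<le> B"
proof -
  have "(\<integral>\<^sup>+x. g x \<partial>M) = (\<integral>\<^sup>+x. liminf (\<lambda>n. f n x) \<partial>M)"
    using lim by (intro nn_integral_cong_AE) (auto elim!: eventually_mono simp: lim_imp_Liminf)
  also have "\<dots> \<le> liminf (\<lambda>n. \<integral>\<^sup>+x. f n x \<partial>M)" by (rule nn_integral_liminf) measurable
  also have "\<dots> \<le> liminf b" by (intro Liminf_mono always_eventually allI le)
  also have "\<dots> = B" by (rule lim_imp_Liminf[OF _ b]) simp
  finally show ?thesis .
qed

lemma nn_integral_midpoint_le:
  fixes f g h :: "'a \<Rightarrow> real"
  assumes [measurable]: "f \<in> borel_measurable M" "g \<in> borel_measurable M"
    and nonneg: "\<And>x. 0 \<le> f x" "\<And>x. 0 \<le> g x" and mid: "\<And>x. h x \<le> (f x + g x) / 2"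
    and le: "(\<integral>\<^sup>+x. ennreal (f x) \<partial>M) \<le> B" "(\<integral>\<^sup>+x. ennreal (g x) \<partial>M) \<le> B"
  shows "(\<integral>\<^sup>+x. ennreal (h x) \<partial>M) \<le> B"
proof -
  have "ennreal (h x) \<le> ennreal (1/2) * (ennreal (f x) + ennreal (g x))" for x
  proof -
    have "ennreal (h x) \<le> ennreal (1/2 * (f x + g x))" using mid[of x] by (intro ennreal_leI) simp
    also have "\<dots> = ennreal (1/2) * ennreal (f x + g x)" using nonneg[of x] by (intro ennreal_mult) auto
    also have "ennreal (f x + g x) = ennreal (f x) + ennreal (g x)" using nonneg[of x] by (intro ennreal_plus)
    finally show ?thesis .
  qed
  then have "(\<integral>\<^sup>+x. ennreal (h x) \<partial>M) \<le> (\<integral>\<^sup>+x. ennreal (1/2) * (ennreal (f x) + ennreal (g x)) \<partial>M)"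
    by (intro nn_integral_mono)
  also have "\<dots> = ennreal (1/2) * ((\<integral>\<^sup>+x. ennreal (f x) \<partial>M) + (\<integral>\<^sup>+x. ennreal (g x) \<partial>M))"
    by (simp add: nn_integral_cmult nn_integral_add)
  also have "\<dots> \<le> ennreal (1/2) * (B + B)" by (intro mult_left_mono add_mono le) auto
  also have "\<dots> = (ennreal (1/2) + ennreal (1/2)) * B"
    by (simp only: distrib_left distrib_right)
  also have "ennreal (1/2) + ennreal (1/2) = 1"
    by (subst ennreal_plus[symmetric]) simp_all
  finally show ?thesis by simp
qed

lemma powr_midpoint_le:
  fixes a b p :: real
  assumes p: "p \<ge> 1"
  shows "\<bar>(a + b) / 2\<bar> powr p \<le> (\<bar>a\<bar> powr p + \<bar>b\<bar> powr p) / 2"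
proof (cases "a = 0 \<or> b = 0")
  case True
  have half: "(1/2) powr p \<le> (1/2 :: real)" using powr_mono'[of 1 p "1/2"] p by simp
  have "\<bar>c / 2\<bar> powr p \<le> \<bar>c\<bar> powr p / 2" for c :: real
  proof -
    have "\<bar>c / 2\<bar> powr p = \<bar>c\<bar> powr p * (1/2) powr p" by (simp add: abs_divide powr_mult[symmetric])
    also have "\<dots> \<le> \<bar>c\<bar> powr p * (1/2)" by (intro mult_left_mono half) auto
    finally show ?thesis by simp
  qed
  then show ?thesis using True by auto
next
  case False
  have "((1 - 1/2) *\<^sub>R \<bar>a\<bar> + (1/2) *\<^sub>R \<bar>b\<bar>) powr p \<le> (1 - 1/2) * \<bar>a\<bar> powr p + (1/2) * \<bar>b\<bar> powr p"
    by (rule convex_onD[OF powr_convex[OF p]]) (use False in auto)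
  moreover have "\<bar>(a + b) / 2\<bar> powr p \<le> ((\<bar>a\<bar> + \<bar>b\<bar>) / 2) powr p"
    using p abs_triangle_ineq[of a b] by (intro powr_mono2) auto
  ultimately show ?thesis by (simp add: add_divide_distrib)
qed

lemma square_midpoint_le: "((a + b) / 2)\<^sup>2 \<le> (a\<^sup>2 + b\<^sup>2) / (2::real)"
  using sum_squares_ge_zero[of "a - b" 0] by (simp add: power2_eq_square field_simps)

lemma D12_iff: "u \<in> D12 \<Omega> \<longleftrightarrow> u \<in> D12 UNIV \<and> (AE x in lebesgue. x \<notin> \<Omega> \<longrightarrow> u x = 0)"
  by (auto simp: D12_def)


text \<open>
  The compactness argument behind both claims: uniformly bounded infima of the penalised
  problems produce an admissible function for the limit problem with no larger energy. The limit is taken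
  inside the sets where the constraints hold up to an error \<open>\<epsilon>\<close>. The constraint on \<open>V\<close> becomes an
  inequality in the limit, since only the \<open>V\<^sup>+\<close> part passes to the limit exactly, and rescaling restores it.
\<close>
lemma penalised_bound_imp_admissible:
  fixes h V :: "real ^ 'n \<Rightarrow> real" and p L :: real
  assumes N: "CARD('n) \<ge> 3" and p: "p > 2"
    and h: "continuous_on UNIV h" and V: "continuous_on UNIV V"
    and emb_h: "compactly_embedded (D12 UNIV) grad_norm (Lq p (neg_part h)) (Lq_norm p (neg_part h))"
    and emb_V: "compactly_embedded
           (D12 UNIV \<inter> Lq p (pos_part h)) (\<lambda>u. grad_norm u + Lq_norm p (pos_part h) u)
           (Lq 2 (pos_part V)) (Lq_norm 2 (pos_part V))"
    and bound: "\<And>n. lambda1_k p UNIV V (\<lambda>x. real (Suc n) * pos_part h x - neg_part h x) \<le> ereal L"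
  obtains u where "u \<in> admissible {x. h x \<le> 0} V" "(grad_norm u)\<^sup>2 \<le> L"
proof -
  let ?hp = "pos_part h" and ?hm = "neg_part h" and ?Vp = "pos_part V" and ?Vm = "neg_part V"
  let ?q = "sobolev_exponent TYPE('n)"
  let ?h = "\<lambda>n x. real (Suc n) * ?hp x - ?hm x"
  have q: "?q > 0" using sobolev_exponent_gt_1[OF N] by simp
  have nn: "0 \<le> ?hp x" "0 \<le> ?hm x" "0 \<le> ?Vp x" "0 \<le> ?Vm x" for x by (auto simp: pos_part_def neg_part_def)
  have Vsplit: "V x = ?Vp x - ?Vm x" "\<bar>V x\<bar> = ?Vp x + ?Vm x" for x by (auto simp: pos_part_def neg_part_def)
  have [measurable]: "h \<in> borel_measurable lebesgue" "V \<in> borel_measurable lebesgue"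
    by (intro borel_measurable_continuous_lebesgue h V)+
  have [measurable]: "?hp \<in> borel_measurable lebesgue" "?hm \<in> borel_measurable lebesgue"
    "?Vp \<in> borel_measurable lebesgue" "?Vm \<in> borel_measurable lebesgue"
    unfolding pos_part_def[abs_def] neg_part_def[abs_def] by measurable

  have "\<exists>u\<in>admissible_k p UNIV V (?h n). (grad_norm u)\<^sup>2 < L + 1 / real (Suc n)" for n
  proof -
    have "lambda1_k p UNIV V (?h n) < ereal (L + 1 / real (Suc n))"
      using bound[of n] by (rule order.strict_trans1) simp
    then show ?thesis unfolding lambda1_k_def by (auto simp: INF_less_iff)
  qed
  then obtain u where u: "\<And>n. u n \<in> admissible_k p UNIV V (?h n)" and u_lt: "\<And>n. (grad_norm (u n))\<^sup>2 < L + 1 / real (Suc n)"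
    by metis
  have uD: "u n \<in> D12 UNIV" for n using u[of n] by (simp add: admissible_k_def)
  have um[measurable]: "u n \<in> borel_measurable lebesgue" for n by (rule D12_measurable[OF uD])
  have grad_le: "grad_norm (u n) \<le> sqrt (L + 1)" for n
  proof (rule real_le_rsqrt)
    have "1 / real (Suc n) \<le> 1" by simp
    then show "(grad_norm (u n))\<^sup>2 \<le> L + 1" using u_lt[of n] by linarith
  qed

  \<comment> \<open>The \<open>h\<^sup>-\<close> integrals are bounded, so the penalty forces the \<open>h\<^sup>+\<close> integrals to \<open>0\<close>.\<close>
  obtain C where C: "\<And>u. u \<in> D12 UNIV \<Longrightarrow> Lq_norm p ?hm u \<le> C * grad_norm u"
    using emb_h unfolding compactly_embedded_def by blast
  have sub_h: "D12 UNIV \<subseteq> Lq p ?hm" using emb_h unfolding compactly_embedded_def by blast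
  define C0 where "C0 = (max C 0 * sqrt (L + 1)) powr p"
  have C0: "C0 \<ge> 0" by (simp add: C0_def)
  have int_hm: "integrable lebesgue (\<lambda>x. ?hm x * \<bar>v x\<bar> powr p)" if "v \<in> D12 UNIV" for v
    using sub_h that by (auto simp: Lq_def)
  have hm_le: "(LINT x|lebesgue. ?hm x * \<bar>u n x\<bar> powr p) \<le> C0" for n
  proof -
    let ?I = "LINT x|lebesgue. ?hm x * \<bar>u n x\<bar> powr p"
    have I0: "?I \<ge> 0" by (intro integral_nonneg_AE AE_I2 mult_nonneg_nonneg nn) auto
    have "?I powr (1 / p) \<le> C * grad_norm (u n)" using C[OF uD[of n]] by (simp add: Lq_norm_def)
    also have "\<dots> \<le> max C 0 * sqrt (L + 1)" using grad_le[of n] grad_norm_nonneg[of "u n"] by (intro mult_mono) auto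
    finally have "(?I powr (1 / p)) powr p \<le> C0" unfolding C0_def using p by (intro powr_mono2) auto
    then show ?thesis using I0 p by (simp add: powr_powr)
  qed
  have int_hp: "integrable lebesgue (\<lambda>x. ?hp x * \<bar>u n x\<bar> powr p)"
    and hp_le: "(LINT x|lebesgue. ?hp x * \<bar>u n x\<bar> powr p) \<le> C0 / real (Suc n)" for n
  proof -
    have int: "integrable lebesgue (\<lambda>x. \<bar>?h n x\<bar> * \<bar>u n x\<bar> powr p)"
      and le0: "(LINT x|lebesgue. ?h n x * \<bar>u n x\<bar> powr p) \<le> 0"
      using u[of n] by (auto simp: admissible_k_def Lq_def)
    show ihp: "integrable lebesgue (\<lambda>x. ?hp x * \<bar>u n x\<bar> powr p)"
    proof (rule Bochner_Integration.integrable_bound[OF int])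
      show "AE x in lebesgue. norm (?hp x * \<bar>u n x\<bar> powr p) \<le> norm (\<bar>?h n x\<bar> * \<bar>u n x\<bar> powr p)"
      proof (intro AE_I2)
        fix x
        have "?hp x \<le> \<bar>?h n x\<bar>"
        proof (cases "h x \<le> 0")
          case False
          then have "?hp x \<le> real (Suc n) * ?hp x" by (simp add: pos_part_def)
          then show ?thesis using False by (simp add: neg_part_def pos_part_def)
        qed (simp add: pos_part_def)
        then show "norm (?hp x * \<bar>u n x\<bar> powr p) \<le> norm (\<bar>?h n x\<bar> * \<bar>u n x\<bar> powr p)"
          using nn(1)[of x] by (simp add: abs_mult mult_right_mono)
      qed
    qed measurable
    have "(LINT x|lebesgue. ?h n x * \<bar>u n x\<bar> powr p)
        = (LINT x|lebesgue. real (Suc n) * (?hp x * \<bar>u n x\<bar> powr p) - ?hm x * \<bar>u n x\<bar> powr p)"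
      by (simp add: left_diff_distrib mult.assoc)
    also have "\<dots> = real (Suc n) * (LINT x|lebesgue. ?hp x * \<bar>u n x\<bar> powr p) - (LINT x|lebesgue. ?hm x * \<bar>u n x\<bar> powr p)"
      using ihp int_hm[OF uD[of n]] by (simp only: Bochner_Integration.integral_diff integral_mult_right_zero integrable_mult_right)
    finally have "real (Suc n) * (LINT x|lebesgue. ?hp x * \<bar>u n x\<bar> powr p) \<le> C0"
      using le0 hm_le[of n] by linarith
    then show "(LINT x|lebesgue. ?hp x * \<bar>u n x\<bar> powr p) \<le> C0 / real (Suc n)"
      by (simp add: pos_le_divide_eq mult.commute)
  qed

  have u_in: "u n \<in> D12 UNIV \<inter> Lq p ?hp" for n using uD um int_hp by (simp add: Lq_def)
  have "grad_norm (u n) + Lq_norm p ?hp (u n) \<le> sqrt (L + 1) + C0 powr (1 / p)" for n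
  proof -
    have "(LINT x|lebesgue. ?hp x * \<bar>u n x\<bar> powr p) \<ge> 0" by (intro integral_nonneg_AE AE_I2 mult_nonneg_nonneg nn) auto
    moreover have "C0 / real (Suc n) \<le> C0" using C0 by (simp add: divide_le_eq mult_le_cancel_left1)
    ultimately have "Lq_norm p ?hp (u n) \<le> C0 powr (1 / p)"
      unfolding Lq_norm_def using hp_le[of n] p by (intro powr_mono2) auto
    then show ?thesis using grad_le[of n] by linarith
  qed
  then have "(\<forall>n. u n \<in> D12 UNIV \<inter> Lq p ?hp) \<and> (\<exists>B. \<forall>n. grad_norm (u n) + Lq_norm p ?hp (u n) \<le> B)"
    using u_in by blast
  then obtain r w where r: "strict_mono r" and w: "w \<in> Lq 2 ?Vp"
    and w_lim: "(\<lambda>n. Lq_norm 2 ?Vp (\<lambda>x. u (r n) x - w x)) \<longlonglongrightarrow> 0"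
    using emb_V[unfolded compactly_embedded_def] by blast
  have [measurable]: "w \<in> borel_measurable lebesgue" using w by (simp add: Lq_def)
  have int_w: "integrable lebesgue (\<lambda>x. ?Vp x * (w x)\<^sup>2)" using w by (simp add: Lq_def)
  have int_u: "integrable lebesgue (\<lambda>x. ?Vp x * (u n x)\<^sup>2)" "integrable lebesgue (\<lambda>x. ?Vm x * (u n x)\<^sup>2)"
    and V_u: "(LINT x|lebesgue. ?Vp x * (u n x)\<^sup>2) - (LINT x|lebesgue. ?Vm x * (u n x)\<^sup>2) = 1" for n
  proof -
    have int: "integrable lebesgue (\<lambda>x. \<bar>V x\<bar> * (u n x)\<^sup>2)" and one: "(LINT x|lebesgue. V x * (u n x)\<^sup>2) = 1"
      using u[of n] by (auto simp: admissible_k_def Lq_def)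
    show 1: "integrable lebesgue (\<lambda>x. ?Vp x * (u n x)\<^sup>2)" and 2: "integrable lebesgue (\<lambda>x. ?Vm x * (u n x)\<^sup>2)"
      by (rule Bochner_Integration.integrable_bound[OF int], measurable,
          intro AE_I2, use nn in \<open>auto simp: Vsplit(2) abs_mult intro!: mult_right_mono\<close>)+
    have "(LINT x|lebesgue. V x * (u n x)\<^sup>2) = (LINT x|lebesgue. ?Vp x * (u n x)\<^sup>2 - ?Vm x * (u n x)\<^sup>2)"
      by (simp add: Vsplit(1) left_diff_distrib)
    then show "(LINT x|lebesgue. ?Vp x * (u n x)\<^sup>2) - (LINT x|lebesgue. ?Vm x * (u n x)\<^sup>2) = 1"
      using one 1 2 by simp
  qed
  have int_uw: "integrable lebesgue (\<lambda>x. ?Vp x * (u n x - w x)\<^sup>2)" for n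
  proof (rule Bochner_Integration.integrable_bound)
    show "integrable lebesgue (\<lambda>x. 2 * (?Vp x * (u n x)\<^sup>2) + 2 * (?Vp x * (w x)\<^sup>2))"
      by (intro Bochner_Integration.integrable_add integrable_mult_right int_u int_w)
    show "AE x in lebesgue. norm (?Vp x * (u n x - w x)\<^sup>2) \<le> norm (2 * (?Vp x * (u n x)\<^sup>2) + 2 * (?Vp x * (w x)\<^sup>2))"
    proof (intro AE_I2)
      fix x
      have "(u n x - w x)\<^sup>2 \<le> 2 * (u n x)\<^sup>2 + 2 * (w x)\<^sup>2"
        using norm_add_power2_le[of 1 "u n x" "- w x"] by simp
      then have "?Vp x * (u n x - w x)\<^sup>2 \<le> ?Vp x * (2 * (u n x)\<^sup>2 + 2 * (w x)\<^sup>2)" by (intro mult_left_mono nn)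
      then show "norm (?Vp x * (u n x - w x)\<^sup>2) \<le> norm (2 * (?Vp x * (u n x)\<^sup>2) + 2 * (?Vp x * (w x)\<^sup>2))"
        using nn(3)[of x] by (simp add: distrib_left mult.left_commute)
    qed
  qed measurable
  have uw_lim: "(\<lambda>n. LINT x|lebesgue. ?Vp x * (u (r n) x - w x)\<^sup>2) \<longlonglongrightarrow> 0"
  proof -
    have "(LINT x|lebesgue. ?Vp x * (u (r n) x - w x)\<^sup>2) \<ge> 0" for n by (intro integral_nonneg_AE AE_I2 mult_nonneg_nonneg nn) auto
    then have "(LINT x|lebesgue. ?Vp x * (u (r n) x - w x)\<^sup>2) = (Lq_norm 2 ?Vp (\<lambda>x. u (r n) x - w x))\<^sup>2" for n
      by (simp add: Lq_norm_def powr_half_sqrt)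
    then show ?thesis using tendsto_power[OF w_lim, of 2] by simp
  qed

  \<comment> \<open>In the third constraint \<open>(1 + e n) * P + e n\<close> bounds \<open>\<integral>V\<^sup>+u\<^sup>2\<close> for \<open>u\<close> close to \<open>w\<close>, by \<open>norm_add_power2_le\<close> with
     \<open>\<delta> = e n\<close>; subtracting \<open>1\<close> bounds \<open>\<integral>V\<^sup>-u\<^sup>2\<close> because of the normalisation of \<open>u\<close>. Stated this way
     all three constraints are convex in \<open>v\<close>.\<close>
  define P where "P = (LINT x|lebesgue. ?Vp x * (w x)\<^sup>2)"
  define e where "e n = inverse (real (Suc n))" for n
  have e_pos: "e n > 0" and e_mono: "m \<le> n \<Longrightarrow> e n \<le> e m" for m n by (auto simp: e_def)
  have e_lim: "e \<longlonglongrightarrow> 0" unfolding e_def by (rule LIMSEQ_inverse_real_of_nat)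
  have P: "P \<ge> 0" unfolding P_def by (intro integral_nonneg_AE AE_I2 mult_nonneg_nonneg nn) auto
  define K where "K n = {v \<in> D12 UNIV. (\<integral>\<^sup>+x. ennreal (?hp x * \<bar>v x\<bar> powr p) \<partial>lebesgue) \<le> ennreal (e n)
      \<and> (\<integral>\<^sup>+x. ennreal (?Vp x * (v x - w x)\<^sup>2) \<partial>lebesgue) \<le> ennreal (e n)
      \<and> (\<integral>\<^sup>+x. ennreal (?Vm x * (v x)\<^sup>2) \<partial>lebesgue) \<le> ennreal ((1 + e n) * P + e n - 1)}" for n
  have K_mem: "\<forall>\<^sub>F k in sequentially. u (r k) \<in> K n \<and> (grad_norm (u (r k)))\<^sup>2 \<le> L + \<epsilon>
      \<and> 0 \<le> (1 + e n) * P + e n - 1" if \<epsilon>: "\<epsilon> > 0" for n \<epsilon>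
  proof -
    have rlim: "filterlim r at_top sequentially" by (rule filterlim_subseq[OF r])
    have inv: "(\<lambda>k. inverse (real (Suc (r k)))) \<longlonglongrightarrow> 0"
      using LIMSEQ_subseq_LIMSEQ[OF LIMSEQ_inverse_real_of_nat r] by (simp add: o_def)
    have "\<forall>\<^sub>F k in sequentially. C0 * inverse (real (Suc (r k))) < e n"
      using e_pos[of n] tendsto_mult_left[OF inv, of C0] by (intro order_tendstoD(2)[where y = 0]) auto
    moreover have "\<forall>\<^sub>F k in sequentially. inverse (real (Suc (r k))) < \<epsilon>"
      by (rule order_tendstoD(2)[OF inv \<epsilon>])
    moreover have "\<forall>\<^sub>F k in sequentially. (1 + 1 / e n) * (LINT x|lebesgue. ?Vp x * (u (r k) x - w x)\<^sup>2) < e n"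
      using e_pos[of n] tendsto_mult_left[OF uw_lim, of "1 + 1 / e n"] by (intro order_tendstoD(2)[where y = 0]) auto
    ultimately show ?thesis
    proof eventually_elim
      case (elim k)
      let ?A = "LINT x|lebesgue. ?Vp x * (u (r k) x - w x)\<^sup>2"
      have A0: "?A \<ge> 0" by (intro integral_nonneg_AE AE_I2 mult_nonneg_nonneg nn) auto
      have "?A \<le> (1 + 1 / e n) * ?A" using A0 e_pos[of n] by (simp add: distrib_right)
      then have A: "?A \<le> e n" using elim(3) by linarith
      have "(LINT x|lebesgue. ?Vp x * (u (r k) x)\<^sup>2) \<le> (LINT x|lebesgue. (1 + e n) * (?Vp x * (w x)\<^sup>2) + (1 + 1 / e n) * (?Vp x * (u (r k) x - w x)\<^sup>2))"
      proof (intro integral_mono Bochner_Integration.integrable_add integrable_mult_right int_u int_w int_uw)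
        fix x
        have "(u (r k) x)\<^sup>2 \<le> (1 + e n) * (w x)\<^sup>2 + (1 + 1 / e n) * (u (r k) x - w x)\<^sup>2"
          using norm_add_power2_le[OF e_pos[of n], of "w x" "u (r k) x - w x"] by simp
        then have "?Vp x * (u (r k) x)\<^sup>2 \<le> ?Vp x * ((1 + e n) * (w x)\<^sup>2 + (1 + 1 / e n) * (u (r k) x - w x)\<^sup>2)"
          by (intro mult_left_mono nn)
        then show "?Vp x * (u (r k) x)\<^sup>2 \<le> (1 + e n) * (?Vp x * (w x)\<^sup>2) + (1 + 1 / e n) * (?Vp x * (u (r k) x - w x)\<^sup>2)"
          by (simp only: distrib_left mult.left_commute)
      qed
      also have "\<dots> = (1 + e n) * P + (1 + 1 / e n) * ?A"
        unfolding P_def using int_w int_uw[of "r k"]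
        by (simp only: Bochner_Integration.integral_add integral_mult_right_zero integrable_mult_right)
      finally have Vm: "(LINT x|lebesgue. ?Vm x * (u (r k) x)\<^sup>2) \<le> (1 + e n) * P + e n - 1"
        using elim(3) V_u[of "r k"] by linarith
      have hp: "(LINT x|lebesgue. ?hp x * \<bar>u (r k) x\<bar> powr p) \<le> e n"
        using hp_le[of "r k"] elim(1) by (simp add: divide_inverse)
      have "u (r k) \<in> K n"
        unfolding K_def using nn hp A Vm
        by (auto simp: uD nn_integral_eq_integral int_hp int_uw int_u ennreal_leI)
      moreover have "(grad_norm (u (r k)))\<^sup>2 \<le> L + \<epsilon>"
        using u_lt[of "r k"] elim(2) by (simp add: inverse_eq_divide)
      moreover have "0 \<le> (LINT x|lebesgue. ?Vm x * (u (r k) x)\<^sup>2)"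
        by (intro integral_nonneg_AE AE_I2 mult_nonneg_nonneg nn) auto
      ultimately show ?case using Vm by linarith
    qed
  qed
  have K_sub: "K n \<subseteq> D12 UNIV" for n by (auto simp: K_def)
  have K_antimono: "K n \<subseteq> K m" if "m \<le> n" for m n
  proof
    fix v assume v: "v \<in> K n"
    have le: "e n \<le> e m" by (rule e_mono[OF that])
    have "(1 + e n) * P + e n - 1 \<le> (1 + e m) * P + e m - 1"
      using P le by (intro diff_right_mono add_mono mult_right_mono) auto
    from ennreal_leI[OF this] ennreal_leI[OF le] show "v \<in> K m"
      using v unfolding K_def mem_Collect_eq by (meson order_trans)
  qed
  have K_mid: "(\<lambda>x. (v x + v' x) / 2) \<in> K n" if v: "v \<in> K n" and v': "v' \<in> K n" for n v v'
  proof -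
    have vD: "v \<in> D12 UNIV" "v' \<in> D12 UNIV" using v v' K_sub by blast+
    note [measurable] = D12_measurable[OF vD(1)] D12_measurable[OF vD(2)]
    have "(\<lambda>x. (v x + v' x) / 2) \<in> D12 UNIV"
      using D12_lincomb[OF N vD, of "1/2" "1/2"] by (simp add: add_divide_distrib)
    moreover have "(\<integral>\<^sup>+x. ennreal (?hp x * \<bar>(v x + v' x) / 2\<bar> powr p) \<partial>lebesgue) \<le> ennreal (e n)"
    proof (rule nn_integral_midpoint_le[where f = "\<lambda>x. ?hp x * \<bar>v x\<bar> powr p" and g = "\<lambda>x. ?hp x * \<bar>v' x\<bar> powr p"])
      show "?hp x * \<bar>(v x + v' x) / 2\<bar> powr p \<le> (?hp x * \<bar>v x\<bar> powr p + ?hp x * \<bar>v' x\<bar> powr p) / 2" for x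
        using mult_left_mono[OF powr_midpoint_le[of p "v x" "v' x"] nn(1)[of x]] p by (simp add: distrib_left)
    qed (use v v' nn in \<open>auto simp: K_def\<close>)
    moreover have "(\<integral>\<^sup>+x. ennreal (?Vp x * ((v x + v' x) / 2 - w x)\<^sup>2) \<partial>lebesgue) \<le> ennreal (e n)"
    proof (rule nn_integral_midpoint_le[where f = "\<lambda>x. ?Vp x * (v x - w x)\<^sup>2" and g = "\<lambda>x. ?Vp x * (v' x - w x)\<^sup>2"])
      show "?Vp x * ((v x + v' x) / 2 - w x)\<^sup>2 \<le> (?Vp x * (v x - w x)\<^sup>2 + ?Vp x * (v' x - w x)\<^sup>2) / 2" for x
      proof -
        have eq: "(v x + v' x) / 2 - w x = ((v x - w x) + (v' x - w x)) / 2" by (simp add: field_simps)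
        show ?thesis
          using mult_left_mono[OF square_midpoint_le[of "v x - w x" "v' x - w x"] nn(3)[of x]]
          unfolding eq by (simp only: times_divide_eq_right distrib_left)
      qed
    qed (use v v' nn in \<open>auto simp: K_def\<close>)
    moreover have "(\<integral>\<^sup>+x. ennreal (?Vm x * ((v x + v' x) / 2)\<^sup>2) \<partial>lebesgue) \<le> ennreal ((1 + e n) * P + e n - 1)"
    proof (rule nn_integral_midpoint_le[where f = "\<lambda>x. ?Vm x * (v x)\<^sup>2" and g = "\<lambda>x. ?Vm x * (v' x)\<^sup>2"])
      show "?Vm x * ((v x + v' x) / 2)\<^sup>2 \<le> (?Vm x * (v x)\<^sup>2 + ?Vm x * (v' x)\<^sup>2) / 2" for x
        using mult_left_mono[OF square_midpoint_le[of "v x" "v' x"] nn(4)[of x]] by (simp add: distrib_left)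
    qed (use v v' nn in \<open>auto simp: K_def\<close>)
    ultimately show ?thesis unfolding K_def by blast
  qed
  have K_energy: "\<exists>v\<in>K n. (grad_norm v)\<^sup>2 \<le> L + \<epsilon>" if "\<epsilon> > 0" for n \<epsilon>
    using K_mem[OF that, of n] by (auto simp: eventually_sequentially)
  obtain v z where v: "\<And>n. v n \<in> K n" and z: "z \<in> D12 UNIV" and z_le: "(grad_norm z)\<^sup>2 \<le> L"
    and vz: "(\<lambda>n. powr_integral lebesgue ?q (\<lambda>x. v n x - z x)) \<longlonglongrightarrow> 0"
    by (rule nested_energy_minimisation[where K = K, OF N K_sub K_antimono K_mid K_energy]) blast+
  have vD: "v n \<in> D12 UNIV" for n using v K_sub by blast
  have vm[measurable]: "v n \<in> borel_measurable lebesgue" for n by (rule D12_measurable[OF vD])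
  have zm[measurable]: "z \<in> borel_measurable lebesgue" by (rule D12_measurable[OF z])
  obtain s where s: "strict_mono s" and ae: "AE x in lebesgue. (\<lambda>n. v (s n) x) \<longlonglongrightarrow> z x"
    by (rule Lq_convergent_imp_AE_subseq[OF q vm zm vz]) blast
  have es_lim: "(\<lambda>n. e (s n)) \<longlonglongrightarrow> 0" using LIMSEQ_subseq_LIMSEQ[OF e_lim s] by (simp add: o_def)

  have "(\<integral>\<^sup>+x. ennreal (?hp x * \<bar>z x\<bar> powr p) \<partial>lebesgue) \<le> ennreal 0"
  proof (rule Fatou_le)
    show "AE x in lebesgue. (\<lambda>n. ennreal (?hp x * \<bar>v (s n) x\<bar> powr p)) \<longlonglongrightarrow> ennreal (?hp x * \<bar>z x\<bar> powr p)"
      using ae by eventually_elim (use p in \<open>auto intro!: tendsto_ennrealI tendsto_mult tendsto_powr' tendsto_rabs\<close>)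
    show "(\<integral>\<^sup>+x. ennreal (?hp x * \<bar>v (s n) x\<bar> powr p) \<partial>lebesgue) \<le> ennreal (e (s n))" for n
      using v[of "s n"] by (simp add: K_def)
    show "(\<lambda>n. ennreal (e (s n))) \<longlonglongrightarrow> ennreal 0" by (rule tendsto_ennrealI[OF es_lim])
  qed measurable
  then have "AE x in lebesgue. ennreal (?hp x * \<bar>z x\<bar> powr p) = 0"
    by (subst nn_integral_0_iff_AE[symmetric]) auto
  then have z_support: "AE x in lebesgue. x \<notin> {x. h x \<le> 0} \<longrightarrow> z x = 0"
    by eventually_elim (auto simp: ennreal_eq_0_iff pos_part_def mult_le_0_iff)
  have "(\<integral>\<^sup>+x. ennreal (?Vp x * (z x - w x)\<^sup>2) \<partial>lebesgue) \<le> ennreal 0"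
  proof (rule Fatou_le)
    show "AE x in lebesgue. (\<lambda>n. ennreal (?Vp x * (v (s n) x - w x)\<^sup>2)) \<longlonglongrightarrow> ennreal (?Vp x * (z x - w x)\<^sup>2)"
      using ae by eventually_elim (intro tendsto_ennrealI tendsto_intros)
    show "(\<integral>\<^sup>+x. ennreal (?Vp x * (v (s n) x - w x)\<^sup>2) \<partial>lebesgue) \<le> ennreal (e (s n))" for n
      using v[of "s n"] by (simp add: K_def)
    show "(\<lambda>n. ennreal (e (s n))) \<longlonglongrightarrow> ennreal 0" by (rule tendsto_ennrealI[OF es_lim])
  qed measurable
  then have "AE x in lebesgue. ennreal (?Vp x * (z x - w x)\<^sup>2) = 0"
    by (subst nn_integral_0_iff_AE[symmetric]) auto
  then have zw: "AE x in lebesgue. ?Vp x * (w x)\<^sup>2 = ?Vp x * (z x)\<^sup>2"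
    by eventually_elim (use nn(3) in \<open>auto simp: ennreal_eq_0_iff mult_le_0_iff order_antisym_conv\<close>)
  have Vm_le: "(\<integral>\<^sup>+x. ennreal (?Vm x * (z x)\<^sup>2) \<partial>lebesgue) \<le> ennreal ((1 + 0) * P + 0 - 1)"
  proof (rule Fatou_le)
    show "AE x in lebesgue. (\<lambda>n. ennreal (?Vm x * (v (s n) x)\<^sup>2)) \<longlonglongrightarrow> ennreal (?Vm x * (z x)\<^sup>2)"
      using ae by eventually_elim (intro tendsto_ennrealI tendsto_intros)
    show "(\<integral>\<^sup>+x. ennreal (?Vm x * (v (s n) x)\<^sup>2) \<partial>lebesgue) \<le> ennreal ((1 + e (s n)) * P + e (s n) - 1)" for n
      using v[of "s n"] by (simp add: K_def)
    show "(\<lambda>n. ennreal ((1 + e (s n)) * P + e (s n) - 1)) \<longlonglongrightarrow> ennreal ((1 + 0) * P + 0 - 1)"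
      by (intro tendsto_ennrealI tendsto_intros es_lim)
  qed measurable
  \<comment> \<open>The bound in \<open>Vm_le\<close> is truncated at \<open>0\<close>, so \<open>P \<ge> 1\<close> has to come from the approximating sequence.\<close>
  have P1: "0 \<le> (1 + 0) * P + 0 - 1"
  proof (rule LIMSEQ_le_const)
    show "(\<lambda>n. (1 + e n) * P + e n - 1) \<longlonglongrightarrow> (1 + 0) * P + 0 - 1" by (intro tendsto_intros e_lim)
    have "0 \<le> (1 + e n) * P + e n - 1" for n
      using K_mem[of 1 n] by (auto simp: eventually_sequentially)
    then show "\<exists>N. \<forall>n\<ge>N. 0 \<le> (1 + e n) * P + e n - 1" by blast
  qed
  have int_Vp: "integrable lebesgue (\<lambda>x. ?Vp x * (z x)\<^sup>2)"
    by (rule integrable_cong_AE_imp[OF int_w _ zw]) measurable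
  have Vp_eq: "(LINT x|lebesgue. ?Vp x * (z x)\<^sup>2) = P"
    unfolding P_def using zw by (intro integral_cong_AE) (measurable, auto elim!: eventually_mono)
  have int_Vm: "integrable lebesgue (\<lambda>x. ?Vm x * (z x)\<^sup>2)"
    using Vm_le nn by (intro integrableI_nonneg) (auto intro: le_less_trans)
  have "ennreal (LINT x|lebesgue. ?Vm x * (z x)\<^sup>2) \<le> ennreal ((1 + 0) * P + 0 - 1)"
    using Vm_le nn by (subst nn_integral_eq_integral[OF int_Vm, symmetric]) auto
  then have Vm_le': "(LINT x|lebesgue. ?Vm x * (z x)\<^sup>2) \<le> P - 1"
    using P1 by (simp add: ennreal_le_iff)
  define S where "S = (LINT x|lebesgue. V x * (z x)\<^sup>2)"
  have "S = (LINT x|lebesgue. ?Vp x * (z x)\<^sup>2 - ?Vm x * (z x)\<^sup>2)"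
    by (simp add: S_def Vsplit(1) left_diff_distrib)
  also have "\<dots> = P - (LINT x|lebesgue. ?Vm x * (z x)\<^sup>2)"
    using int_Vp int_Vm Vp_eq by simp
  finally have S: "S \<ge> 1" using Vm_le' by linarith
  \<comment> \<open>Rescaling to \<open>\<integral>V u\<^sup>2 = 1\<close> divides the energy by \<open>S \<ge> 1\<close>.\<close>
  define c where "c = 1 / sqrt S"
  have c2: "c\<^sup>2 = 1 / S" using S by (simp add: c_def power_divide)
  have "(\<lambda>x. c * z x) \<in> D12 UNIV" using D12_lincomb[OF N z z, of c 0] by simp
  then have 1: "(\<lambda>x. c * z x) \<in> D12 {x. h x \<le> 0}"
    unfolding D12_iff[of _ "{x. h x \<le> 0}"] using z_support by (auto elim!: eventually_mono)
  have "integrable lebesgue (\<lambda>x. c\<^sup>2 * (?Vp x * (z x)\<^sup>2 + ?Vm x * (z x)\<^sup>2))"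
    by (intro integrable_mult_right Bochner_Integration.integrable_add int_Vp int_Vm)
  then have 2: "(\<lambda>x. c * z x) \<in> Lq 2 (\<lambda>x. \<bar>V x\<bar>)"
    by (simp add: Lq_def Vsplit(2) power_mult_distrib algebra_simps)
  have "(LINT x|lebesgue. V x * \<bar>c * z x\<bar>\<^sup>2) = (LINT x|lebesgue. c\<^sup>2 * (V x * (z x)\<^sup>2))"
    by (simp add: power_mult_distrib mult.left_commute)
  also have "\<dots> = c\<^sup>2 * S" unfolding S_def by (rule integral_mult_right_zero)
  also have "\<dots> = 1" using S by (simp add: c2)
  finally have 3: "(LINT x|lebesgue. V x * \<bar>c * z x\<bar>\<^sup>2) = 1" .
  have "(grad_norm (\<lambda>x. c * z x))\<^sup>2 = c\<^sup>2 * (grad_norm z)\<^sup>2"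
    by (rule grad_norm_power2_cmult[OF D12_finite_energy[OF z]])
  also have "\<dots> \<le> 1 * (grad_norm z)\<^sup>2"
    using S by (intro mult_right_mono) (auto simp: c2)
  also have "\<dots> \<le> L" using z_le by simp
  finally have "(grad_norm (\<lambda>x. c * z x))\<^sup>2 \<le> L" .
  then show thesis using 1 2 3 by (intro that[of "\<lambda>x. c * z x"]) (auto simp: admissible_def)
qed

section \<open>Convergence of the principal eigenvalues\<close>

lemma abs_penalised_weight:
  "\<mu> \<ge> 0 \<Longrightarrow> \<bar>\<mu> * pos_part h x - neg_part h x\<bar> = \<mu> * pos_part h x + neg_part h x"
  by (cases "h x \<ge> 0") (auto simp: pos_part_def neg_part_def)

lemma penalised_weight_measurable:
  fixes h :: "real ^ 'n \<Rightarrow> real"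
  assumes "continuous_on UNIV h"
  shows "(\<lambda>x. \<mu> * pos_part h x - neg_part h x) \<in> borel_measurable lebesgue"
proof -
  have [measurable]: "h \<in> borel_measurable lebesgue" by (rule borel_measurable_continuous_lebesgue[OF assms])
  show ?thesis unfolding pos_part_def neg_part_def by measurable
qed

text \<open>On functions that vanish where \<open>h > 0\<close> the weight reduces to \<open>- h\<^sup>-\<close>, so they satisfy the penalised constraint.\<close>
lemma lambda1_k_le_lambda1:
  fixes h V :: "real ^ 'n \<Rightarrow> real"
  assumes sub: "D12 UNIV \<subseteq> Lq p (neg_part h)" and h: "continuous_on UNIV h"
  shows "lambda1_k p UNIV V (\<lambda>x. \<mu> * pos_part h x - neg_part h x) \<le> lambda1 {x. h x \<le> 0} V"
  unfolding lambda1_k_def lambda1_def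
proof (rule INF_superset_mono)
  show "admissible {x. h x \<le> 0} V \<subseteq> admissible_k p UNIV V (\<lambda>x. \<mu> * pos_part h x - neg_part h x)"
  proof
    fix u assume u: "u \<in> admissible {x. h x \<le> 0} V"
    let ?k = "\<lambda>x. \<mu> * pos_part h x - neg_part h x"
    have uD: "u \<in> D12 UNIV" and supp: "AE x in lebesgue. x \<notin> {x. h x \<le> 0} \<longrightarrow> u x = 0"
      using u D12_iff[of u "{x. h x \<le> 0}"] by (auto simp: admissible_def)
    have um[measurable]: "u \<in> borel_measurable lebesgue" by (rule D12_measurable[OF uD])
    have km[measurable]: "?k \<in> borel_measurable lebesgue" by (rule penalised_weight_measurable[OF h])
    have int: "integrable lebesgue (\<lambda>x. neg_part h x * \<bar>u x\<bar> powr p)"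
      using sub uD by (auto simp: Lq_def)
    have eq1: "AE x in lebesgue. neg_part h x * \<bar>u x\<bar> powr p = \<bar>?k x\<bar> * \<bar>u x\<bar> powr p"
      using supp by eventually_elim (force simp: pos_part_def neg_part_def)
    have eq2: "AE x in lebesgue. ?k x * \<bar>u x\<bar> powr p = - (neg_part h x * \<bar>u x\<bar> powr p)"
      using supp by eventually_elim (force simp: pos_part_def neg_part_def)
    have "integrable lebesgue (\<lambda>x. \<bar>?k x\<bar> * \<bar>u x\<bar> powr p)"
      by (rule integrable_cong_AE_imp[OF int _ eq1]) measurable
    moreover have "(LINT x|lebesgue. ?k x * \<bar>u x\<bar> powr p) = (LINT x|lebesgue. - (neg_part h x * \<bar>u x\<bar> powr p))"
      using eq2 borel_measurable_integrable[OF int] by (intro integral_cong_AE) auto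
    moreover have "(LINT x|lebesgue. - (neg_part h x * \<bar>u x\<bar> powr p)) \<le> 0"
      by (simp add: integral_nonneg_AE neg_part_def pos_part_def)
    ultimately show "u \<in> admissible_k p UNIV V ?k"
      using u uD um by (simp add: admissible_k_def admissible_def Lq_def)
  qed
qed simp

text \<open>For \<open>\<mu> \<ge> 0\<close> the absolute values of the weights increase with \<open>\<mu>\<close>, so the integrability condition gets stronger too.\<close>
lemma lambda1_k_mono:
  fixes h V :: "real ^ 'n \<Rightarrow> real"
  assumes h: "continuous_on UNIV h" and \<mu>: "0 \<le> \<mu>" "\<mu> \<le> \<mu>'"
  shows "lambda1_k p UNIV V (\<lambda>x. \<mu> * pos_part h x - neg_part h x)
    \<le> lambda1_k p UNIV V (\<lambda>x. \<mu>' * pos_part h x - neg_part h x)"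
  unfolding lambda1_k_def
proof (rule INF_superset_mono)
  let ?k = "\<lambda>\<mu> x. \<mu> * pos_part h x - neg_part h x"
  show "admissible_k p UNIV V (?k \<mu>') \<subseteq> admissible_k p UNIV V (?k \<mu>)"
  proof
    fix u assume u: "u \<in> admissible_k p UNIV V (?k \<mu>')"
    have um[measurable]: "u \<in> borel_measurable lebesgue" using u by (auto simp: admissible_k_def Lq_def)
    have km[measurable]: "?k \<nu> \<in> borel_measurable lebesgue" for \<nu> by (rule penalised_weight_measurable[OF h])
    have int: "integrable lebesgue (\<lambda>x. \<bar>?k \<mu>' x\<bar> * \<bar>u x\<bar> powr p)"
      using u by (auto simp: admissible_k_def Lq_def)
    have nn: "0 \<le> pos_part h x" "0 \<le> neg_part h x" for x by (auto simp: pos_part_def neg_part_def)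
    have le: "\<mu> * pos_part h x \<le> \<mu>' * pos_part h x" for x by (intro mult_right_mono \<mu> nn)
    then have "\<bar>?k \<mu> x\<bar> \<le> \<bar>?k \<mu>' x\<bar>" for x using \<mu> by (simp add: abs_penalised_weight)
    then have bound: "\<bar>?k \<mu> x\<bar> * \<bar>u x\<bar> powr p \<le> \<bar>?k \<mu>' x\<bar> * \<bar>u x\<bar> powr p" for x by (intro mult_right_mono) auto
    have 1: "integrable lebesgue (\<lambda>x. \<bar>?k \<mu> x\<bar> * \<bar>u x\<bar> powr p)"
      by (rule Bochner_Integration.integrable_bound[OF int]) (measurable, use bound in \<open>auto simp: abs_mult\<close>)
    have 2: "integrable lebesgue (\<lambda>x. ?k \<nu> x * \<bar>u x\<bar> powr p)" if "integrable lebesgue (\<lambda>x. \<bar>?k \<nu> x\<bar> * \<bar>u x\<bar> powr p)" for \<nu>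
      by (rule Bochner_Integration.integrable_bound[OF that]) (measurable, auto simp: abs_mult)
    have "(LINT x|lebesgue. ?k \<mu> x * \<bar>u x\<bar> powr p) \<le> (LINT x|lebesgue. ?k \<mu>' x * \<bar>u x\<bar> powr p)"
      using le by (intro integral_mono 2 1 int mult_right_mono) auto
    also have "\<dots> \<le> 0" using u by (simp add: admissible_k_def)
    finally show "u \<in> admissible_k p UNIV V (?k \<mu>)"
      using u 1 by (simp add: admissible_k_def Lq_def)
  qed
qed simp

theorem theorem1p6:
  fixes h V :: "real ^ 'n \<Rightarrow> real" and p :: real
  assumes "CARD('n) \<ge> 3" and "p > 2"
    and "continuous_on UNIV h" and "continuous_on UNIV V"
    and "\<exists>x. pos_part V x \<noteq> 0" and "\<exists>x. pos_part h x \<noteq> 0"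
    and "compactly_embedded (D12 UNIV) grad_norm (Lq p (neg_part h)) (Lq_norm p (neg_part h))"
    and "compactly_embedded
           (D12 UNIV \<inter> Lq p (pos_part h)) (\<lambda>u. grad_norm u + Lq_norm p (pos_part h) u)
           (Lq 2 (pos_part V)) (Lq_norm 2 (pos_part V))"
    and "\<bar>lambda1_k p UNIV V h\<bar> \<noteq> \<infinity>"
  shows "((\<lambda>\<mu>::real. lambda1_k p UNIV V (\<lambda>x. \<mu> * pos_part h x - neg_part h x))
            \<longlongrightarrow> lambda1 {x. h x \<le> 0} V) at_top
         \<and> (lambda1 {x. h x \<le> 0} V < \<infinity> \<longrightarrow> lambda1_attained {x. h x \<le> 0} V)"
proof -
  define f where "f \<mu> = lambda1_k p UNIV V (\<lambda>x. \<mu> * pos_part h x - neg_part h x)" for \<mu> :: real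
  define \<Lambda> where "\<Lambda> = lambda1 {x. h x \<le> 0} V"
  have sub: "D12 UNIV \<subseteq> Lq p (neg_part h)" using assms(7) unfolding compactly_embedded_def by blast
  have f_le: "f \<mu> \<le> \<Lambda>" for \<mu> unfolding f_def \<Lambda>_def by (rule lambda1_k_le_lambda1[OF sub assms(3)])
  have f_mono: "f \<mu> \<le> f \<mu>'" if "0 \<le> \<mu>" "\<mu> \<le> \<mu>'" for \<mu> \<mu>'
    unfolding f_def by (rule lambda1_k_mono[OF assms(3) that])
  have f_nonneg: "0 \<le> f \<mu>" for \<mu> unfolding f_def lambda1_k_def by (intro INF_greatest) simp
  have core: "\<exists>u\<in>admissible {x. h x \<le> 0} V. (grad_norm u)\<^sup>2 \<le> L" if "\<And>n. f (real (Suc n)) \<le> ereal L" for L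
    by (rule penalised_bound_imp_admissible[OF assms(1-4,7,8) that[unfolded f_def]]) blast
  have \<Lambda>_lower: "\<Lambda> \<le> ereal ((grad_norm u)\<^sup>2)" if "u \<in> admissible {x. h x \<le> 0} V" for u
    unfolding \<Lambda>_def lambda1_def by (rule INF_lower[OF that])
  have "(f \<longlongrightarrow> \<Lambda>) at_top"
  proof (rule order_tendstoI)
    fix a assume a: "a < \<Lambda>"
    have "\<exists>n. a < f (real (Suc n))"
    proof (rule ccontr)
      assume "\<nexists>n. a < f (real (Suc n))"
      then have le: "f (real (Suc n)) \<le> a" for n by (simp add: not_less)
      then have "0 \<le> a" using f_nonneg order_trans by blast
      then obtain L where L: "a = ereal L" using a by (cases a) auto
      then obtain u where u: "u \<in> admissible {x. h x \<le> 0} V" "(grad_norm u)\<^sup>2 \<le> L" using core le by blast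
      then have "\<Lambda> \<le> a" using \<Lambda>_lower[OF u(1)] L by (simp add: order_trans[OF \<Lambda>_lower])
      then show False using a by simp
    qed
    then obtain n where n: "a < f (real (Suc n))" by blast
    show "\<forall>\<^sub>F \<mu> in at_top. a < f \<mu>"
      using eventually_ge_at_top[of "real (Suc n)"]
    proof eventually_elim
      case (elim \<mu>)
      show ?case using n f_mono[OF _ elim] by (simp add: order.strict_trans2)
    qed
  next
    fix a assume "\<Lambda> < a"
    then show "\<forall>\<^sub>F \<mu> in at_top. f \<mu> < a" using f_le by (intro always_eventually allI) (rule order.strict_trans1)
  qed
  moreover have "lambda1_attained {x. h x \<le> 0} V" if finite: "\<Lambda> < \<infinity>"
  proof -
    have "0 \<le> \<Lambda>" using f_nonneg[of 0] f_le[of 0] by (rule order_trans)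
    then obtain L where L: "\<Lambda> = ereal L" using finite by (cases \<Lambda>) auto
    then obtain u where u: "u \<in> admissible {x. h x \<le> 0} V" "(grad_norm u)\<^sup>2 \<le> L"
      using core[of L] f_le by metis
    then have "\<Lambda> = ereal ((grad_norm u)\<^sup>2)" using \<Lambda>_lower[OF u(1)] L by (intro antisym) auto
    then show ?thesis using u(1) unfolding lambda1_attained_def \<Lambda>_def by blast
  qed
  ultimately show ?thesis unfolding f_def[abs_def] \<Lambda>_def by blast
qed

end
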